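(* Let $d,k$ be integers with $2\le k<d$, and let $p,q,r$ be real numbers with $2 \leq p \leq d+1$, $p \leq r \leq \frac{p(d-1)}{p-2}$ (when $p=2$ the upper bound is read as $r<\infty$), and $\frac{pr}{p+r} \leq q \leq r$. Let $\alpha\in\mathbb{R}$ and suppose there is a constant $C$ such that for all $0<\delta\le\frac12$ and all $f\in L^p(\mathbb{R}^{d-1})$, $$\|\mathcal{M}^{k-1}_\delta f\|_{L^q(G(d-1,k-1))} \leq C\, \delta^{-\frac{\alpha}{p}} \|f\|_{L^p(\mathbb{R}^{d-1})}.$$ Then for every $\epsilon>0$, setting $$\tilde{\alpha} = \frac{r \alpha}{p+r} + \epsilon,\qquad \tilde{p} = \frac{p(d-1) + 2r}{p+r},\qquad \tilde{q} = \frac{\tilde{p}\, q(p+r)}{pr},$$ there is a constant $C'$, independent of $\delta$ and $f$, such that for all $0<\delta\le\frac12$ and all $f\in L^{\tilde p}(\mathbb{R}^d)$, $$\|\mathcal{M}^k_\delta f\|_{L^{\tilde{q}}(G(d,k))} \leq C'\, \delta^{-\frac{\tilde{\alpha}}{\tilde{p}}} \|f\|_{L^{\tilde{p}}(\mathbb{R}^d)}.$$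
   Context: For integers $1\le m<n$, $G(n,m)$ is the Grassmannian of $m$-dimensional linear subspaces of $\mathbb{R}^n$, equipped with its unique $O(n)$-invariant Radon probability measure; $L^q(G(n,m))$ is taken with respect to this measure. For $L\in G(n,m)$, $a\in\mathbb{R}^n$ and $\delta>0$, the $\delta$-plate $L_\delta(a)$ is the $\delta$-neighborhood in $\mathbb{R}^n$ of $B(a,\frac12)\cap(L+a)$. With $\mathcal{L}^n$ denoting Lebesgue measure on $\mathbb{R}^n$, for a function $f$ on $\mathbb{R}^n$, $$\mathcal{M}^m_\delta[f](L) = \sup_{a\in\mathbb{R}^n}\frac{1}{\mathcal{L}^n(L_\delta(a))}\int_{L_\delta(a)} f(y)\,dy.$$ *)

theory Defs
  imports "HOL-Analysis.Analysis"
begin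

definition grassmannian :: "nat \<Rightarrow> 'a::euclidean_space set set" where
  "grassmannian m = {L. subspace L \<and> dim L = m}"

text \<open>For a linear subspace \<open>L\<close>, \<open>closest_point L\<close> is the orthogonal projection onto \<open>L\<close>,
  a bounded linear map by the lemma below. \<open>grass_dist\<close> is the usual operator-norm distance
  of the orthogonal projections.\<close>

definition grass_dist :: "'a::euclidean_space set \<Rightarrow> 'a set \<Rightarrow> real" where
  "grass_dist L L' = norm (Blinfun (closest_point L) - Blinfun (closest_point L'))"

lemma bounded_linear_closest_point:
  fixes L :: "'a::euclidean_space set"
  assumes "subspace L"
  shows "bounded_linear (closest_point L)"
proof -
  have cl: "closed L" "L \<noteq> {}" "convex L"
    using assms closed_subspace subspace_0 subspace_imp_convex by blast+
  have inL: "closest_point L x \<in> L" for x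
    using cl closest_point_in_set by blast
  have orth: "(x - closest_point L x) \<bullet> v = 0" if "v \<in> L" for x v
  proof -
    have "(x - closest_point L x) \<bullet> (w - closest_point L x) \<le> 0" if "w \<in> L" for w
      using closest_point_dot[OF cl(3) cl(1) that] .
    from this[of "closest_point L x + v"] this[of "closest_point L x - v"]
    show ?thesis
      using subspace_add[OF assms inL[of x] that] subspace_diff[OF assms inL[of x] that] by simp
  qed
  have uniq: "y = closest_point L x" if "y \<in> L" "\<And>v. v \<in> L \<Longrightarrow> (x - y) \<bullet> v = 0" for x y
  proof -
    have "y - closest_point L x \<in> L"
      by (rule subspace_diff[OF assms that(1) inL])
    then have "(y - closest_point L x) \<bullet> (y - closest_point L x) = 0"
      using that(2)[of "y - closest_point L x"] orth[of "y - closest_point L x" x]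
      by (simp add: inner_diff_left)
    then show ?thesis by simp
  qed
  have "linear (closest_point L)"
  proof (rule linearI)
    show "closest_point L (x + y) = closest_point L x + closest_point L y" for x y
    proof (rule uniq[symmetric])
      show "closest_point L x + closest_point L y \<in> L"
        using assms inL by (rule subspace_add) (rule inL)
      show "(x + y - (closest_point L x + closest_point L y)) \<bullet> v = 0" if "v \<in> L" for v
        using orth[OF that, of x] orth[OF that, of y]
        by (simp add: inner_diff_left inner_add_left)
    qed
    show "closest_point L (c *\<^sub>R x) = c *\<^sub>R closest_point L x" for c x
    proof (rule uniq[symmetric])
      show "c *\<^sub>R closest_point L x \<in> L"
        using assms inL by (rule subspace_scale)
      show "(c *\<^sub>R x - c *\<^sub>R closest_point L x) \<bullet> v = 0" if "v \<in> L" for v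
        using orth[OF that, of x] by (simp add: inner_diff_left)
    qed
  qed
  then show ?thesis
    by (simp add: linear_conv_bounded_linear)
qed

lemma Metric_space_grassmannian: "Metric_space (grassmannian m) grass_dist"
proof
  show "0 \<le> grass_dist L L'" for L L' :: "'a set"
    by (simp add: grass_dist_def)
  show "grass_dist L L' = grass_dist L' L" for L L' :: "'a set"
    by (simp add: grass_dist_def norm_minus_commute)
  show "grass_dist L L'' \<le> grass_dist L L' + grass_dist L' L''" for L L' L'' :: "'a set"
    unfolding grass_dist_def
    by (simp only: dist_norm[symmetric] dist_triangle)
  show "grass_dist L L' = 0 \<longleftrightarrow> L = L'"
    if "L \<in> grassmannian m" "L' \<in> grassmannian m" for L L' :: "'a set"
  proof
    assume "grass_dist L L' = 0"
    then have "Blinfun (closest_point L) = Blinfun (closest_point L')"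
      by (simp add: grass_dist_def)
    then have eq: "blinfun_apply (Blinfun (closest_point L)) = blinfun_apply (Blinfun (closest_point L'))"
      by (rule arg_cong)
    have "subspace L" "subspace L'"
      using that by (auto simp: grassmannian_def)
    note ap = this[THEN bounded_linear_closest_point, THEN bounded_linear_Blinfun_apply]
    have "closest_point L = closest_point L'"
      using eq by (simp only: ap)
    moreover have mem: "x \<in> K \<longleftrightarrow> closest_point K x = x" if "subspace K" for x and K :: "'a set"
      using closest_point_refl[of K x] closed_subspace[OF that] subspace_0[OF that] by blast
    ultimately show "L = L'"
      using mem[OF \<open>subspace L\<close>] mem[OF \<open>subspace L'\<close>] by (intro set_eqI) (simp only:)
  qed (simp add: grass_dist_def)
qed

definition grass_topology :: "nat \<Rightarrow> 'a::euclidean_space set topology" where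
  "grass_topology m = Metric_space.mtopology (grassmannian m) grass_dist"

text \<open>An \<open>O(n)\<close>-invariant Radon probability measure on the Borel sets of the Grassmannian;
  the last clause is inner regularity by compact sets.\<close>

definition invariant_radon_prob :: "nat \<Rightarrow> 'a::euclidean_space set measure \<Rightarrow> bool" where
  "invariant_radon_prob m M \<longleftrightarrow>
     sets M = sigma_sets (grassmannian m) {U. openin (grass_topology m) U} \<and>
     emeasure M (space M) = 1 \<and>
     (\<forall>g. orthogonal_transformation g \<longrightarrow>
        (\<forall>A \<in> sets M. emeasure M ((\<lambda>L. g ` L) ` A) = emeasure M A)) \<and>
     (\<forall>A \<in> sets M. emeasure M A =
        (SUP K \<in> {K. compactin (grass_topology m) K \<and> K \<subseteq> A}. emeasure M K))"

definition grassmann_measure :: "nat \<Rightarrow> 'a::euclidean_space set measure" where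
  "grassmann_measure m = (THE M. invariant_radon_prob m M)"

text \<open>The plate is the open \<open>\<delta>\<close>-neighborhood.\<close>

definition plate :: "real \<Rightarrow> 'a::euclidean_space set \<Rightarrow> 'a \<Rightarrow> 'a set" where
  "plate \<delta> L a = (\<Union>x \<in> cball a (1/2) \<inter> (+) a ` L. ball x \<delta>)"

text \<open>For \<open>f\<close> in some \<open>L\<^sup>p\<close> with \<open>1 \<le> p < \<infinity>\<close>, the averages are bounded uniformly in \<open>a\<close>
  (all plates of given \<open>L\<close> and \<open>\<delta>\<close> have the same measure), so the real supremum is the true one.\<close>

definition plate_maximal :: "real \<Rightarrow> ('a::euclidean_space \<Rightarrow> real) \<Rightarrow> 'a set \<Rightarrow> real" where
  "plate_maximal \<delta> f L =
     (SUP a. 1 / measure lebesgue (plate \<delta> L a) * (LINT y : plate \<delta> L a | lebesgue. f y))"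

definition Lp_space :: "'b measure \<Rightarrow> real \<Rightarrow> ('b \<Rightarrow> real) set" where
  "Lp_space M p = {f \<in> borel_measurable M. integrable M (\<lambda>x. \<bar>f x\<bar> powr p)}"

text \<open>To be used for \<open>f \<in> Lp_space M p\<close>; otherwise the Bochner integral may be the default \<open>0\<close>.\<close>

definition Lp_norm :: "'b measure \<Rightarrow> real \<Rightarrow> ('b \<Rightarrow> real) \<Rightarrow> real" where
  "Lp_norm M p f = (LINT x|M. \<bar>f x\<bar> powr p) powr (1 / p)"

end

theory Submission
  imports Defs
begin

text \<open>A \<open>k\<close>-plane containing a direction \<open>v\<close> is spanned by \<open>v\<close> and a \<open>(k-1)\<close>-plane of the orthogonal
  hyperplane, and the average of \<open>f\<close> over a \<open>k\<close>-plate is at most a constant times the average of the X-ray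
  transform of \<open>f\<close> in direction \<open>v\<close> over a \<open>(k-1)\<close>-plate. The invariant measure on the Grassmannian fibres
  over the directions \<open>v\<close>, so the hypothesis on each fibre, followed by Jensen's inequality, reduces the theorem
  for bounded \<open>f\<close> supported in a ball to a mixed norm bound for the X-ray transform. That bound follows by
  Hoelder's inequality on lines from the trivial one on \<open>L\<^sup>2\<close> and the endpoint \<open>L\<^bsup>(d+1)/2\<^esup> \<rightarrow> L\<^bsup>d+1\<^esup>\<close>, which is
  obtained from a reversed Hardy--Littlewood--Sobolev inequality on the line and polar coordinates. Since
  \<open>q' \<ge> p'\<close>, averaging over the balls that contain a given plate removes the support condition.\<close>

subsection \<open>Integral inequalities\<close>

text \<open>Put \<rho> = r/p, R = d - 1 + 2 \<rho> and t = r/R. The X-ray transform takes L^p' with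
  p' = R/(1+\<rho>) into L^R over directions of L^(R/\<rho>) over lines, while a fibre asks for L^p.
  The gap is closed by Jensen on each plate, with the hypothesis applied to the power 1/t of the
  transform; this needs t \<le> 1, which is the upper bound on r. The bound q \<le> r is what Jensen
  over directions needs, and pr/(p+r) \<le> q is where q' \<ge> p' comes from. Working in a ball is
  forced by the L^2 bound, whose constant is the length of the segment cut from a line. Two
  obstacles shape the rest. The measure on the Grassmannian is a definite description, so existence
  and uniqueness come before any integral can be computed, and uniqueness then identifies the fibred
  law. The maximal function is a supremum over uncountably many centres; it is replaced by suprema
  over a countable dense set in the extended nonnegative reals, where Fubini and Fatou need no
  integrability.\<close>

lemma nn_integral_Holder:
  fixes u w :: "'a \<Rightarrow> real"
  assumes [measurable]: "u \<in> borel_measurable M" "w \<in> borel_measurable M"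
    and nonneg: "\<And>x. 0 \<le> u x" "\<And>x. 0 \<le> w x"
    and u: "(\<integral>\<^sup>+x. ennreal (u x) \<partial>M) \<le> ennreal A" and w: "(\<integral>\<^sup>+x. ennreal (w x) \<partial>M) \<le> ennreal B"
    and AB: "0 \<le> A" "0 \<le> B" and ab: "0 \<le> \<alpha>" "0 \<le> \<beta>" "\<alpha> + \<beta> = 1"
  shows "(\<integral>\<^sup>+x. ennreal (u x powr \<alpha> * w x powr \<beta>) \<partial>M) \<le> ennreal (A powr \<alpha> * B powr \<beta>)"
proof -
  \<comment> \<open>If a bound vanishes, so does its function almost everywhere, and the convention
    \<open>0 powr 0 = 0\<close> makes both sides 0 even for a zero exponent. Otherwise Young's
    inequality is integrated for the normalised \<open>u / A\<close> and
    \<open>w / B\<close>.\<close>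
  consider "A = 0" | "B = 0" | "0 < A" "0 < B" using AB by fastforce
  then show ?thesis
  proof cases
    case 1
    then have "AE x in M. u x \<le> 0"
      using u by (simp add: nn_integral_0_iff_AE ennreal_eq_0_iff)
    then have "AE x in M. u x = 0" by eventually_elim (use nonneg in \<open>simp add: order_antisym\<close>)
    then have "AE x in M. ennreal (u x powr \<alpha> * w x powr \<beta>) = 0" by eventually_elim simp
    then show ?thesis by (subst nn_integral_0_iff_AE[THEN iffD2]) auto
  next
    case 2
    then have "AE x in M. w x \<le> 0"
      using w by (simp add: nn_integral_0_iff_AE ennreal_eq_0_iff)
    then have "AE x in M. w x = 0" by eventually_elim (use nonneg in \<open>simp add: order_antisym\<close>)
    then have "AE x in M. ennreal (u x powr \<alpha> * w x powr \<beta>) = 0" by eventually_elim simp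
    then show ?thesis by (subst nn_integral_0_iff_AE[THEN iffD2]) auto
  next
    case 3
    define c where "c = A powr \<alpha> * B powr \<beta>"
    have c: "0 < c" using 3 by (simp add: c_def)
    have pw: "u x powr \<alpha> * w x powr \<beta> \<le> c * \<alpha> / A * u x + c * \<beta> / B * w x" for x
    proof (cases "u x = 0 \<or> w x = 0")
      case True
      then show ?thesis using c 3 nonneg[of x] ab by (auto intro!: add_nonneg_nonneg mult_nonneg_nonneg divide_nonneg_nonneg)
    next
      case False
      then have pos: "0 < u x" "0 < w x" using nonneg[of x] by auto
      have "(u x / A) powr \<alpha> * (w x / B) powr \<beta> \<le> \<alpha> * (u x / A) + \<beta> * (w x / B)"
        using pos 3 ab by (intro Youngs_inequality_0) auto
      then have "c * ((u x / A) powr \<alpha> * (w x / B) powr \<beta>) \<le> c * (\<alpha> * (u x / A) + \<beta> * (w x / B))"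
        using c by (intro mult_left_mono) auto
      then show ?thesis using pos 3 by (simp add: c_def powr_divide field_simps)
    qed
    have "(\<integral>\<^sup>+x. ennreal (u x powr \<alpha> * w x powr \<beta>) \<partial>M) \<le>
        (\<integral>\<^sup>+x. ennreal (c * \<alpha> / A) * ennreal (u x) + ennreal (c * \<beta> / B) * ennreal (w x) \<partial>M)"
      using pw c 3 nonneg ab
      by (intro nn_integral_mono) (simp add: ennreal_mult[symmetric] ennreal_plus[symmetric] del: ennreal_plus)
    also have "\<dots> = ennreal (c * \<alpha> / A) * (\<integral>\<^sup>+x. u x \<partial>M) + ennreal (c * \<beta> / B) * (\<integral>\<^sup>+x. w x \<partial>M)"
      by (simp add: nn_integral_add nn_integral_cmult)
    also have "\<dots> \<le> ennreal (c * \<alpha> / A) * ennreal A + ennreal (c * \<beta> / B) * ennreal B"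
      using u w by (intro add_mono mult_left_mono) auto
    also have "\<dots> = ennreal (c * \<alpha> + c * \<beta>)"
      using 3 c ab by (simp add: ennreal_mult[symmetric] ennreal_plus[symmetric] del: ennreal_plus)
    also have "c * \<alpha> + c * \<beta> = c" using ab by (metis distrib_left mult.right_neutral)
    finally show ?thesis by (simp add: c_def)
  qed
qed

lemma nn_integral_abs_inverse_power_tail:
  assumes "1 \<le> m" "0 < c"
  shows "(\<integral>\<^sup>+t. ennreal (1 / \<bar>t\<bar> ^ (m+1)) * indicator {t. c \<le> \<bar>t\<bar>} t \<partial>lborel) = ennreal (2 / (m * c ^ m))"
proof -
  let ?I = "\<integral>\<^sup>+t. ennreal (1 / \<bar>t\<bar> ^ (m+1)) * indicator {c..} t \<partial>lborel"
  have "?I = (\<integral>\<^sup>+t. ennreal (1 / t ^ (m+1)) * indicator {c..} t \<partial>lborel)"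
    using assms by (intro nn_integral_cong) (auto simp: indicator_def)
  also have "\<dots> = ennreal (0 - (- (1 / m) * inverse c ^ m))"
  proof (rule nn_integral_FTC_atLeast)
    fix x assume "c \<le> x"
    then have x: "0 < x" using assms by simp
    have "((\<lambda>x. - (1 / m) * inverse x ^ m) has_real_derivative
       - (1 / m) * (of_nat m * (- (inverse x * 1 * inverse x) * inverse x ^ (m - Suc 0)))) (at x)"
      using x by (intro DERIV_cmult DERIV_power DERIV_inverse' DERIV_ident) auto
    moreover have "- (1 / m) * (of_nat m * (- (inverse x * 1 * inverse x) * inverse x ^ (m - Suc 0))) = 1 / x ^ (m + 1)"
      using x assms by (cases m) (auto simp: field_simps)
    ultimately show "((\<lambda>x. - (1 / m) * inverse x ^ m) has_real_derivative 1 / x ^ (m + 1)) (at x)"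
      by simp
    show "0 \<le> 1 / x ^ (m+1)" using x by simp
  next
    have "((\<lambda>x. inverse (x::real) ^ m) \<longlongrightarrow> 0 ^ m) at_top"
      by (intro tendsto_power tendsto_inverse_0_at_top filterlim_ident)
    then have "((\<lambda>x. - (1 / real m) * inverse (x::real) ^ m) \<longlongrightarrow> - (1 / real m) * 0 ^ m) at_top"
      by (intro tendsto_mult tendsto_const)
    then show "((\<lambda>x. - (1 / real m) * inverse (x::real) ^ m) \<longlongrightarrow> 0) at_top"
      using assms by (simp add: zero_power)
  qed simp
  finally have I: "?I = ennreal (1 / (m * c ^ m))" by (simp add: field_simps)
  have "(\<integral>\<^sup>+t. ennreal (1 / \<bar>t\<bar> ^ (m+1)) * indicator {t. c \<le> \<bar>t\<bar>} t \<partial>lborel) =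
     (\<integral>\<^sup>+t. ennreal (1 / \<bar>t\<bar> ^ (m+1)) * indicator {c..} t + ennreal (1 / \<bar>-t\<bar> ^ (m+1)) * indicator {c..} (-t) \<partial>lborel)"
    using assms by (intro nn_integral_cong) (auto simp: indicator_def)
  also have "\<dots> = ?I + (\<integral>\<^sup>+t. ennreal (1 / \<bar>-t\<bar> ^ (m+1)) * indicator {c..} (-t) \<partial>lborel)"
    by (intro nn_integral_add) auto
  also have "(\<integral>\<^sup>+t. ennreal (1 / \<bar>-t\<bar> ^ (m+1)) * indicator {c..} (-t) \<partial>lborel) = ?I"
    by (subst (2) nn_integral_real_affine[of _ "-1" 0]) auto
  also have "?I + ?I = ennreal (2 / (m * c ^ m))"
    using assms unfolding I by (subst ennreal_plus[symmetric]) auto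
  finally show ?thesis .
qed

lemma nn_integral_lborel_scaleR:
  fixes G :: "'a::euclidean_space \<Rightarrow> ennreal"
  assumes [measurable]: "G \<in> borel_measurable borel" and "c \<noteq> 0"
  shows "(\<integral>\<^sup>+z. G z \<partial>lborel) = ennreal (\<bar>c\<bar> ^ DIM('a)) * (\<integral>\<^sup>+v. G (c *\<^sub>R v) \<partial>lborel)"
proof -
  have "(\<integral>\<^sup>+z. G z \<partial>lborel) = (\<integral>\<^sup>+z. G z \<partial>density (distr lborel borel (\<lambda>x. 0 + c *\<^sub>R x)) (\<lambda>_. ennreal (\<bar>c\<bar> ^ DIM('a))))"
    using lborel_affine[OF assms(2), of "0::'a"] by simp
  also have "\<dots> = ennreal (\<bar>c\<bar> ^ DIM('a)) * (\<integral>\<^sup>+v. G (c *\<^sub>R v) \<partial>lborel)"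
    by (subst nn_integral_density) (auto simp: nn_integral_distr nn_integral_cmult)
  finally show ?thesis .
qed

text \<open>Polar coordinates without a surface measure: the direction is \<open>sgn v\<close> for
  \<open>v\<close> in the unit ball. Rescaling \<open>u\<close> by \<open>norm v\<close> turns the
  point into u v; for fixed u the dilation z = u v maps the ball onto norm z \<le> |u|; the
  remaining integral of |u|^-(d+1) over |u| \<ge> norm z cancels the factor (norm z)^d up to 2/d.
  The 2 is there because u runs over both signs.\<close>

lemma polar_coordinates_lborel:
  fixes G :: "'a::euclidean_space \<Rightarrow> ennreal"
  assumes [measurable]: "G \<in> borel_measurable borel"
  defines "d \<equiv> DIM('a)"
  shows "(\<integral>\<^sup>+v. (\<integral>\<^sup>+u. G (u *\<^sub>R sgn v) * ennreal (\<bar>u\<bar> ^ (d - 1)) \<partial>lborel) * indicator (cball 0 1) v \<partial>lborel)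
     = ennreal (2 / d) * (\<integral>\<^sup>+z. G z \<partial>lborel)"
proof -
  have [measurable]: "cball (0::'a) 1 \<in> sets borel" by simp
  have d: "1 \<le> d" using DIM_positive[where 'a='a] by (simp add: d_def Suc_leI)
  have *: "(\<integral>\<^sup>+u. G (u *\<^sub>R sgn v) * ennreal (\<bar>u\<bar> ^ (d - 1)) \<partial>lborel)
     = (\<integral>\<^sup>+u. G (u *\<^sub>R v) * ennreal (\<bar>u\<bar> ^ (d - 1) * norm v ^ d) \<partial>lborel)" if "v \<noteq> 0" for v :: 'a
  proof -
    have "(\<integral>\<^sup>+u. G (u *\<^sub>R sgn v) * ennreal (\<bar>u\<bar> ^ (d - 1)) \<partial>lborel)
       = ennreal (norm v) * (\<integral>\<^sup>+u. G ((norm v * u) *\<^sub>R sgn v) * ennreal (\<bar>norm v * u\<bar> ^ (d - 1)) \<partial>lborel)"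
      using that by (subst nn_integral_real_affine[of _ "norm v" 0]) auto
    also have "\<dots> = (\<integral>\<^sup>+u. ennreal (norm v) * (G ((norm v * u) *\<^sub>R sgn v) * ennreal (\<bar>norm v * u\<bar> ^ (d - 1))) \<partial>lborel)"
      by (rule nn_integral_cmult[symmetric]) measurable
    also have "\<dots> = (\<integral>\<^sup>+u. G (u *\<^sub>R v) * ennreal (\<bar>u\<bar> ^ (d - 1) * norm v ^ d) \<partial>lborel)"
    proof (intro nn_integral_cong)
      fix u
      have "(norm v * u) *\<^sub>R sgn v = u *\<^sub>R v" using that by (simp add: sgn_div_norm)
      moreover have "norm v * (\<bar>norm v * u\<bar> ^ (d - 1)) = \<bar>u\<bar> ^ (d - 1) * norm v ^ d"
        using d by (cases d) (auto simp: abs_mult power_mult_distrib)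
      ultimately show "ennreal (norm v) * (G ((norm v * u) *\<^sub>R sgn v) * ennreal (\<bar>norm v * u\<bar> ^ (d - 1))) =
        G (u *\<^sub>R v) * ennreal (\<bar>u\<bar> ^ (d - 1) * norm v ^ d)"
        by (metis (no_types, lifting) ennreal_mult' mult.left_commute norm_ge_zero)
    qed
    finally show ?thesis .
  qed
  have "(\<integral>\<^sup>+v. (\<integral>\<^sup>+u. G (u *\<^sub>R sgn v) * ennreal (\<bar>u\<bar> ^ (d - 1)) \<partial>lborel) * indicator (cball 0 1) v \<partial>lborel)
     = (\<integral>\<^sup>+v. (\<integral>\<^sup>+u. G (u *\<^sub>R v) * ennreal (\<bar>u\<bar> ^ (d - 1) * norm v ^ d) * indicator (cball 0 1) v \<partial>lborel) \<partial>lborel)"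
  proof (intro nn_integral_cong_AE, use AE_lborel_singleton[of "0::'a"] in eventually_elim)
    case (elim v)
    then show ?case by (subst *) (auto simp: nn_integral_multc)
  qed
  also have "\<dots> = (\<integral>\<^sup>+u. (\<integral>\<^sup>+v. G (u *\<^sub>R v) * ennreal (\<bar>u\<bar> ^ (d - 1) * norm v ^ d) * indicator (cball 0 1) v \<partial>lborel) \<partial>lborel)"
    by (rule lborel_pair.Fubini') measurable
  also have "\<dots> = (\<integral>\<^sup>+u. (\<integral>\<^sup>+z. G z * ennreal (norm z ^ d) * (ennreal (1 / \<bar>u\<bar> ^ (d + 1)) * indicator {u. norm z \<le> \<bar>u\<bar>} u) \<partial>lborel) \<partial>lborel)"
  proof (intro nn_integral_cong_AE, use AE_lborel_singleton[of "0::real"] in eventually_elim)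
    case (elim u)
    let ?H = "\<lambda>z. G z * ennreal (norm z ^ d) * (ennreal (1 / \<bar>u\<bar> ^ (d + 1)) * indicator {z. norm z \<le> \<bar>u\<bar>} z)"
    have "(\<integral>\<^sup>+z. G z * ennreal (norm z ^ d) * (ennreal (1 / \<bar>u\<bar> ^ (d + 1)) * indicator {u. norm z \<le> \<bar>u\<bar>} u) \<partial>lborel)
      = (\<integral>\<^sup>+z. ?H z \<partial>lborel)" by (intro nn_integral_cong) (auto simp: indicator_def)
    also have "\<dots> = ennreal (\<bar>u\<bar> ^ d) * (\<integral>\<^sup>+v. ?H (u *\<^sub>R v) \<partial>lborel)"
      unfolding d_def using elim by (intro nn_integral_lborel_scaleR) auto
    also have "\<dots> = (\<integral>\<^sup>+v. ennreal (\<bar>u\<bar> ^ d) * ?H (u *\<^sub>R v) \<partial>lborel)"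
      by (rule nn_integral_cmult[symmetric]) measurable
    also have "\<dots> = (\<integral>\<^sup>+v. G (u *\<^sub>R v) * ennreal (\<bar>u\<bar> ^ (d - 1) * norm v ^ d) * indicator (cball 0 1) v \<partial>lborel)"
    proof (intro nn_integral_cong)
      fix v :: 'a
      have i: "indicator {z. norm z \<le> \<bar>u\<bar>} (u *\<^sub>R v) = (indicator (cball 0 1) v :: ennreal)"
        using elim by (auto simp: indicator_def field_simps)
      have "\<bar>u\<bar> ^ d * (norm (u *\<^sub>R v) ^ d * (1 / \<bar>u\<bar> ^ (d + 1))) = \<bar>u\<bar> ^ (d - 1) * norm v ^ d"
        using elim d by (cases d) (auto simp: power_mult_distrib field_simps)
      then have "ennreal (\<bar>u\<bar> ^ d) * (ennreal (norm (u *\<^sub>R v) ^ d) * ennreal (1 / \<bar>u\<bar> ^ (d + 1))) = ennreal (\<bar>u\<bar> ^ (d - 1) * norm v ^ d)"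
        by (simp add: ennreal_mult[symmetric] del: norm_scaleR)
      moreover have "a * (g * n * (p * j)) = g * (a * (n * p)) * j" for a g n p j :: ennreal
        by (simp only: ac_simps)
      ultimately show "ennreal (\<bar>u\<bar> ^ d) * ?H (u *\<^sub>R v) = G (u *\<^sub>R v) * ennreal (\<bar>u\<bar> ^ (d - 1) * norm v ^ d) * indicator (cball 0 1) v"
        unfolding i by (simp only:)
    qed
    finally show ?case ..
  qed
  also have "\<dots> = (\<integral>\<^sup>+z. (\<integral>\<^sup>+u. G z * ennreal (norm z ^ d) * (ennreal (1 / \<bar>u\<bar> ^ (d + 1)) * indicator {u. norm z \<le> \<bar>u\<bar>} u) \<partial>lborel) \<partial>lborel)"
    by (rule lborel_pair.Fubini') (unfold indicator_def mem_Collect_eq, measurable)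
  also have "\<dots> = (\<integral>\<^sup>+z. ennreal (2 / d) * G z \<partial>lborel)"
  proof (intro nn_integral_cong_AE, use AE_lborel_singleton[of "0::'a"] in eventually_elim)
    case (elim z)
    have t: "(\<integral>\<^sup>+u. ennreal (1 / \<bar>u\<bar> ^ (d + 1)) * indicator {u. norm z \<le> \<bar>u\<bar>} u \<partial>lborel) = ennreal (2 / (d * norm z ^ d))"
      using elim by (intro nn_integral_abs_inverse_power_tail[OF d]) simp
    have "(\<integral>\<^sup>+u. G z * ennreal (norm z ^ d) * (ennreal (1 / \<bar>u\<bar> ^ (d + 1)) * indicator {u. norm z \<le> \<bar>u\<bar>} u) \<partial>lborel)
      = G z * ennreal (norm z ^ d) * ennreal (2 / (d * norm z ^ d))"
      unfolding t[symmetric] by (rule nn_integral_cmult) (unfold indicator_def mem_Collect_eq, measurable)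
    also have "\<dots> = G z * ennreal (norm z ^ d * (2 / (d * norm z ^ d)))"
      using d by (simp add: mult.assoc ennreal_mult[symmetric])
    also have "norm z ^ d * (2 / (d * norm z ^ d)) = 2 / d" using elim d by (simp add: field_simps)
    finally show ?case by (simp add: mult.commute)
  qed
  also have "\<dots> = ennreal (2 / d) * (\<integral>\<^sup>+z. G z \<partial>lborel)" by (rule nn_integral_cmult) measurable
  finally show ?thesis .
qed

text \<open>Halve the cutoff \<open>H / 2 ^ i\<close> until the mass of the sublevel set first drops
  below \<open>F / 2\<close>. The last cutoff before that is \<open>l\<close>; the factor 1/2 in the
  second estimate is this one dyadic step.\<close>

lemma median_level:
  fixes h :: "'a \<Rightarrow> real"
  assumes [measurable]: "h \<in> borel_measurable M" "S \<in> sets M"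
    and nonneg: "\<And>x. 0 \<le> h x" and bounded: "\<And>x. h x \<le> H"
    and supp: "\<And>x. x \<notin> S \<Longrightarrow> h x = 0" and fin: "emeasure M S < \<infinity>"
    and F: "(\<integral>\<^sup>+x. h x \<partial>M) = ennreal F" "0 < F"
  obtains l where "0 < l"
    "ennreal (F/2) \<le> (\<integral>\<^sup>+x. ennreal (h x) * indicator {x. h x \<le> l} x \<partial>M)"
    "ennreal (F/2) \<le> (\<integral>\<^sup>+x. ennreal (h x) * indicator {x. l / 2 < h x} x \<partial>M)"
proof -
  define I where "I i = (\<integral>\<^sup>+x. ennreal (h x) * indicator {x. h x \<le> H / 2 ^ i} x \<partial>M)" for i :: nat
  define m where "m = measure M S"
  have m: "emeasure M S = ennreal m" "0 \<le> m" using fin by (auto simp: m_def emeasure_eq_ennreal_measure)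
  have H: "0 < H"
  proof (rule ccontr)
    assume "\<not> 0 < H"
    then have "h x = 0" for x using nonneg[of x] bounded[of x] by linarith
    then show False using F by simp
  qed
  have I0: "I 0 = ennreal F"
    unfolding I_def F(1)[symmetric] by (intro nn_integral_cong) (simp add: bounded)
  \<comment> \<open>The mass below the cutoff \<open>H / 2 ^ i\<close> is at most that cutoff times
    the measure of \<open>S\<close>; this index makes it less than \<open>F / 2\<close>, so a least
    such index exists.\<close>
  obtain i where i: "2 * H * (m + 1) / F < 2 ^ i" using real_arch_pow[of 2] by force
  have "I i \<le> (\<integral>\<^sup>+x. ennreal (H / 2 ^ i) * indicator S x \<partial>M)"
    unfolding I_def using supp H by (intro nn_integral_mono) (auto simp: indicator_def ennreal_leI)
  also have "\<dots> = ennreal (H / 2 ^ i * m)"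
    using H m by (simp add: nn_integral_cmult_indicator ennreal_mult[symmetric])
  also have "\<dots> < ennreal (F / 2)"
  proof (rule ennreal_lessI)
    have "2 * H * (m + 1) < 2 ^ i * F" using i F by (simp add: field_simps)
    moreover have "2 * H * m \<le> 2 * H * (m + 1)" using H by simp
    ultimately have "2 * H * m < 2 ^ i * F" by linarith
    then show "H / 2 ^ i * m < F / 2" by (simp add: field_simps)
  qed (use F in simp)
  finally have ex: "\<exists>i. I i < ennreal (F/2)" by blast
  define n where "n = (LEAST i. I i < ennreal (F/2))"
  have n: "I n < ennreal (F/2)" unfolding n_def by (rule LeastI_ex[OF ex])
  have "n \<noteq> 0"
  proof
    assume "n = 0"
    then have "ennreal F < ennreal (F/2)" using n I0 by simp
    then show False using F by (simp add: ennreal_less_iff)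
  qed
  then obtain j where j: "n = Suc j" using not0_implies_Suc by blast
  have Ij: "ennreal (F/2) \<le> I j" using not_less_Least[of j "\<lambda>i. I i < ennreal (F/2)"] j n_def by (simp add: not_less)
  let ?K = "\<integral>\<^sup>+x. ennreal (h x) * indicator {x. H / 2 ^ n < h x} x \<partial>M"
  have sum: "?K + I n = ennreal F"
    unfolding I_def F(1)[symmetric]
    by (subst nn_integral_add[symmetric]) (auto intro!: nn_integral_cong simp: indicator_def)
  have K: "ennreal (F/2) \<le> ?K"
  proof (rule ccontr)
    assume "\<not> ?thesis"
    then have "?K + I n < ennreal (F/2) + ennreal (F/2)" using n by (intro add_strict_mono) (auto simp: not_le)
    also have "\<dots> = ennreal F" using F by (simp add: ennreal_plus[symmetric] del: ennreal_plus)
    finally show False using sum by simp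
  qed
  show ?thesis
  proof (rule that)
    show "0 < H / 2 ^ j" using H by simp
    show "ennreal (F/2) \<le> (\<integral>\<^sup>+x. ennreal (h x) * indicator {x. h x \<le> H / 2 ^ j} x \<partial>M)"
      using Ij by (simp add: I_def)
    show "ennreal (F/2) \<le> (\<integral>\<^sup>+x. ennreal (h x) * indicator {x. H / 2 ^ j / 2 < h x} x \<partial>M)"
      using K by (simp add: j mult.commute)
  qed
qed

text \<open>Above the threshold \<open>k\<close>, write x = x^a x^(1-a) and use 1 - a \<le> 0. The
  intended threshold is A / |s - t|^2 with a = (d+1)/2, for which k^(1-a) is a constant times the
  kernel |s - t|^(d-1).\<close>

lemma le_add_powr_mult_powr:
  fixes x k :: real
  assumes "0 \<le> x" "0 < k" "1 \<le> a"
  shows "x \<le> k + x powr a * k powr (1 - a)"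
proof (cases "x \<le> k")
  case False
  have "x * (k powr (a - 1) * k powr (1 - a)) \<le> x * (x powr (a - 1) * k powr (1 - a))"
    using False assms by (intro mult_left_mono mult_right_mono powr_mono2) auto
  also have "\<dots> = x powr a * k powr (1 - a)"
    using False assms by (simp add: powr_diff)
  finally show ?thesis using assms by (simp add: powr_add[symmetric])
qed (use assms in \<open>simp add: add_increasing2\<close>)

text \<open>The reversed Hardy--Littlewood--Sobolev inequality. Choose a median level \<open>l\<close> of \<open>h\<close>. The half of the mass
  where \<open>h \<le> l\<close> cannot concentrate in an interval shorter than a multiple of \<open>F / l\<close>, so the inner integral has
  a lower bound uniform in \<open>t\<close>; the outer one is then bounded below through the half where \<open>h > l / 2\<close>.\<close>

lemma reverse_HLS_line:
  fixes h :: "real \<Rightarrow> real" and d :: nat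
  assumes [measurable]: "h \<in> borel_measurable borel" "S \<in> sets borel" and d: "1 \<le> d"
    and nonneg: "\<And>x. 0 \<le> h x" and bounded: "\<And>x. h x \<le> H"
    and supp: "\<And>x. x \<notin> S \<Longrightarrow> h x = 0" and fin: "emeasure lborel S < \<infinity>"
    and F: "(\<integral>\<^sup>+x. h x \<partial>lborel) = ennreal F" "0 \<le> F"
  defines "a \<equiv> (real d + 1) / 2"
  shows "ennreal (F ^ (d + 1)) \<le> ennreal (32 ^ d) *
    (\<integral>\<^sup>+t. (\<integral>\<^sup>+s. ennreal (h t powr a * h s powr a * \<bar>s - t\<bar> ^ (d - 1)) \<partial>lborel) \<partial>lborel)"
proof (cases "F = 0")
  case False
  then have F0: "0 < F" using F by simp
  obtain l where l: "0 < l"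
    and lo: "ennreal (F/2) \<le> (\<integral>\<^sup>+x. ennreal (h x) * indicator {x. h x \<le> l} x \<partial>lborel)"
    and hi: "ennreal (F/2) \<le> (\<integral>\<^sup>+x. ennreal (h x) * indicator {x. l / 2 < h x} x \<partial>lborel)"
    using median_level[of h lborel S H F] nonneg bounded supp fin F F0 by auto
  define P where "P = F / 2"
  \<comment> \<open>An interval of radius \<open>r\<close> holds at most 2 r l = P/4 of the mass
    where h \<le> l, and \<open>A\<close> is chosen so that the integral of A / |s - t|^2 beyond
    distance \<open>r\<close> is 2 A / r = P/4. Half of \<open>P\<close> is left for
    \<open>J\<close>.\<close>
  define r where "r = P / (8 * l)"
  define A where "A = P * r / 8"
  define J where "J t = (\<integral>\<^sup>+s. ennreal (h s powr a * \<bar>s - t\<bar> ^ (d - 1)) \<partial>lborel)" for t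
  have J_meas [measurable]: "J \<in> borel_measurable borel" unfolding J_def by measurable
  have pos: "0 < P" "0 < r" "0 < A" using F0 l by (auto simp: P_def r_def A_def)
  have a: "1 \<le> a" using d by (simp add: a_def)
  have J: "ennreal (A powr (a - 1) * P / 2) \<le> J t" for t
  proof -
    have pw: "ennreal (h s) * indicator {s. h s \<le> l} s \<le>
        ennreal l * indicator {t - r..t + r} s +
        (ennreal A * (ennreal (1 / \<bar>s - t\<bar> ^ (1 + 1)) * indicator {u. r \<le> \<bar>u\<bar>} (s - t)) +
        ennreal (A powr (1 - a)) * ennreal (h s powr a * \<bar>s - t\<bar> ^ (d - 1)))" (is "?L \<le> ?B + (?C + ?D)") for s
    proof (cases "\<bar>s - t\<bar> < r")
      case True
      then have "s \<in> {t - r..t + r}" by auto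
      then have "?L \<le> ?B" using l by (auto simp: indicator_def ennreal_leI)
      then show ?thesis by (simp add: add_increasing2)
    next
      case False
      define u where "u = \<bar>s - t\<bar>"
      have u: "0 < u" using False pos by (simp add: u_def)
      have e: "(A / u ^ 2) powr (1 - a) = A powr (1 - a) * u ^ (d - 1)"
      proof -
        have "(u ^ 2) powr (1 - a) = u powr (2 * (1 - a))"
          using u by (simp add: powr_powr flip: powr_numeral)
        also have "2 * (1 - a) = - real (d - 1)" unfolding a_def using d by (simp add: of_nat_diff field_simps)
        also have "u powr (- real (d - 1)) = 1 / u ^ (d - 1)"
          using u by (simp add: powr_minus powr_realpow divide_inverse)
        finally show ?thesis using u pos by (simp add: powr_divide)
      qed
      have "h s \<le> A / u ^ 2 + h s powr a * (A / u ^ 2) powr (1 - a)"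
        using u pos nonneg a by (intro le_add_powr_mult_powr) auto
      also have "\<dots> = A * (1 / u ^ (1 + 1)) + A powr (1 - a) * (h s powr a * u ^ (d - 1))"
        unfolding e by (simp add: power2_eq_square)
      finally have "ennreal (h s) \<le> ennreal (A * (1 / u ^ (1 + 1)) + A powr (1 - a) * (h s powr a * u ^ (d - 1)))"
        by (rule ennreal_leI)
      also have "\<dots> = ennreal A * ennreal (1 / u ^ (1 + 1)) + ennreal (A powr (1 - a)) * ennreal (h s powr a * u ^ (d - 1))"
        using u pos by (simp add: ennreal_mult[symmetric] ennreal_plus[symmetric] del: ennreal_plus)
      finally have "ennreal (h s) \<le> ?C + ?D" using False by (simp add: u_def)
      moreover have "?L \<le> ennreal (h s)" by (simp add: indicator_def)
      moreover have "?C + ?D \<le> ?B + (?C + ?D)" by (rule add_increasing[OF zero_le order_refl])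
      ultimately show ?thesis by (meson order_trans)
    qed
    have "ennreal P \<le> (\<integral>\<^sup>+s. ennreal (h s) * indicator {x. h x \<le> l} s \<partial>lborel)"
      using lo by (simp add: P_def)
    also have "\<dots> \<le> (\<integral>\<^sup>+s. ennreal l * indicator {t - r..t + r} s +
        (ennreal A * (ennreal (1 / \<bar>s - t\<bar> ^ (1 + 1)) * indicator {u. r \<le> \<bar>u\<bar>} (s - t)) +
        ennreal (A powr (1 - a)) * ennreal (h s powr a * \<bar>s - t\<bar> ^ (d - 1))) \<partial>lborel)"
      by (intro nn_integral_mono pw)
    also have "\<dots> = (\<integral>\<^sup>+s. ennreal l * indicator {t - r..t + r} s \<partial>lborel) +
        ((\<integral>\<^sup>+s. ennreal A * (ennreal (1 / \<bar>s - t\<bar> ^ (1 + 1)) * indicator {u. r \<le> \<bar>u\<bar>} (s - t)) \<partial>lborel) +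
        (\<integral>\<^sup>+s. ennreal (A powr (1 - a)) * ennreal (h s powr a * \<bar>s - t\<bar> ^ (d - 1)) \<partial>lborel))"
      by (simp add: nn_integral_add del: nn_integral_const nn_integral_cmult_indicator nn_integral_indicator)
    also have "(\<integral>\<^sup>+s. ennreal l * indicator {t - r..t + r} s \<partial>lborel) = ennreal (P / 4)"
      using pos l by (subst nn_integral_cmult_indicator) (auto simp: r_def ennreal_mult[symmetric])
    also have "(\<integral>\<^sup>+s. ennreal A * (ennreal (1 / \<bar>s - t\<bar> ^ (1 + 1)) * indicator {u. r \<le> \<bar>u\<bar>} (s - t)) \<partial>lborel)
      = ennreal A * (\<integral>\<^sup>+s. ennreal (1 / \<bar>s - t\<bar> ^ (1 + 1)) * indicator {u. r \<le> \<bar>u\<bar>} (s - t) \<partial>lborel)"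
      by (rule nn_integral_cmult) measurable
    also have "(\<integral>\<^sup>+s. ennreal (1 / \<bar>s - t\<bar> ^ (1 + 1)) * indicator {u. r \<le> \<bar>u\<bar>} (s - t) \<partial>lborel) = ennreal (2 / (1 * r ^ 1))"
      by (subst nn_integral_real_affine[of _ 1 t]) (use nn_integral_abs_inverse_power_tail[of 1 r] pos in auto)
    also have "ennreal A * ennreal (2 / (1 * r ^ 1)) = ennreal (P / 4)"
      using pos by (simp add: A_def ennreal_mult[symmetric])
    also have "(\<integral>\<^sup>+s. ennreal (A powr (1 - a)) * ennreal (h s powr a * \<bar>s - t\<bar> ^ (d - 1)) \<partial>lborel) = ennreal (A powr (1 - a)) * J t"
      unfolding J_def by (rule nn_integral_cmult) measurable
    finally have "ennreal P \<le> ennreal (P / 4) + (ennreal (P / 4) + ennreal (A powr (1 - a)) * J t)" .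
    also have "\<dots> = ennreal (P / 2) + ennreal (A powr (1 - a)) * J t"
      using pos by (simp add: add.assoc[symmetric] ennreal_plus[symmetric] del: ennreal_plus)
    finally have "ennreal P - ennreal (P / 2) \<le> ennreal (A powr (1 - a)) * J t"
      by (simp add: ennreal_minus_le_iff)
    then have *: "ennreal (P / 2) \<le> ennreal (A powr (1 - a)) * J t"
      using pos by (simp add: ennreal_minus)
    have "ennreal (A powr (a - 1) * P / 2) = ennreal (A powr (a - 1)) * ennreal (P / 2)"
      using pos by (simp add: ennreal_mult[symmetric])
    also have "\<dots> \<le> ennreal (A powr (a - 1)) * (ennreal (A powr (1 - a)) * J t)"
      using * by (rule mult_left_mono) simp
    also have "\<dots> = J t" using pos by (simp add: mult.assoc[symmetric] ennreal_mult[symmetric] powr_add[symmetric])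
    finally show ?thesis .
  qed
  have pw: "ennreal ((l / 2) powr (a - 1) * (A powr (a - 1) * P / 2)) * (ennreal (h t) * indicator {x. l / 2 < h x} t)
      \<le> ennreal (h t powr a) * J t" for t
  proof (cases "l / 2 < h t")
    case True
    have "(l / 2) powr (a - 1) * h t \<le> h t powr (a - 1) * h t"
      using True l a by (intro mult_right_mono powr_mono2) auto
    also have "\<dots> = h t powr a" using True l by (simp add: powr_diff)
    finally have "ennreal ((l / 2) powr (a - 1) * h t) * ennreal (A powr (a - 1) * P / 2) \<le> ennreal (h t powr a) * J t"
      by (intro mult_mono J ennreal_leI) auto
    then show ?thesis using True pos nonneg[of t] by (simp add: ennreal_mult[symmetric] mult.assoc mult.left_commute mult.commute)
  qed simp
  \<comment> \<open>The level cancels: (l/2) A = P^2/128, which dominates (P/16)^2, and 32 (P/16) =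
    F. The constant therefore depends on \<open>d\<close> only.\<close>
  have c: "F ^ (d + 1) \<le> 32 ^ d * ((l / 2) powr (a - 1) * (A powr (a - 1) * P / 2) * P)"
  proof -
    have "(P / 16) ^ (d - 1) = (P / 16) powr real (d - 1)" using pos by (simp add: powr_realpow)
    also have "\<dots> = ((P / 16) powr 2) powr (a - 1)"
    proof -
      have "2 * (a - 1) = real (d - 1)" unfolding a_def using d by (simp add: of_nat_diff field_simps)
      then show ?thesis by (simp add: powr_powr)
    qed
    also have "\<dots> = (P ^ 2 / 16 ^ 2) powr (a - 1)"
      using pos by (simp add: power_divide)
    also have "\<dots> \<le> (P ^ 2 / 128) powr (a - 1)"
      using pos a by (intro powr_mono2) auto
    also have "\<dots> = (l / 2) powr (a - 1) * A powr (a - 1)"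
      using l pos by (simp add: powr_mult[symmetric] A_def r_def power2_eq_square)
    finally have "(P / 16) ^ (d - 1) * (P / 2 * P) \<le> (l / 2) powr (a - 1) * A powr (a - 1) * (P / 2 * P)"
      using pos by (intro mult_right_mono) auto
    then have "32 ^ d * ((P / 16) ^ (d - 1) * (P / 2 * P)) \<le> 32 ^ d * ((l / 2) powr (a - 1) * A powr (a - 1) * (P / 2 * P))"
      by (intro mult_left_mono) auto
    moreover have "F ^ (d + 1) \<le> 32 ^ d * ((P / 16) ^ (d - 1) * (P / 2 * P))"
    proof -
      obtain n where n: "d = Suc n" using d by (cases d) auto
      have "32 ^ d * ((P / 16) ^ (d - 1) * (P / 2 * P)) = 32 * (32 ^ n * (P / 16) ^ n) * (P / 2 * P)"
        by (simp add: n)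
      also have "32 ^ n * (P / 16) ^ n = F ^ n"
        by (simp only: power_mult_distrib[symmetric]) (simp add: P_def)
      also have "32 * F ^ n * (P / 2 * P) = F ^ n * (4 * F * F)" by (simp add: P_def)
      also have "\<dots> \<ge> F ^ n * (F * F)" using F0 by (intro mult_left_mono) auto
      finally show ?thesis by (simp add: n mult.commute mult.left_commute)
    qed
    ultimately have "F ^ (d + 1) \<le> 32 ^ d * ((l / 2) powr (a - 1) * A powr (a - 1) * (P / 2 * P))"
      by (rule order_trans[rotated])
    then show ?thesis by (simp add: mult.assoc)
  qed
  let ?c = "(l / 2) powr (a - 1) * (A powr (a - 1) * P / 2)"
  have "ennreal (F ^ (d + 1)) \<le> ennreal (32 ^ d * (?c * P))"
    using c by (intro ennreal_leI) (simp add: mult.assoc)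
  also have "\<dots> = ennreal (32 ^ d) * (ennreal ?c * ennreal P)"
    using pos by (simp add: ennreal_mult[symmetric])
  also have "\<dots> \<le> ennreal (32 ^ d) * (ennreal ?c * (\<integral>\<^sup>+t. ennreal (h t) * indicator {x. l / 2 < h x} t \<partial>lborel))"
    using hi by (intro mult_left_mono) (auto simp: P_def)
  also have "\<dots> = ennreal (32 ^ d) * (\<integral>\<^sup>+t. ennreal ?c * (ennreal (h t) * indicator {x. l / 2 < h x} t) \<partial>lborel)"
    by (subst nn_integral_cmult) auto
  also have "\<dots> \<le> ennreal (32 ^ d) * (\<integral>\<^sup>+t. ennreal (h t powr a) * J t \<partial>lborel)"
    by (intro mult_left_mono nn_integral_mono pw) auto
  also have "(\<integral>\<^sup>+t. ennreal (h t powr a) * J t \<partial>lborel) =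
     (\<integral>\<^sup>+t. (\<integral>\<^sup>+s. ennreal (h t powr a * h s powr a * \<bar>s - t\<bar> ^ (d - 1)) \<partial>lborel) \<partial>lborel)"
    unfolding J_def
    by (subst nn_integral_cmult[symmetric]) (auto intro!: nn_integral_cong simp: ennreal_mult'' mult.assoc)
  finally show ?thesis .
qed simp

subsection \<open>Orthogonal projections as matrices\<close>

lemma subspace_closest_point:
  fixes L :: "'a::euclidean_space set"
  assumes L: "subspace L"
  shows closest_point_in_subspace: "closest_point L x \<in> L"
    and closest_point_orthogonal: "v \<in> L \<Longrightarrow> (x - closest_point L x) \<bullet> v = 0"
proof -
  have cl: "closed L" "L \<noteq> {}" "convex L"
    using L closed_subspace subspace_0 subspace_imp_convex by blast+
  show inL: "closest_point L x \<in> L" using cl closest_point_in_set by blast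
  show "(x - closest_point L x) \<bullet> v = 0" if "v \<in> L"
  proof -
    have "closest_point L x + v \<in> L" "closest_point L x - v \<in> L"
      using subspace_add[OF L inL that] subspace_diff[OF L inL that] by auto
    from this[THEN closest_point_dot[OF cl(3,1), of _ x]] show ?thesis by simp
  qed
qed

lemma closest_point_eqI:
  fixes L :: "'a::euclidean_space set"
  assumes L: "subspace L" and y: "y \<in> L" and orth: "\<And>v. v \<in> L \<Longrightarrow> (x - y) \<bullet> v = 0"
  shows "closest_point L x = y"
proof -
  have *: "closest_point L x - y \<in> L"
    by (intro subspace_diff L y closest_point_in_subspace)
  have "(closest_point L x - y) \<bullet> (closest_point L x - y) = 0"
    using orth[OF *] closest_point_orthogonal[OF L *, of x] unfolding inner_diff_left by linarith
  then show ?thesis by simp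
qed

lemma closest_point_subspace_refl: "subspace L \<Longrightarrow> x \<in> L \<Longrightarrow> closest_point L x = x"
  for L :: "'a::euclidean_space set"
  by (rule closest_point_eqI) auto

lemma inner_closest_point:
  fixes L :: "'a::euclidean_space set"
  assumes "subspace L"
  shows "closest_point L x \<bullet> y = closest_point L x \<bullet> closest_point L y"
    and "x \<bullet> closest_point L y = closest_point L x \<bullet> closest_point L y"
proof -
  have "(y - closest_point L y) \<bullet> closest_point L x = 0" "(x - closest_point L x) \<bullet> closest_point L y = 0"
    by (intro closest_point_orthogonal closest_point_in_subspace assms)+
  then have "y \<bullet> closest_point L x = closest_point L y \<bullet> closest_point L x"
    "x \<bullet> closest_point L y = closest_point L x \<bullet> closest_point L y"
    unfolding inner_diff_left by linarith+
  then show "closest_point L x \<bullet> y = closest_point L x \<bullet> closest_point L y"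
    "x \<bullet> closest_point L y = closest_point L x \<bullet> closest_point L y"
    by (simp_all only: inner_commute[of "closest_point L x"])
qed

lemma norm_closest_point_le:
  fixes L :: "'a::euclidean_space set"
  assumes "subspace L"
  shows "norm (closest_point L x) \<le> norm x"
proof -
  have "norm (closest_point L x) ^ 2 = closest_point L x \<bullet> x"
    using inner_closest_point(1)[OF assms, of x x] by (simp add: power2_norm_eq_inner)
  also have "\<dots> \<le> norm (closest_point L x) * norm x" by (rule norm_cauchy_schwarz)
  finally show ?thesis by (cases "closest_point L x = 0") (auto simp: power2_eq_square)
qed

text \<open>Planes are encoded by their projection matrices, so that topology, separability, Borel
  sets and regularity are inherited from the Euclidean space of matrices.\<close>

definition gproj :: "(real^'n) set \<Rightarrow> real^'n^'n" where
  "gproj L = matrix (closest_point L)"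

lemma gproj_works: "subspace L \<Longrightarrow> gproj L *v x = closest_point L x"
  unfolding gproj_def
  by (rule matrix_works, unfold linear_matrix_vector_mul_eq, rule bounded_linear.linear, rule bounded_linear_closest_point)

lemma grassmannianD: "L \<in> grassmannian m \<Longrightarrow> subspace L" "L \<in> grassmannian m \<Longrightarrow> dim L = m"
  by (auto simp: grassmannian_def)

lemma bounded_bilinear_matrix_vector_mult: "bounded_bilinear (\<lambda>(A::real^'n^'m) x. A *v x)"
proof -
  have "bilinear (\<lambda>(A::real^'n^'m) x. A *v x)"
    unfolding bilinear_def
    by (intro conjI allI linearI; rule matrix_vector_right_distrib matrix_vector_mult_add_rdistrib
        matrix_vector_mult_scaleR scaleR_matrix_vector_assoc[symmetric])
  then show ?thesis by (rule bilinear_conv_bounded_bilinear[THEN iffD1])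
qed

lemma borel_measurable_matrix_vector_mult [measurable]:
  fixes f :: "'a \<Rightarrow> real^'n^'m"
  assumes "f \<in> borel_measurable M" "g \<in> borel_measurable M"
  shows "(\<lambda>x. f x *v g x) \<in> borel_measurable M"
proof (rule borel_measurable_continuous_Pair[OF assms])
  show "continuous_on UNIV (\<lambda>x. fst x *v snd x :: real^'m)"
    by (intro bounded_bilinear.continuous_on[OF bounded_bilinear_matrix_vector_mult] continuous_intros)
qed

lemma norm_matrix_le_onorm:
  fixes A :: "real^'n^'n"
  shows "norm A \<le> real CARD('n) ^ 2 * onorm ((*v) A)"
proof -
  have "norm A \<le> (\<Sum>i\<in>UNIV. norm (A $ i))" unfolding norm_vec_def by (rule L2_set_le_sum) simp
  also have "\<dots> \<le> (\<Sum>i\<in>UNIV. \<Sum>j\<in>UNIV. \<bar>A $ i $ j\<bar>)" by (intro sum_mono norm_le_l1_cart)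
  also have "\<dots> \<le> (\<Sum>i::'n\<in>UNIV. \<Sum>j::'n\<in>UNIV. onorm ((*v) A))" by (intro sum_mono matrix_component_le_onorm)
  finally show ?thesis by (simp add: power2_eq_square)
qed

lemma onorm_le_norm_matrix:
  fixes A :: "real^'n^'n"
  shows "onorm ((*v) A) \<le> real CARD('n) ^ 2 * norm A"
proof -
  have "onorm ((*v) A) \<le> (\<Sum>i\<in>UNIV. \<Sum>j\<in>UNIV. \<bar>A $ i $ j\<bar>)" by (rule onorm_le_matrix_component_sum)
  also have "\<dots> \<le> (\<Sum>i::'n\<in>UNIV. \<Sum>j::'n\<in>UNIV. norm A)"
    by (intro sum_mono) (meson Finite_Cartesian_Product.norm_nth_le component_le_norm_cart order_trans)
  finally show ?thesis by (simp add: power2_eq_square)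
qed

lemma grass_dist_gproj:
  assumes "subspace L" "subspace L'"
  shows "grass_dist L L' = onorm ((*v) (gproj L - gproj L'))"
proof -
  have "grass_dist L L' = onorm (blinfun_apply (Blinfun (closest_point L) - Blinfun (closest_point L')))"
    by (simp add: grass_dist_def norm_blinfun.rep_eq)
  also have "blinfun_apply (Blinfun (closest_point L) - Blinfun (closest_point L')) = (*v) (gproj L - gproj L')"
    using assms by (auto simp: minus_blinfun.rep_eq bounded_linear_Blinfun_apply bounded_linear_closest_point
        gproj_works matrix_vector_mult_diff_rdistrib)
  finally show ?thesis .
qed

text \<open>\<open>grass_dist\<close> is the operator norm of the difference of the matrices; it is
  comparable to their Euclidean distance up to the factor \<open>CARD('n) ^ 2\<close> in both
  directions, so both give the same open sets.\<close>

lemma openin_grass_topology: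
  "openin (grass_topology m) U \<longleftrightarrow> (\<exists>V. open V \<and> U = gproj -` V \<inter> (grassmannian m :: (real^'n) set set))"
proof -
  interpret Metric_space "grassmannian m :: (real^'n) set set" grass_dist
    by (rule Metric_space_grassmannian)
  let ?G = "grassmannian m :: (real^'n) set set"
  let ?c = "real CARD('n) ^ 2"
  have c: "0 < ?c" by simp
  have d1: "grass_dist L L' \<le> ?c * dist (gproj L) (gproj L')"
    and d2: "dist (gproj L) (gproj L') \<le> ?c * grass_dist L L'" if "L \<in> ?G" "L' \<in> ?G" for L L'
    using that onorm_le_norm_matrix[of "gproj L - gproj L'"] norm_matrix_le_onorm[of "gproj L - gproj L'"]
    by (auto simp: grass_dist_gproj grassmannianD dist_norm)
  have op: "openin mtopology U \<longleftrightarrow> U \<subseteq> ?G \<and> (\<forall>x\<in>U. \<exists>r>0. \<forall>y\<in>?G. grass_dist x y < r \<longrightarrow> y \<in> U)"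
  proof -
    have b: "(mball x r \<subseteq> U) = (\<forall>y. y \<in> ?G \<longrightarrow> grass_dist x y < r \<longrightarrow> y \<in> U)"
      if "U \<subseteq> ?G" "x \<in> U" for x r
      using that by (auto simp: subset_eq in_mball)
    show ?thesis
      by (cases "U \<subseteq> ?G") (simp_all add: openin_mtopology Ball_def b)
  qed
  show ?thesis unfolding grass_topology_def op
  proof (rule iffI; elim conjE exE)
    assume U: "U \<subseteq> ?G" "\<forall>x\<in>U. \<exists>r>0. \<forall>y\<in>?G. grass_dist x y < r \<longrightarrow> y \<in> U"
    then obtain r where r: "\<And>x. x \<in> U \<Longrightarrow> 0 < r x" "\<And>x y. x \<in> U \<Longrightarrow> y \<in> ?G \<Longrightarrow> grass_dist x y < r x \<Longrightarrow> y \<in> U"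
      by metis
    define V where "V = (\<Union>x\<in>U. ball (gproj x) (r x / ?c))"
    have "open V" by (auto simp: V_def)
    moreover have "U = gproj -` V \<inter> ?G"
    proof (rule antisym; rule subsetI)
      fix x assume "x \<in> U"
      moreover have "gproj x \<in> ball (gproj x) (r x / ?c)" using r(1)[OF \<open>x \<in> U\<close>] c by simp
      ultimately show "x \<in> gproj -` V \<inter> ?G" using U(1) unfolding V_def by blast
    next
      fix y assume "y \<in> gproj -` V \<inter> ?G"
      then obtain x where y: "y \<in> ?G" and x: "x \<in> U" "dist (gproj x) (gproj y) < r x / ?c"
        by (auto simp: V_def)
      have "grass_dist x y \<le> ?c * dist (gproj x) (gproj y)" using d1 x y U(1) by blast
      also have "\<dots> < r x" using x c by (simp add: field_simps)
      finally show "y \<in> U" using r(2) x y by blast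
    qed
    ultimately show "\<exists>V. open V \<and> U = gproj -` V \<inter> ?G" by blast
  next
    fix V assume V: "open V" "U = gproj -` V \<inter> ?G"
    have "\<exists>r>0. \<forall>y\<in>?G. grass_dist x y < r \<longrightarrow> y \<in> U" if x: "x \<in> U" for x
    proof -
      obtain e where e: "0 < e" "ball (gproj x) e \<subseteq> V" using open_contains_ball V x by blast
      show ?thesis
      proof (intro exI[of _ "e / ?c"] conjI ballI impI)
        show "0 < e / ?c" using e c by simp
        fix y assume y: "y \<in> ?G" "grass_dist x y < e / ?c"
        have "dist (gproj x) (gproj y) \<le> ?c * grass_dist x y" using d2 x y V by blast
        also have "\<dots> < e" using y c by (simp add: field_simps)
        finally have "gproj y \<in> V" using e by auto
        then show "y \<in> U" using y V by blast
      qed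
    qed
    then show "U \<subseteq> ?G \<and> (\<forall>x\<in>U. \<exists>r>0. \<forall>y\<in>?G. grass_dist x y < r \<longrightarrow> y \<in> U)"
      using V by blast
  qed
qed

subsection \<open>The Borel structure of the Grassmannian\<close>

text \<open>Only the sigma-algebra matters here. Being initial along \<open>gproj\<close>, it makes
  a plane-valued map measurable as soon as its projection matrix is.\<close>

definition grass_borel :: "nat \<Rightarrow> (real^'n) set measure" where
  "grass_borel m = vimage_algebra (grassmannian m) gproj borel"

lemma space_grass_borel [simp]: "space (grass_borel m) = grassmannian m"
  by (simp add: grass_borel_def)

lemma grass_borel_eq_sigma: "grass_borel m = sigma (grassmannian m) {gproj -` V \<inter> grassmannian m |V. open V}"
proof -
  have "vimage_algebra (grassmannian m) gproj (sigma UNIV {S :: (real^'n^'n) set. open S})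
      = sigma (grassmannian m) {gproj -` A \<inter> grassmannian m | A. A \<in> {S. open S}}"
    by (rule vimage_algebra_sigma) auto
  then show ?thesis by (simp add: grass_borel_def borel_def)
qed

lemma sets_grass_borel:
  "sets (grass_borel m :: (real^'n) set measure) = sigma_sets (grassmannian m) {U. openin (grass_topology m) U}"
proof -
  have "{gproj -` V \<inter> (grassmannian m :: (real^'n) set set) |V. open V} = {U. openin (grass_topology m) U}"
    unfolding openin_grass_topology by blast
  moreover have "sets (grass_borel m :: (real^'n) set measure) = sigma_sets (grassmannian m) {gproj -` V \<inter> grassmannian m |V. open V}"
    unfolding grass_borel_eq_sigma by (rule sets_measure_of) auto
  ultimately show ?thesis by (simp only:)
qed

lemma sets_grass_borel_iff: "A \<in> sets (grass_borel m) \<longleftrightarrow> (\<exists>B\<in>sets borel. A = gproj -` B \<inter> grassmannian m)"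
  unfolding grass_borel_def by (subst sets_vimage_algebra2) (simp, blast)

lemma measurable_gproj [measurable]: "gproj \<in> borel_measurable (grass_borel m)"
  unfolding grass_borel_def by (rule measurable_vimage_algebra1) auto

lemma measurable_grass_borelI:
  assumes "\<And>x. x \<in> space N \<Longrightarrow> f x \<in> grassmannian m" "(\<lambda>x. gproj (f x)) \<in> borel_measurable N"
  shows "f \<in> measurable N (grass_borel m)"
  unfolding grass_borel_def using assms by (intro measurable_vimage_algebra2) auto

lemma measurable_closest_point_grass [measurable]:
  fixes f :: "'a \<Rightarrow> (real^'n) set"
  assumes [measurable]: "f \<in> measurable M (grass_borel m)" "g \<in> borel_measurable M"
  shows "(\<lambda>x. closest_point (f x) (g x)) \<in> borel_measurable M"
proof -
  have "(\<lambda>x. gproj (f x) *v g x) \<in> borel_measurable M" by measurable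
  moreover have "gproj (f x) *v g x = closest_point (f x) (g x)" if "x \<in> space M" for x
    using measurable_space[OF assms(1) that] by (simp add: gproj_works grassmannianD)
  ultimately show ?thesis by (rule measurable_cong[THEN iffD1, rotated])
qed

text \<open>Projections onto constructed planes are known through their action on vectors; testing
  on the axes recovers the entries.\<close>

lemma borel_measurable_matrixI:
  fixes f :: "'a \<Rightarrow> real^'n^'m"
  assumes "\<And>x. (\<lambda>w. f w *v x) \<in> borel_measurable M"
  shows "f \<in> borel_measurable M"
proof -
  have "(\<lambda>w. f w $ i $ j) \<in> borel_measurable M" for i j
  proof -
    have "(\<lambda>w. (f w *v axis j 1) $ i) \<in> borel_measurable M"
      by (intro borel_measurable_continuous_on[OF _ assms] continuous_intros)
    then show ?thesis by (simp add: matrix_vector_mult_basis column_def)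
  qed
  then show ?thesis
    by (subst borel_measurable_euclidean_space) (auto simp: Basis_vec_def inner_axis)
qed

subsection \<open>The orthogonal group acting on the Grassmannian\<close>

text \<open>Transitivity of the orthogonal group: an isometry of \<open>L\<close> onto
  \<open>L'\<close> is glued, along the orthogonal projection, to an isometry of the complements,
  whose dimensions agree. Pythagoras makes the sum norm preserving.\<close>

lemma orthogonal_transformation_between_subspaces:
  fixes L L' :: "'a::euclidean_space set"
  assumes L: "subspace L" "subspace L'" "dim L = dim L'"
  obtains h where "orthogonal_transformation h" "h ` L = L'"
proof -
  define C where "C K = {y \<in> UNIV. \<forall>x\<in>K. orthogonal x y}" for K :: "'a set"
  have C: "subspace (C K)" for K
    unfolding C_def by (auto simp: subspace_def orthogonal_def inner_add_right)
  have "dim (C K) + dim K = dim (UNIV :: 'a set)" if "subspace K" for K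
    unfolding C_def using that by (intro dim_subspace_orthogonal_to_vectors) auto
  from this[OF L(1)] this[OF L(2)] have d: "dim (C L) = dim (C L')" using L(3) by simp
  obtain f where f: "linear f" "f ` L = L'" "\<And>x. x \<in> L \<Longrightarrow> norm (f x) = norm x"
    using isometry_subspaces[OF L] by metis
  obtain g where g: "linear g" "g ` C L = C L'" "\<And>x. x \<in> C L \<Longrightarrow> norm (g x) = norm x"
    using isometry_subspaces[OF C C d] by metis
  let ?P = "closest_point L"
  have P: "linear ?P" using bounded_linear_closest_point[OF L(1)] bounded_linear.linear by blast
  have PL: "?P x \<in> L" for x by (rule closest_point_in_subspace[OF L(1)])
  have PC: "x - ?P x \<in> C L" for x
    using closest_point_orthogonal[OF L(1)] by (auto simp: C_def orthogonal_def inner_commute)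
  define h where "h x = f (?P x) + g (x - ?P x)" for x
  have "linear h"
    unfolding h_def
    by (intro linear_compose_add linear_compose[OF P f(1), unfolded o_def]
        linear_compose[OF linear_compose_sub[OF linear_ident P] g(1), unfolded o_def])
  moreover have "norm (h x) = norm x" for x
  proof -
    have 1: "f (?P x) \<in> L'" using f(2) PL by blast
    have 2: "g (x - ?P x) \<in> C L'" using g(2) PC by blast
    have "orthogonal (f (?P x)) (g (x - ?P x))" using 1 2 by (auto simp: C_def)
    then have "norm (h x) ^ 2 = norm (?P x) ^ 2 + norm (x - ?P x) ^ 2"
      by (simp only: h_def norm_add_Pythagorean f(3)[OF PL] g(3)[OF PC])
    also have "\<dots> = norm (?P x + (x - ?P x)) ^ 2"
      using PL[of x] PC[of x] by (intro norm_add_Pythagorean[symmetric]) (auto simp: C_def)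
    finally show ?thesis by simp
  qed
  ultimately have "orthogonal_transformation h" by (simp add: orthogonal_transformation)
  moreover have "h x = f x" if "x \<in> L" for x
    using that closest_point_subspace_refl[OF L(1) that] linear_0[OF g(1)] by (simp add: h_def)
  then have "h ` L = L'" using f(2) by (metis image_cong)
  ultimately show ?thesis by (rule that)
qed

lemma orthogonal_transformation_image_grassmannian:
  fixes g :: "'a::euclidean_space \<Rightarrow> 'a"
  assumes g: "orthogonal_transformation g" and L: "L \<in> grassmannian m"
  shows "g ` L \<in> grassmannian m"
proof -
  have "linear g" "inj g" using g orthogonal_transformation_linear orthogonal_transformation_inj by blast+
  then have "dim (g ` L) = dim L" by (intro dim_image_eq) (auto intro: inj_on_subset)
  then show ?thesis
    using L \<open>linear g\<close> by (auto simp: grassmannian_def linear_subspace_image)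
qed

lemma closest_point_orthogonal_transformation:
  fixes L :: "'a::euclidean_space set" and g :: "'a \<Rightarrow> 'a"
  assumes g: "orthogonal_transformation g" and L: "subspace L"
  shows "closest_point (g ` L) (g x) = g (closest_point L x)"
proof (rule closest_point_eqI)
  have lin: "linear g" using g orthogonal_transformation_linear by blast
  show "subspace (g ` L)" using lin L by (rule linear_subspace_image)
  show "g (closest_point L x) \<in> g ` L" using closest_point_in_subspace[OF L] by blast
  fix v assume "v \<in> g ` L"
  then obtain w where w: "w \<in> L" "v = g w" by blast
  have "(g x - g (closest_point L x)) \<bullet> v = g (x - closest_point L x) \<bullet> g w"
    by (simp only: w(2) linear_diff[OF lin])
  also have "\<dots> = (x - closest_point L x) \<bullet> w" using g by (simp only: orthogonal_transformation_def)
  finally show "(g x - g (closest_point L x)) \<bullet> v = 0" using closest_point_orthogonal[OF L w(1)] by simp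
qed

lemma norm_transpose_matrix: "norm (transpose A) = norm (A :: real^'n^'n)"
  unfolding norm_vec_def L2_set_def transpose_def
  by (simp add: sum_nonneg) (rule sum.swap)

text \<open>The rows of \<open>A ** transpose Q\<close> are the images of the rows of
  \<open>A\<close> under \<open>Q\<close>; transposition gives the other side. Together they make
  the Euclidean distance of projection matrices invariant under the orthogonal group.\<close>

lemma norm_matrix_mult_orthogonal:
  fixes A :: "real^'n^'n"
  assumes "orthogonal_matrix Q"
  shows "norm (A ** transpose Q) = norm A" "norm (Q ** A) = norm A"
proof -
  have *: "norm (A ** transpose Q) = norm A" for A
  proof -
    have "(A ** transpose Q) $ i = Q *v (A $ i)" for i
      by (simp add: vec_eq_iff matrix_matrix_mult_def matrix_vector_mult_def transpose_def mult.commute)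
    moreover have "norm (Q *v y) = norm y" for y
      using assms orthogonal_transformation_matrix[of "(*v) Q"] by (simp add: orthogonal_transformation)
    ultimately show ?thesis by (simp add: norm_vec_def)
  qed
  then show "norm (A ** transpose Q) = norm A" .
  show "norm (Q ** A) = norm A"
    using *[of "transpose A"] norm_transpose_matrix[of "Q ** A"] norm_transpose_matrix[of A]
    by (simp add: matrix_transpose_mul)
qed

lemma gproj_orthogonal_transformation:
  fixes g :: "real^'n \<Rightarrow> real^'n"
  assumes g: "orthogonal_transformation g" and L: "subspace L"
  shows "gproj (g ` L) = matrix g ** gproj L ** transpose (matrix g)"
proof -
  have Q: "orthogonal_matrix (matrix g)" and lin: "linear g"
    using g orthogonal_transformation_matrix by blast+
  have "gproj (g ` L) *v x = matrix g ** gproj L ** transpose (matrix g) *v x" for x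
  proof -
    define y where "y = transpose (matrix g) *v x"
    have g_eq: "g w = matrix g *v w" for w
      using lin by (simp add: matrix_works linear_matrix_vector_mul_eq)
    have "g y = (matrix g ** transpose (matrix g)) *v x"
      by (simp only: y_def g_eq matrix_vector_mul_assoc)
    then have "x = g y" using Q by (simp only: orthogonal_matrix_def matrix_vector_mul_lid)
    moreover have "matrix g ** gproj L ** transpose (matrix g) *v x = g (closest_point L y)"
      by (simp only: y_def g_eq matrix_vector_mul_assoc[symmetric] gproj_works[OF L])
    moreover have "gproj (g ` L) *v (g y) = g (closest_point L y)"
      using closest_point_orthogonal_transformation[OF g L] linear_subspace_image[OF lin L] by (simp add: gproj_works)
    ultimately show ?thesis by simp
  qed
  then show ?thesis by (simp add: matrix_eq)
qed

lemma dist_gproj_orthogonal_transformation: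
  fixes g :: "real^'n \<Rightarrow> real^'n"
  assumes g: "orthogonal_transformation g" and L: "subspace L" "subspace L'"
  shows "dist (gproj (g ` L)) (gproj (g ` L')) = dist (gproj L) (gproj L')"
proof -
  have Q: "orthogonal_matrix (matrix g)"
    using g orthogonal_transformation_matrix by blast
  have "gproj (g ` L) - gproj (g ` L') = matrix g ** (gproj L - gproj L') ** transpose (matrix g)"
    by (simp add: gproj_orthogonal_transformation[OF g] L)
      (simp add: vec_eq_iff matrix_matrix_mult_def left_diff_distrib right_diff_distrib sum_subtractf)
  then show ?thesis
    by (simp add: dist_norm norm_matrix_mult_orthogonal[OF Q])
qed

text \<open>The group acts transitively and by isometries for the matrix distance, so some
  \<open>h\<close> carries one ball onto the other; the reverse inclusion uses the inverse of
  \<open>h\<close>.\<close>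

lemma invariant_ball_measure:
  fixes M :: "(real^'n) set measure"
  assumes sM: "sets M = sets (grass_borel m)"
    and iM: "\<And>g A. orthogonal_transformation g \<Longrightarrow> A \<in> sets M \<Longrightarrow> emeasure M ((\<lambda>L. g ` L) ` A) = emeasure M A"
    and xy: "x \<in> grassmannian m" "y \<in> grassmannian m"
  shows "emeasure M {L \<in> grassmannian m. dist (gproj L) (gproj x) < r}
    = emeasure M {L \<in> grassmannian m. dist (gproj L) (gproj y) < r}"
proof -
  let ?B = "\<lambda>x :: (real^'n) set. {L \<in> grassmannian m. dist (gproj L) (gproj x) < r}"
  obtain h where h: "orthogonal_transformation h" "h ` x = y"
    using orthogonal_transformation_between_subspaces[of x y] xy by (auto simp: grassmannian_def)
  have B: "?B z \<in> sets M" for z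
    unfolding sM sets_grass_borel_iff
    by (rule bexI[of _ "ball (gproj z) r"]) (auto simp: dist_commute)
  have sub: "(\<lambda>L. g ` L) ` ?B z \<subseteq> ?B (g ` z)" if "orthogonal_transformation g" "z \<in> grassmannian m" for g :: "real^'n \<Rightarrow> real^'n" and z
  proof clarsimp
    fix L assume L: "L \<in> grassmannian m" "dist (gproj L) (gproj z) < r"
    then show "g ` L \<in> grassmannian m \<and> dist (gproj (g ` L)) (gproj (g ` z)) < r"
      using orthogonal_transformation_image_grassmannian[OF that(1) L(1)]
        dist_gproj_orthogonal_transformation[OF that(1) grassmannianD(1)[OF L(1)] grassmannianD(1)[OF that(2)]]
      by simp
  qed
  have surj: "surj h" using h orthogonal_transformation_surj by blast
  have inj: "inj h" using h orthogonal_transformation_inj by blast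
  have "(\<lambda>L. h ` L) ` ?B x = ?B y"
  proof
    show "(\<lambda>L. h ` L) ` ?B x \<subseteq> ?B y" using sub[OF h(1) xy(1)] h(2) by simp
    have "inv h ` y = x" using h(2) inj by (auto simp: image_image)
    then have "(\<lambda>L. inv h ` L) ` ?B y \<subseteq> ?B x"
      using sub[OF orthogonal_transformation_inv[OF h(1)] xy(2)] by simp
    moreover have "L = h ` (inv h ` L)" for L using surj by (simp add: image_image surj_f_inv_f)
    ultimately show "?B y \<subseteq> (\<lambda>L. h ` L) ` ?B x" by blast
  qed
  then show ?thesis using iM[OF h(1) B[of x]] by simp
qed

text \<open>Two invariant probability measures give all balls of a given radius the same mass, by Fubini;
  density of balls at the points of an open set and Fatou then compare the measures on open sets.\<close>

lemma invariant_measure_open_le: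
  fixes M N :: "(real^'n) set measure"
  assumes sM: "sets M = sets (grass_borel m)" and sN: "sets N = sets (grass_borel m)"
    and pM: "emeasure M (space M) = 1" and pN: "emeasure N (space N) = 1"
    and iM: "\<And>g A. orthogonal_transformation g \<Longrightarrow> A \<in> sets M \<Longrightarrow> emeasure M ((\<lambda>L. g ` L) ` A) = emeasure M A"
    and iN: "\<And>g A. orthogonal_transformation g \<Longrightarrow> A \<in> sets N \<Longrightarrow> emeasure N ((\<lambda>L. g ` L) ` A) = emeasure N A"
    and U: "open U"
  shows "emeasure M (gproj -` U \<inter> grassmannian m) \<le> emeasure N (gproj -` U \<inter> grassmannian m)"
proof -
  let ?G = "grassmannian m :: (real^'n) set set"
  have sp: "space M = ?G" "space N = ?G" using sM sN by (auto dest: sets_eq_imp_space_eq)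
  interpret M: finite_measure M using pM by (intro finite_measureI) auto
  interpret N: finite_measure N using pN by (intro finite_measureI) auto
  interpret pair_sigma_finite M N by unfold_locales
  have [measurable]: "gproj \<in> borel_measurable M" "gproj \<in> borel_measurable N"
    using measurable_gproj[of m] by (simp_all add: measurable_cong_sets[OF sM refl] measurable_cong_sets[OF sN refl])
  define B where "B r x = {L \<in> ?G. dist (gproj L) (gproj x) < r}" for r x
  have BM [measurable]: "B r x \<in> sets M" and BN [measurable]: "B r x \<in> sets N" for r x
    unfolding sM sN sets_grass_borel_iff B_def
    by (rule bexI[of _ "ball (gproj x) r"]; auto simp: dist_commute)+
  define U' where "U' = gproj -` U \<inter> ?G"
  have U'[measurable]: "U' \<in> sets N" "U' \<in> sets M"
    unfolding sM sN sets_grass_borel_iff U'_def using borel_open[OF U] by (intro bexI[of _ U] refl; assumption)+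
  have "?G \<noteq> {}" using pM sp by auto
  then obtain x0 where x0: "x0 \<in> ?G" by blast
  define hM where "hM r = emeasure M (B r x0)" for r
  define hN where "hN r = emeasure N (B r x0)" for r
  have hM: "emeasure M (B r x) = hM r" if "x \<in> ?G" for r x
    unfolding hM_def B_def by (rule invariant_ball_measure[OF sM iM that x0])
  have hN: "emeasure N (B r x) = hN r" if "x \<in> ?G" for r x
    unfolding hN_def B_def by (rule invariant_ball_measure[OF sN iN that x0])
  define f where "f r A x y = indicator A y * (if dist (gproj y) (gproj x) < r then 1 else 0 :: ennreal)" for r A and x y :: "(real^'n) set"
  have f_meas [measurable]: "case_prod (f r A) \<in> borel_measurable (M \<Otimes>\<^sub>M N)" if [measurable]: "A \<in> sets N" for r A
    unfolding f_def by measurable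
  have f_int: "(\<integral>\<^sup>+y. f r A x y \<partial>N) = emeasure N (A \<inter> B r x)" if A: "A \<in> sets N" for r A x
  proof -
    have "(\<integral>\<^sup>+y. f r A x y \<partial>N) = (\<integral>\<^sup>+y. indicator (A \<inter> B r x) y \<partial>N)"
      by (intro nn_integral_cong) (auto simp: f_def B_def sp indicator_def)
    also have "\<dots> = emeasure N (A \<inter> B r x)" by (rule nn_integral_indicator) (intro sets.Int A BN)
    finally show ?thesis .
  qed
  have meas_int: "(\<lambda>x. emeasure N (A \<inter> B r x)) \<in> borel_measurable M" if A: "A \<in> sets N" for A r
    unfolding f_int[OF A, symmetric] by (rule N.borel_measurable_nn_integral[OF f_meas[OF A]])
  \<comment> \<open>Membership in a ball is symmetric in centre and point, so after exchanging the
    integrals the inner one is the \<open>M\<close>-mass of a ball about \<open>y\<close>, that is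
    \<open>hM r\<close>.\<close>
  have Fub: "(\<integral>\<^sup>+x. emeasure N (A \<inter> B r x) \<partial>M) = hM r * emeasure N A" if A[measurable]: "A \<in> sets N" for A r
  proof -
    have "(\<integral>\<^sup>+x. emeasure N (A \<inter> B r x) \<partial>M) = (\<integral>\<^sup>+x. (\<integral>\<^sup>+y. f r A x y \<partial>N) \<partial>M)"
      by (simp add: f_int A)
    also have "\<dots> = (\<integral>\<^sup>+y. (\<integral>\<^sup>+x. f r A x y \<partial>M) \<partial>N)"
      by (rule Fubini'[OF f_meas, symmetric]) (rule A)
    also have "\<dots> = (\<integral>\<^sup>+y. hM r * indicator A y \<partial>N)"
    proof (rule nn_integral_cong)
      fix y assume "y \<in> space N"
      then have y: "y \<in> ?G" using sp by simp
      have "(\<integral>\<^sup>+x. f r A x y \<partial>M) = (\<integral>\<^sup>+x. indicator A y * indicator (B r y) x \<partial>M)"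
        by (intro nn_integral_cong) (auto simp: f_def B_def sp indicator_def dist_commute)
      also have "\<dots> = indicator A y * hM r" by (simp add: nn_integral_cmult_indicator hM[OF y])
      finally show "(\<integral>\<^sup>+x. f r A x y \<partial>M) = hM r * indicator A y"
        by (simp add: mult.commute)
    qed
    also have "\<dots> = hM r * emeasure N A" by (simp add: nn_integral_cmult_indicator)
    finally show ?thesis .
  qed
  \<comment> \<open>Take the whole Grassmannian for \<open>A\<close>: the left side of
    \<open>Fub\<close> becomes \<open>hN r\<close> and the right side \<open>hM r\<close>, both
    total masses being 1.\<close>
  have eq: "hM r = hN r" for r
  proof -
    have "(\<integral>\<^sup>+x. emeasure N (?G \<inter> B r x) \<partial>M) = hM r * emeasure N ?G"
      using sp by (intro Fub) (metis sets.top)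
    moreover have "?G \<inter> B r x = B r x" for x by (auto simp: B_def)
    moreover have "(\<integral>\<^sup>+x. emeasure N (B r x) \<partial>M) = (\<integral>\<^sup>+x. hN r \<partial>M)"
      by (intro nn_integral_cong) (simp add: hN sp)
    ultimately show ?thesis using pM pN sp by simp
  qed
  \<comment> \<open>If one ball of radius \<open>r\<close> were null, all would be, and by
    separability countably many of them cover the space.\<close>
  have pos: "hN r \<noteq> 0" if r: "0 < r" for r
  proof
    assume 0: "hN r = 0"
    obtain T where T: "countable T" "T \<subseteq> gproj ` ?G" "gproj ` ?G \<subseteq> closure T" using separable by blast
    have "?G \<subseteq> (\<Union>t\<in>T. {L \<in> ?G. dist (gproj L) t < r})"
    proof
      fix L assume L: "L \<in> ?G"
      then have "gproj L \<in> closure T" using T by blast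
      then obtain t where "t \<in> T" "dist t (gproj L) < r" using r closure_approachable by blast
      then have "L \<in> {L \<in> ?G. dist (gproj L) t < r}" using L by (simp add: dist_commute)
      with \<open>t \<in> T\<close> show "L \<in> (\<Union>t\<in>T. {L \<in> ?G. dist (gproj L) t < r})" by (rule UN_I)
    qed
    moreover have nul: "{L \<in> ?G. dist (gproj L) t < r} \<in> null_sets N" if t: "t \<in> T" for t
    proof -
      obtain x where "t = gproj x" "x \<in> ?G" using subsetD[OF T(2) t] by (rule imageE)
      then show ?thesis using hN[of x r] 0 BN[of r x] by (simp add: B_def null_sets_def)
    qed
    moreover have "?G \<in> sets N" using sets.top[of N] sp by simp
    ultimately have "?G \<in> null_sets N"
      using null_sets_subset[OF null_sets_UN'[OF T(1), of "\<lambda>t. {L \<in> ?G. dist (gproj L) t < r}" N]] by simp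
    then show False using pN sp by auto
  qed
  have fin: "hN r \<noteq> \<infinity>" for r unfolding hN_def by (simp add: N.emeasure_finite)
  let ?r = "\<lambda>n. 1 / real (Suc n)"
  have "emeasure M U' = (\<integral>\<^sup>+x. indicator U' x \<partial>M)" by simp
  \<comment> \<open>At a point of the open set small balls lie inside \<open>U'\<close>, so the
    quotient is eventually 1. Each quotient integrates to \<open>emeasure N U'\<close> by
    \<open>Fub\<close> and \<open>eq\<close>.\<close>
  also have "\<dots> \<le> (\<integral>\<^sup>+x. liminf (\<lambda>n. emeasure N (U' \<inter> B (?r n) x) / hN (?r n)) \<partial>M)"
  proof (rule nn_integral_mono)
    fix x assume x: "x \<in> space M"
    show "indicator U' x \<le> liminf (\<lambda>n. emeasure N (U' \<inter> B (?r n) x) / hN (?r n))"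
    proof (cases "x \<in> U'")
      case True
      then obtain e where e: "0 < e" "ball (gproj x) e \<subseteq> U" using U open_contains_ball U'_def by blast
      have "eventually (\<lambda>n. ?r n < e) sequentially"
        using order_tendstoD(2)[OF LIMSEQ_inverse_real_of_nat e(1)] by (simp add: inverse_eq_divide)
      then have "eventually (\<lambda>n. 1 \<le> emeasure N (U' \<inter> B (?r n) x) / hN (?r n)) sequentially"
      proof eventually_elim
        case (elim n)
        then have "B (?r n) x \<subseteq> U'" using e by (auto simp: B_def U'_def dist_commute subset_eq)
        then have "emeasure N (U' \<inter> B (?r n) x) = hN (?r n)"
          using x sp hN by (simp add: Int_absorb1)
        then show ?case using pos[of "?r n"] fin[of "?r n"] by (simp add: ennreal_divide_self less_top)
      qed
      then have "1 \<le> liminf (\<lambda>n. emeasure N (U' \<inter> B (?r n) x) / hN (?r n))" by (rule Liminf_bounded)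
      then show ?thesis by (simp add: True)
    qed simp
  qed
  also have "\<dots> \<le> liminf (\<lambda>n. \<integral>\<^sup>+x. emeasure N (U' \<inter> B (?r n) x) / hN (?r n) \<partial>M)"
  proof (rule nn_integral_liminf)
    show "(\<lambda>x. emeasure N (U' \<inter> B (?r n) x) / hN (?r n)) \<in> borel_measurable M" for n
      using meas_int[of U' "?r n"] U' by measurable
  qed
  also have "(\<lambda>n. \<integral>\<^sup>+x. emeasure N (U' \<inter> B (?r n) x) / hN (?r n) \<partial>M) = (\<lambda>n. emeasure N U')"
  proof
    fix n
    have "(\<integral>\<^sup>+x. emeasure N (U' \<inter> B (?r n) x) / hN (?r n) \<partial>M) = hN (?r n) * emeasure N U' / hN (?r n)"
      using meas_int[OF U'(1)] by (subst nn_integral_divide) (simp_all add: Fub[OF U'(1)] eq)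
    also have "\<dots> = emeasure N U'"
      using pos[of "?r n"] fin[of "?r n"] by (subst mult.commute, intro mult_divide_eq_ennreal) auto
    finally show "(\<integral>\<^sup>+x. emeasure N (U' \<inter> B (?r n) x) / hN (?r n) \<partial>M) = emeasure N U'" .
  qed
  also have "liminf (\<lambda>n. emeasure N U') = emeasure N U'" by (simp add: Liminf_const)
  finally show ?thesis unfolding U'_def .
qed

text \<open>The inequality for open sets, used in both directions, gives equality on a generator
  that is stable under intersection.\<close>

lemma invariant_measure_unique:
  fixes M N :: "(real^'n) set measure"
  assumes sM: "sets M = sets (grass_borel m)" and sN: "sets N = sets (grass_borel m)"
    and pM: "emeasure M (space M) = 1" and pN: "emeasure N (space N) = 1"
    and iM: "\<And>g A. orthogonal_transformation g \<Longrightarrow> A \<in> sets M \<Longrightarrow> emeasure M ((\<lambda>L. g ` L) ` A) = emeasure M A"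
    and iN: "\<And>g A. orthogonal_transformation g \<Longrightarrow> A \<in> sets N \<Longrightarrow> emeasure N ((\<lambda>L. g ` L) ` A) = emeasure N A"
  shows "M = N"
proof (rule measure_eqI_generator_eq)
  let ?G = "grassmannian m :: (real^'n) set set"
  let ?E = "{gproj -` V \<inter> ?G |V. open V}"
  have sp: "space M = ?G" "space N = ?G" using sM sN by (auto dest: sets_eq_imp_space_eq)
  show "Int_stable ?E"
  proof (rule Int_stableI)
    fix a b assume "a \<in> ?E" "b \<in> ?E"
    then obtain V W where "open V" "open W" "a = gproj -` V \<inter> ?G" "b = gproj -` W \<inter> ?G" by blast
    then have "open (V \<inter> W)" "a \<inter> b = gproj -` (V \<inter> W) \<inter> ?G" by auto
    then show "a \<inter> b \<in> ?E" by blast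
  qed
  show "?E \<subseteq> Pow ?G" by auto
  have "sets (grass_borel m) = sigma_sets ?G ?E" unfolding grass_borel_eq_sigma by (rule sets_measure_of) auto
  then show "sets M = sigma_sets ?G ?E" "sets N = sigma_sets ?G ?E" using sM sN by simp_all
  show "emeasure M X = emeasure N X" if X: "X \<in> ?E" for X
  proof -
    obtain V where V: "open V" "X = gproj -` V \<inter> ?G" using X by blast
    show ?thesis
      unfolding V(2) by (intro antisym invariant_measure_open_le[OF sM sN pM pN iM iN V(1)]
          invariant_measure_open_le[OF sN sM pN pM iN iM V(1)])
  qed
  show "range (\<lambda>_::nat. ?G) \<subseteq> ?E" by (force intro!: exI[of _ UNIV])
  show "(\<Union>i::nat. ?G) = ?G" by simp
  show "emeasure M ?G \<noteq> \<infinity>" using pM sp by simp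
qed

subsection \<open>Isometries and Lebesgue measure\<close>

lemma borel_measurable_linear: "linear f \<Longrightarrow> f \<in> borel_measurable borel"
  for f :: "'a::euclidean_space \<Rightarrow> 'b::euclidean_space"
  by (intro borel_measurable_continuous_onI linear_continuous_on) (simp add: linear_conv_bounded_linear)

text \<open>A linear map that permutes basis vectors pulls a box back to a box with the same edge
  lengths. It serves to identify R x R^(d-1) with R^d.\<close>

lemma distr_lborel_Basis_bij:
  fixes f :: "'a::euclidean_space \<Rightarrow> 'b::euclidean_space"
  assumes lin: "linear f" and bij: "bij_betw f Basis Basis"
  shows "distr lborel borel f = lborel"
proof (rule lborel_eqI[symmetric])
  have f_meas [measurable]: "f \<in> borel_measurable borel" using lin by (rule borel_measurable_linear)
  have fb: "f x \<bullet> f b = x \<bullet> b" if b: "b \<in> Basis" for x b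
  proof -
    have "f c \<bullet> f b = (if c = b then 1 else 0)" if c: "c \<in> Basis" for c
    proof -
      have "f c \<in> Basis" "f b \<in> Basis" "f c = f b \<longleftrightarrow> c = b"
        using bij c b by (auto simp: bij_betw_def inj_on_eq_iff)
      then show ?thesis by (simp add: inner_Basis)
    qed
    moreover have "f x = (\<Sum>c\<in>Basis. (x \<bullet> c) *\<^sub>R f c)"
      by (subst euclidean_representation[of x, symmetric]) (simp only: linear_sum[OF lin] linear_cmul[OF lin])
    ultimately have "f x \<bullet> f b = (\<Sum>c\<in>Basis. (x \<bullet> c) * (if c = b then 1 else 0))"
      by (simp add: inner_sum_left del: mult_cancel_left)
    also have "\<dots> = x \<bullet> b" using b by (simp add: if_distrib cong: if_cong)
    finally show ?thesis .
  qed
  show "emeasure (distr lborel borel f) (box l u) = (\<Prod>b\<in>Basis. (u - l) \<bullet> b)"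
    if le: "\<And>b. b \<in> Basis \<Longrightarrow> l \<bullet> b \<le> u \<bullet> b" for l u
  proof -
    define l' where "l' = (\<Sum>b\<in>Basis. (l \<bullet> f b) *\<^sub>R b)"
    define u' where "u' = (\<Sum>b\<in>Basis. (u \<bullet> f b) *\<^sub>R b)"
    have lu: "l' \<bullet> b = l \<bullet> f b" "u' \<bullet> b = u \<bullet> f b" if "b \<in> Basis" for b
      using that by (simp_all add: l'_def u'_def)
    have BB: "f ` Basis = Basis" using bij by (simp add: bij_betw_def)
    have fB: "f b \<in> Basis" if "b \<in> Basis" for b using that BB by blast
    have "f -` box l u = box l' u'"
    proof (rule set_eqI)
      fix x
      have "x \<in> f -` box l u \<longleftrightarrow> (\<forall>i\<in>f ` Basis. l \<bullet> i < f x \<bullet> i \<and> f x \<bullet> i < u \<bullet> i)"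
        by (simp add: mem_box BB)
      also have "\<dots> \<longleftrightarrow> x \<in> box l' u'" by (simp add: mem_box fb lu)
      finally show "x \<in> f -` box l u \<longleftrightarrow> x \<in> box l' u'" .
    qed
    then have "emeasure (distr lborel borel f) (box l u) = emeasure lborel (box l' u')"
      by (simp add: emeasure_distr)
    also have "\<dots> = (\<Prod>b\<in>Basis. (u' - l') \<bullet> b)"
      by (rule emeasure_lborel_box) (simp add: lu le fB)
    also have "\<dots> = (\<Prod>b\<in>Basis. (u - l) \<bullet> f b)" by (simp add: lu inner_diff_left)
    also have "\<dots> = (\<Prod>b\<in>Basis. (u - l) \<bullet> b)" by (rule arg_cong[where f=ennreal], rule prod.reindex_bij_betw[OF bij])
    finally show ?thesis .
  qed
qed simp

lemma nn_integral_lborel_translate: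
  fixes F :: "'a::euclidean_space \<Rightarrow> ennreal"
  assumes [measurable]: "F \<in> borel_measurable borel"
  shows "(\<integral>\<^sup>+x. F (x + c) \<partial>lborel) = (\<integral>\<^sup>+x. F x \<partial>lborel)"
  by (subst (2) lborel_distr_plus[of c, symmetric]) (simp add: nn_integral_distr add.commute)

text \<open>Uniqueness of Haar measure: translating the arguments of a double integral exchanges the pushed
  forward measure with Lebesgue measure, up to a constant that the unit ball shows to be 1.\<close>

lemma distr_lborel_orthogonal_transformation:
  fixes g :: "'a::euclidean_space \<Rightarrow> 'a"
  assumes g: "orthogonal_transformation g"
  shows "distr lborel borel g = lborel"
proof (rule measure_eqI)
  have lin: "linear g" using g by (rule orthogonal_transformation_linear)
  have [measurable]: "g \<in> borel_measurable borel" using lin by (rule borel_measurable_linear)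
  \<comment> \<open>Linearity and surjectivity move a translation through \<open>g\<close>, so the
    pushed forward measure is translation invariant too.\<close>
  have shift: "(\<integral>\<^sup>+x. F (g x + y) \<partial>lborel) = (\<integral>\<^sup>+x. F (g x) \<partial>lborel)"
    if [measurable]: "F \<in> borel_measurable borel" for F :: "'a \<Rightarrow> ennreal" and y
  proof -
    have "g x + y = g (x + inv g y)" for x
      using lin orthogonal_transformation_surj[OF g] by (simp add: linear_add surj_f_inv_f)
    then show ?thesis using nn_integral_lborel_translate[of "\<lambda>x. F (g x)" "inv g y"] by simp
  qed
  fix A assume "A \<in> sets (distr lborel borel g)"
  then have A [measurable]: "A \<in> sets borel" by simp
  define h :: "'a \<Rightarrow> ennreal" where "h = indicator (ball 0 1)"
  have [measurable]: "h \<in> borel_measurable borel" unfolding h_def by (intro borel_measurable_indicator) simp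
  let ?f = "indicator A :: 'a \<Rightarrow> ennreal"
  have "(\<integral>\<^sup>+x. ?f (g x) \<partial>lborel) * (\<integral>\<^sup>+y. h y \<partial>lborel) = (\<integral>\<^sup>+y. (\<integral>\<^sup>+x. ?f (g x) \<partial>lborel) * h y \<partial>lborel)"
    by (rule nn_integral_cmult[symmetric]) simp
  also have "\<dots> = (\<integral>\<^sup>+y. (\<integral>\<^sup>+x. ?f (g x + y) * h y \<partial>lborel) \<partial>lborel)"
    by (simp add: shift nn_integral_multc)
  also have "\<dots> = (\<integral>\<^sup>+x. (\<integral>\<^sup>+y. ?f (g x + y) * h y \<partial>lborel) \<partial>lborel)"
    by (rule lborel_pair.Fubini') measurable
  also have "\<dots> = (\<integral>\<^sup>+x. (\<integral>\<^sup>+y. ?f y * h (y - g x) \<partial>lborel) \<partial>lborel)"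
  proof (rule nn_integral_cong)
    fix x
    show "(\<integral>\<^sup>+y. ?f (g x + y) * h y \<partial>lborel) = (\<integral>\<^sup>+y. ?f y * h (y - g x) \<partial>lborel)"
      using nn_integral_lborel_translate[of "\<lambda>y. ?f y * h (y - g x)" "g x"] by (simp add: add.commute)
  qed
  also have "\<dots> = (\<integral>\<^sup>+y. (\<integral>\<^sup>+x. ?f y * h (y - g x) \<partial>lborel) \<partial>lborel)"
    by (rule lborel_pair.Fubini'[symmetric]) measurable
  also have "\<dots> = (\<integral>\<^sup>+y. ?f y * (\<integral>\<^sup>+x. h x \<partial>lborel) \<partial>lborel)"
  proof (rule nn_integral_cong)
    fix y
    have "(\<integral>\<^sup>+x. h (y - g x) \<partial>lborel) = (\<integral>\<^sup>+x. h (- g x) \<partial>lborel)"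
      using shift[of "\<lambda>z. h (- z)" "- y"] by simp
    \<comment> \<open>The norm is preserved, so the unit ball is its own preimage under the map
      sending x to - g x; this forces the constant to be 1.\<close>
    also have "\<dots> = (\<integral>\<^sup>+x. h x \<partial>lborel)"
      using g by (intro nn_integral_cong) (simp add: h_def indicator_def orthogonal_transformation_norm)
    finally show "(\<integral>\<^sup>+x. ?f y * h (y - g x) \<partial>lborel) = ?f y * (\<integral>\<^sup>+x. h x \<partial>lborel)"
      by (subst nn_integral_cmult) auto
  qed
  also have "\<dots> = (\<integral>\<^sup>+y. ?f y \<partial>lborel) * (\<integral>\<^sup>+x. h x \<partial>lborel)"
    by (rule nn_integral_multc) simp
  finally have "(\<integral>\<^sup>+x. ?f (g x) \<partial>lborel) * emeasure lborel (ball (0::'a) 1) = emeasure lborel A * emeasure lborel (ball (0::'a) 1)"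
    by (simp add: h_def)
  moreover have "(\<integral>\<^sup>+x. ?f (g x) \<partial>lborel) = emeasure (distr lborel borel g) A"
    using nn_integral_distr[of g lborel borel ?f] by simp
  moreover have "emeasure lborel (ball (0::'a) 1) \<noteq> 0"
    using content_ball_pos[of 1 "0::'a"] by (auto simp: measure_def)
  moreover have "emeasure lborel (ball (0::'a) 1) \<noteq> \<infinity>"
    using emeasure_bounded_finite[of "ball (0::'a) 1"] by simp
  ultimately show "emeasure (distr lborel borel g) A = emeasure lborel A"
    by (metis infinity_ennreal_def mult_divide_eq_ennreal)
qed simp

lemma linear_matrix_mult_left: "linear (\<lambda>A::real^'n^'m. (Q::real^'m^'k) ** A)"
  by (rule linearI)
    (simp_all add: matrix_matrix_mult_def vec_eq_iff sum.distrib distrib_left sum_distrib_left mult.left_commute)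

subsection \<open>Closedness of the Grassmannian and continuity of projections\<close>

text \<open>A limit of projections is symmetric and idempotent, hence the projection onto its range.
  The dimension survives because two projections at operator distance below 1 are injective on each
  other's ranges. Closedness allows the compact sets of inner regularity to be chosen inside the
  image of the Grassmannian.\<close>

lemma closed_gproj_image: "closed (gproj ` (grassmannian m :: (real^'n) set set))"
proof (unfold closed_sequential_limits, intro allI impI, elim conjE)
  fix X and A :: "real^'n^'n"
  assume X: "\<forall>n. X n \<in> gproj ` (grassmannian m :: (real^'n) set set)" and lim: "X \<longlonglongrightarrow> A"
  define S where "S n = inv_into (grassmannian m) gproj (X n)" for n
  have S: "S n \<in> grassmannian m" "X n = gproj (S n)" for n
    unfolding S_def using X by (auto simp: inv_into_into f_inv_into_f)
  have sub: "subspace (S n)" for n using S(1) by (rule grassmannianD)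
  have lim1: "(\<lambda>n. closest_point (S n) x) \<longlonglongrightarrow> A *v x" for x
    using bounded_bilinear.tendsto[OF bounded_bilinear_matrix_vector_mult lim tendsto_const, of x]
    by (simp add: S(2) gproj_works[OF sub])
  have idem: "A *v (A *v x) = A *v x" for x
  proof -
    have "(\<lambda>n. closest_point (S n) (closest_point (S n) x)) \<longlonglongrightarrow> A *v (A *v x)"
      using bounded_bilinear.tendsto[OF bounded_bilinear_matrix_vector_mult lim lim1, of x]
      by (simp add: S(2) gproj_works[OF sub])
    moreover have "closest_point (S n) (closest_point (S n) x) = closest_point (S n) x" for n
      by (rule closest_point_subspace_refl[OF sub closest_point_in_subspace[OF sub]])
    ultimately show ?thesis using lim1[of x] LIMSEQ_unique by simp
  qed
  have symm: "(A *v x) \<bullet> y = x \<bullet> (A *v y)" for x y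
  proof -
    have "(\<lambda>n. closest_point (S n) x \<bullet> y) \<longlonglongrightarrow> (A *v x) \<bullet> y"
      by (intro tendsto_inner lim1 tendsto_const)
    moreover have "(\<lambda>n. x \<bullet> closest_point (S n) y) \<longlonglongrightarrow> x \<bullet> (A *v y)"
      by (intro tendsto_inner lim1 tendsto_const)
    moreover have "closest_point (S n) x \<bullet> y = x \<bullet> closest_point (S n) y" for n
      by (metis inner_closest_point[OF sub])
    ultimately show ?thesis using LIMSEQ_unique by simp
  qed
  define L where "L = range ((*v) A)"
  have subL: "subspace L" unfolding L_def by (intro linear_subspace_image) auto
  have clL: "closest_point L x = A *v x" for x
  proof (rule closest_point_eqI[OF subL])
    show "A *v x \<in> L" by (auto simp: L_def)
    fix v assume "v \<in> L"
    then obtain w where w: "v = A *v w" by (auto simp: L_def)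
    show "(x - A *v x) \<bullet> v = 0" unfolding w inner_diff_left by (simp add: symm idem)
  qed
  have AL: "A *v x = x" if "x \<in> L" for x using closest_point_subspace_refl[OF subL that] clL by simp
  let ?c = "real CARD('n) ^ 2"
  \<comment> \<open>The factor \<open>?c\<close> converts the matrix norm into a bound for the
    operator norm, which then comes out below 1.\<close>
  obtain N where N: "norm (X N - A) < 1 / (?c + 1)"
    using lim[THEN LIMSEQ_D, of "1 / (?c + 1)"] by (auto simp: add_nonneg_pos)
  have small: "norm (closest_point (S N) x - A *v x) < norm x" if "x \<noteq> 0" for x
  proof -
    have "norm (closest_point (S N) x - A *v x) = norm ((X N - A) *v x)"
      by (simp add: S(2) matrix_vector_mult_diff_rdistrib gproj_works[OF sub])
    also have "\<dots> \<le> onorm ((*v) (X N - A)) * norm x" by (rule onorm) simp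
    also have "\<dots> \<le> (?c * norm (X N - A)) * norm x" by (intro mult_right_mono onorm_le_norm_matrix) auto
    also have "\<dots> < 1 * norm x"
    proof (rule mult_strict_right_mono)
      have "?c * norm (X N - A) \<le> ?c * (1 / (?c + 1))" using N by (intro mult_left_mono) auto
      also have "\<dots> < 1" by (simp add: field_simps add_pos_nonneg)
      finally show "?c * norm (X N - A) < 1" .
    qed (use that in simp)
    finally show ?thesis by simp
  qed
  have lin: "linear (closest_point K)" if "subspace K" for K :: "(real^'n) set"
    using bounded_linear_closest_point[OF that] by (rule bounded_linear.linear)
  have le: "dim V \<le> dim W"
    if V: "subspace V" and W: "subspace W" and inj: "\<And>x. x \<in> V \<Longrightarrow> closest_point W x = 0 \<Longrightarrow> x = 0" for V W :: "(real^'n) set"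
  proof -
    have "inj_on (closest_point W) (span V)"
      using V inj by (simp add: linear_inj_on_iff_eq_0[OF lin[OF W]] span_eq_iff[THEN iffD2])
    then have "dim (closest_point W ` V) = dim V" by (rule dim_image_eq[OF lin[OF W]])
    moreover have "dim (closest_point W ` V) \<le> dim W"
      by (intro dim_subset) (auto intro: closest_point_in_subspace[OF W])
    ultimately show ?thesis by simp
  qed
  have "dim L \<le> dim (S N)"
  proof (rule le[OF subL sub])
    fix x assume x: "x \<in> L" "closest_point (S N) x = 0"
    show "x = 0" using small[of x] x AL by (cases "x = 0") auto
  qed
  moreover have "dim (S N) \<le> dim L"
  proof (rule le[OF sub subL])
    fix x assume x: "x \<in> S N" "closest_point L x = 0"
    show "x = 0" using small[of x] x clL closest_point_subspace_refl[OF sub x(1)] by (cases "x = 0") auto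
  qed
  ultimately have "L \<in> grassmannian m" using subL grassmannianD(2)[OF S(1)[of N]] by (simp add: grassmannian_def)
  moreover have "gproj L = A" by (simp add: matrix_eq gproj_works[OF subL] clL)
  ultimately show "A \<in> gproj ` grassmannian m" by blast
qed

text \<open>For the projections P and Q write P - Q = P (1 - Q) - (1 - P) Q. The second term is
  bounded by the gap of \<open>W\<close> from \<open>V\<close>. The first is bounded by duality: for
  z orthogonal to W, |P z|^2 = (P z - Q P z) \<bullet> z, which involves the gap of \<open>V\<close>
  from \<open>W\<close>.\<close>

lemma norm_closest_point_diff_le:
  fixes V W :: "'a::euclidean_space set"
  assumes V: "subspace V" and W: "subspace W"
    and s1: "\<And>w. w \<in> W \<Longrightarrow> norm (w - closest_point V w) \<le> s * norm w"
    and s2: "\<And>v. v \<in> V \<Longrightarrow> norm (v - closest_point W v) \<le> s * norm v" and s: "0 \<le> s"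
  shows "norm (closest_point V x - closest_point W x) \<le> 2 * s * norm x"
proof -
  define P where "P = closest_point V"
  define Q where "Q = closest_point W"
  have P: "linear P" unfolding P_def using bounded_linear_closest_point[OF V] by (rule bounded_linear.linear)
  have inV: "P y \<in> V" and inW: "Q y \<in> W" for y
    unfolding P_def Q_def using closest_point_in_subspace V W by blast+
  define z where "z = x - Q x"
  have "norm z \<le> norm x"
    using closest_point_le[OF closed_subspace[OF W] subspace_0[OF W], of x] by (simp add: z_def Q_def dist_norm)
  have zQ: "z \<bullet> Q (P z) = 0" unfolding z_def Q_def by (rule closest_point_orthogonal[OF W inW[unfolded Q_def]])
  have "norm (P z) ^ 2 = P z \<bullet> z"
    using inner_closest_point(1)[OF V, of z z] by (simp add: P_def power2_norm_eq_inner)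
  also have "\<dots> = (P z - Q (P z)) \<bullet> z"
    using zQ by (simp add: inner_diff_left inner_commute[of "Q (P z)"])
  also have "\<dots> \<le> norm (P z - Q (P z)) * norm z" by (rule norm_cauchy_schwarz)
  also have "\<dots> \<le> (s * norm (P z)) * norm x"
    using s2[OF inV, of z] \<open>norm z \<le> norm x\<close> s by (intro mult_mono) (auto simp: Q_def)
  finally have a: "norm (P z) \<le> s * norm x"
    using s by (cases "P z = 0") (auto simp: power2_eq_square)
  have "norm (Q x - P (Q x)) \<le> s * norm (Q x)" unfolding P_def by (rule s1[OF inW])
  also have "\<dots> \<le> s * norm x" unfolding Q_def using norm_closest_point_le[OF W] s by (intro mult_left_mono) auto
  finally have b: "norm (Q x - P (Q x)) \<le> s * norm x" .
  have "P x - Q x = P z - (Q x - P (Q x))" by (simp add: z_def linear_diff[OF P])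
  then have "norm (P x - Q x) \<le> norm (P z) + norm (Q x - P (Q x))" by (simp only: norm_triangle_ineq4)
  then show ?thesis using a b by (simp add: P_def Q_def)
qed

lemma norm_matrix_vector_le:
  fixes A :: "real^'n^'n"
  shows "norm (A *v x) \<le> real CARD('n) ^ 2 * norm A * norm x"
  using onorm[OF matrix_vector_mul_bounded_linear, of A x] onorm_le_norm_matrix[of A]
  by (meson mult_right_mono norm_ge_zero order_trans)

text \<open>If \<open>B\<close> is close to an invertible \<open>A\<close>, it is bounded below with
  a uniform constant, so corresponding points of the two image planes are close relative to their
  size. That is the gap condition of \<open>norm_closest_point_diff_le\<close> in both
  directions.\<close>

lemma continuous_on_gproj_image:
  fixes L :: "(real^'n) set"
  assumes L: "subspace L"
  shows "continuous_on {A. det A \<noteq> 0} (\<lambda>A. gproj ((*v) A ` L))"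
proof (unfold continuous_on_iff, intro ballI allI impI)
  fix A :: "real^'n^'n" and e :: real assume A: "A \<in> {A. det A \<noteq> 0}" and e: "0 < e"
  define c where "c = real CARD('n) ^ 2"
  have c: "0 < c" by (simp add: c_def)
  obtain A' where A': "A' ** A = mat 1" using A invertible_det_nz[of A] by (auto simp: invertible_def)
  define k where "k = c * norm A' + 1"
  have k: "0 < k" using c by (simp add: k_def add_nonneg_pos)
  have Ak: "norm x \<le> k * norm (A *v x)" for x
  proof -
    have "norm x = norm (A' *v (A *v x))" by (simp add: matrix_vector_mul_assoc A')
    also have "\<dots> \<le> c * norm A' * norm (A *v x)" unfolding c_def by (rule norm_matrix_vector_le)
    also have "\<dots> \<le> k * norm (A *v x)" by (intro mult_right_mono) (auto simp: k_def)
    finally show ?thesis .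
  qed
  define K where "K = c * (2 * (2 * k * c))"
  have K: "0 < K" using c k by (simp add: K_def)
  show "\<exists>d>0. \<forall>B\<in>{A. det A \<noteq> 0}. dist B A < d \<longrightarrow> dist (gproj ((*v) B ` L)) (gproj ((*v) A ` L)) < e"
  \<comment> \<open>The first bound gives |B x| \<ge> |x| / (2 k); the second makes the final
    estimate \<open>K * t\<close> smaller than \<open>e\<close>.\<close>
  proof (intro exI[of _ "min (1 / (2 * k * c)) (e / K)"] conjI ballI impI)
    show "0 < min (1 / (2 * k * c)) (e / K)" using c k K e by simp
    fix B :: "real^'n^'n" assume "B \<in> {A. det A \<noteq> 0}" and B: "dist B A < min (1 / (2 * k * c)) (e / K)"
    define t where "t = norm (B - A)"
    have t: "0 \<le> t" "2 * k * c * t \<le> 1" "K * t < e"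
      using B c k K by (auto simp: t_def dist_norm field_simps)
    have diff: "norm (A *v x - B *v x) \<le> c * t * norm x" for x
      using norm_matrix_vector_le[of "A - B" x]
      by (simp add: c_def t_def matrix_vector_mult_diff_rdistrib norm_minus_commute)
    have Bk: "norm x \<le> 2 * k * norm (B *v x)" for x
    proof -
      have "norm x \<le> k * norm (A *v x)" by (rule Ak)
      also have "\<dots> \<le> k * (norm (B *v x) + c * t * norm x)"
        using diff[of x] norm_triangle_ineq2[of "A *v x" "B *v x"] k by (intro mult_left_mono) auto
      also have "\<dots> = k * norm (B *v x) + (2 * k * c * t) * norm x / 2" by (simp add: algebra_simps)
      also have "\<dots> \<le> k * norm (B *v x) + 1 * norm x / 2"
        using t by (intro add_left_mono divide_right_mono mult_right_mono) auto
      finally show ?thesis by simp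
    qed
    have sub: "subspace ((*v) M ` L)" for M :: "real^'n^'n" using L by (intro linear_subspace_image) auto
    have near: "norm (w - closest_point ((*v) M ` L) w) \<le> 2 * k * c * t * norm w"
      if w: "w \<in> (*v) M' ` L" and M: "\<And>x. norm (M' *v x - M *v x) \<le> c * t * norm x" "\<And>x. norm x \<le> 2 * k * norm (M' *v x)"
      for w and M M' :: "real^'n^'n"
    proof -
      obtain x where x: "x \<in> L" "w = M' *v x" using w by blast
      have "norm (w - closest_point ((*v) M ` L) w) \<le> norm (w - M *v x)"
        using closest_point_le[OF closed_subspace[OF sub], of "M *v x" M w] x by (simp add: dist_norm)
      also have "\<dots> \<le> c * t * norm x" using M(1) x by simp
      also have "\<dots> \<le> c * t * (2 * k * norm w)" using M(2)[of x] x c t by (intro mult_left_mono) auto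
      finally show ?thesis by (simp add: mult_ac)
    qed
    have Ak2: "norm x \<le> 2 * k * norm (A *v x)" for x
      using Ak[of x] mult_nonneg_nonneg[OF less_imp_le[OF k] norm_ge_zero[of "A *v x"]] by (simp add: mult.assoc)
    have diff': "norm (B *v x - A *v x) \<le> c * t * norm x" for x
      using diff[of x] by (simp add: norm_minus_commute)
    have "norm ((gproj ((*v) B ` L) - gproj ((*v) A ` L)) *v x) \<le> 2 * (2 * k * c * t) * norm x" for x
      unfolding matrix_vector_mult_diff_rdistrib gproj_works[OF sub]
      using c k t near[OF _ diff Ak2] near[OF _ diff' Bk]
      by (intro norm_closest_point_diff_le[OF sub sub]) auto
    then have "onorm ((*v) (gproj ((*v) B ` L) - gproj ((*v) A ` L))) \<le> 2 * (2 * k * c * t)"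
      using c k t by (intro onorm_bound) auto
    then have "c * onorm ((*v) (gproj ((*v) B ` L) - gproj ((*v) A ` L))) \<le> c * (2 * (2 * k * c * t))"
      using c by (intro mult_left_mono) auto
    also have "\<dots> = K * t" by (simp add: K_def)
    finally show "dist (gproj ((*v) B ` L)) (gproj ((*v) A ` L)) < e"
      using norm_matrix_le_onorm[of "gproj ((*v) B ` L) - gproj ((*v) A ` L)"] t by (simp add: dist_norm c_def)
  qed
qed

subsection \<open>The invariant measure\<close>

lemma compactin_grass_topology:
  assumes K: "compact K" "K \<subseteq> gproj ` (grassmannian m :: (real^'n) set set)"
  shows "compactin (grass_topology m) (gproj -` K \<inter> (grassmannian m :: (real^'n) set set))"
  unfolding compactin_def
proof (intro conjI allI impI)
  let ?G = "grassmannian m :: (real^'n) set set"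
  interpret Metric_space ?G grass_dist by (rule Metric_space_grassmannian)
  show "gproj -` K \<inter> ?G \<subseteq> topspace (grass_topology m)"
    by (simp add: grass_topology_def)
  fix \<U> assume U: "Ball \<U> (openin (grass_topology m)) \<and> gproj -` K \<inter> ?G \<subseteq> \<Union>\<U>"
  then have "\<forall>u\<in>\<U>. \<exists>V. open V \<and> u = gproj -` V \<inter> ?G" by (auto simp: openin_grass_topology)
  then obtain V where V: "\<And>u. u \<in> \<U> \<Longrightarrow> open (V u)" "\<And>u. u \<in> \<U> \<Longrightarrow> u = gproj -` V u \<inter> ?G"
    by metis
  have "K \<subseteq> (\<Union>u\<in>\<U>. V u)"
  proof
    fix A assume A: "A \<in> K"
    then obtain L where L: "L \<in> ?G" "A = gproj L" using K(2) by blast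
    then have "L \<in> \<Union>\<U>" using U A by blast
    then obtain u where "u \<in> \<U>" "L \<in> u" by blast
    then show "A \<in> (\<Union>u\<in>\<U>. V u)" using V(2)[of u] L by blast
  qed
  then obtain C where C: "C \<subseteq> \<U>" "finite C" "K \<subseteq> (\<Union>u\<in>C. V u)"
    using compactE_image[OF K(1), of \<U> V] V(1) by metis
  have "gproj -` K \<inter> ?G \<subseteq> \<Union>C"
  proof
    fix L assume L: "L \<in> gproj -` K \<inter> ?G"
    then obtain u where u: "u \<in> C" "gproj L \<in> V u" using C(3) by blast
    then have "L \<in> u" using V(2)[of u] C(1) L by blast
    then show "L \<in> \<Union>C" using u by blast
  qed
  then show "\<exists>\<F>. finite \<F> \<and> \<F> \<subseteq> \<U> \<and> gproj -` K \<inter> ?G \<subseteq> \<Union>\<F>" using C by blast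
qed

lemma grass_image_eq_vimage:
  fixes g :: "real^'n \<Rightarrow> real^'n"
  assumes g: "orthogonal_transformation g" and A: "A \<subseteq> grassmannian m"
  shows "(\<lambda>L. g ` L) ` A = {L \<in> grassmannian m. inv g ` L \<in> A}"
proof -
  have "inj g" "surj g"
    using orthogonal_transformation_inj[OF g] orthogonal_transformation_surj[OF g] by auto
  then have 1: "inv g ` (g ` L) = L" "g ` (inv g ` L) = L" for L
    by (auto simp: image_image surj_f_inv_f)
  show ?thesis
  proof (rule antisym)
    show "(\<lambda>L. g ` L) ` A \<subseteq> {L \<in> grassmannian m. inv g ` L \<in> A}"
      using orthogonal_transformation_image_grassmannian[OF g] A by (auto simp: 1)
    show "{L \<in> grassmannian m. inv g ` L \<in> A} \<subseteq> (\<lambda>L. g ` L) ` A"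
    proof
      fix L assume "L \<in> {L \<in> grassmannian m. inv g ` L \<in> A}"
      then have "inv g ` L \<in> A" "L = g ` (inv g ` L)" by (simp_all add: 1)
      then show "L \<in> (\<lambda>L. g ` L) ` A" by blast
    qed
  qed
qed

text \<open>Inner regularity is that of finite Borel measures on the matrix space: push
  \<open>M\<close> forward by \<open>gproj\<close>, approximate by compact sets inside the closed
  image, pull these back. Invariance is asked for preimages, which are easy to compute for a law
  given as a \<open>distr\<close>; the inverse transformation converts to images.\<close>

lemma invariant_radon_probI:
  fixes M :: "(real^'n) set measure"
  assumes sM: "sets M = sets (grass_borel m)" and pM: "emeasure M (space M) = 1"
    and iM: "\<And>g A. orthogonal_transformation g \<Longrightarrow> A \<in> sets M \<Longrightarrow>
      emeasure M {L \<in> grassmannian m. g ` L \<in> A} = emeasure M A"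
  shows "invariant_radon_prob m M"
  unfolding invariant_radon_prob_def
proof (intro conjI allI impI ballI)
  let ?G = "grassmannian m :: (real^'n) set set"
  have sp: "space M = ?G" using sM by (auto dest: sets_eq_imp_space_eq)
  have AG: "A \<subseteq> ?G" if "A \<in> sets M" for A using sets.sets_into_space[OF that] sp by simp
  show "sets M = sigma_sets ?G {U. openin (grass_topology m) U}" using sM sets_grass_borel by simp
  show "emeasure M (space M) = 1" by (rule pM)
  show "emeasure M ((\<lambda>L. g ` L) ` A) = emeasure M A"
    if "orthogonal_transformation g" "A \<in> sets M" for g A
    using iM[OF orthogonal_transformation_inv[OF that(1)] that(2)]
    by (simp add: grass_image_eq_vimage[OF that(1) AG[OF that(2)]])
  fix A assume A: "A \<in> sets M"
  then obtain B where B: "B \<in> sets borel" "A = gproj -` B \<inter> ?G" unfolding sM sets_grass_borel_iff by blast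
  have gm [measurable]: "gproj \<in> borel_measurable M"
    using measurable_gproj[of m] by (simp add: measurable_cong_sets[OF sM refl])
  define N where "N = distr M borel gproj"
  have eN: "emeasure N K = emeasure M (gproj -` K \<inter> ?G)" if "K \<in> sets borel" for K
    unfolding N_def using that by (simp add: emeasure_distr sp)
  define B' where "B' = B \<inter> gproj ` ?G"
  have B': "B' \<in> sets borel" unfolding B'_def by (intro sets.Int B(1) borel_closed closed_gproj_image)
  have "emeasure M A = emeasure N B'"
  proof -
    have "gproj -` B' \<inter> ?G = A" unfolding B(2) B'_def by auto
    then show ?thesis by (simp add: eN[OF B'])
  qed
  also have "\<dots> = (SUP K \<in> {K. K \<subseteq> B' \<and> compact K}. emeasure N K)"
  proof (rule inner_regular[OF _ _ B'])
    show "sets N = sets borel" by (simp add: N_def)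
    show "emeasure N (space N) \<noteq> \<infinity>" using pM eN[of UNIV] sp by (simp add: N_def)
  qed
  also have "\<dots> \<le> (SUP K \<in> {K. compactin (grass_topology m) K \<and> K \<subseteq> A}. emeasure M K)"
  proof (rule SUP_least)
    fix K assume K: "K \<in> {K. K \<subseteq> B' \<and> compact K}"
    then have "compactin (grass_topology m) (gproj -` K \<inter> ?G)"
      by (intro compactin_grass_topology) (auto simp: B'_def)
    moreover have "gproj -` K \<inter> ?G \<subseteq> A" using K B(2) by (auto simp: B'_def)
    moreover have "emeasure N K = emeasure M (gproj -` K \<inter> ?G)" using K by (intro eN) (auto intro: borel_compact)
    ultimately show "emeasure N K \<le> (SUP K \<in> {K. compactin (grass_topology m) K \<and> K \<subseteq> A}. emeasure M K)"
      by (auto intro: SUP_upper)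
  qed
  finally have "emeasure M A \<le> (SUP K \<in> {K. compactin (grass_topology m) K \<and> K \<subseteq> A}. emeasure M K)" .
  moreover have "(SUP K \<in> {K. compactin (grass_topology m) K \<and> K \<subseteq> A}. emeasure M K) \<le> emeasure M A"
    using A by (intro SUP_least emeasure_mono) auto
  ultimately show "emeasure M A = (SUP K \<in> {K. compactin (grass_topology m) K \<and> K \<subseteq> A}. emeasure M K)"
    by (rule antisym)
qed

lemma invariant_radon_probD:
  fixes M :: "(real^'n) set measure"
  assumes "invariant_radon_prob m M"
  shows "sets M = sets (grass_borel m)" "emeasure M (space M) = 1"
    "orthogonal_transformation g \<Longrightarrow> A \<in> sets M \<Longrightarrow> emeasure M ((\<lambda>L. g ` L) ` A) = emeasure M A"
  using assms unfolding invariant_radon_prob_def sets_grass_borel by simp_all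

text \<open>Access to the definite description: any invariant Radon probability measure that has
  been constructed may be substituted for \<open>grassmann_measure\<close>.\<close>

lemma grassmann_measure_eqI:
  fixes M :: "(real^'n) set measure"
  assumes M: "invariant_radon_prob m M"
  shows "grassmann_measure m = M"
  unfolding grassmann_measure_def
proof (rule the_equality)
  show "invariant_radon_prob m M" by (rule M)
  fix N :: "(real^'n) set measure" assume N: "invariant_radon_prob m N"
  show "N = M"
    by (rule invariant_measure_unique[of N m M]; (rule invariant_radon_probD[OF N] invariant_radon_probD[OF M]; assumption?))
qed

lemma sets_grass_borel_vimage:
  fixes g :: "real^'n \<Rightarrow> real^'n"
  assumes g: "orthogonal_transformation g" and A: "A \<in> sets (grass_borel m)"
  shows "{L \<in> grassmannian m. g ` L \<in> A} \<in> sets (grass_borel m)"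
proof -
  have "(\<lambda>L. g ` L) \<in> measurable (grass_borel m) (grass_borel m)"
  proof (rule measurable_grass_borelI)
    show "g ` L \<in> grassmannian m" if "L \<in> space (grass_borel m)" for L
      using orthogonal_transformation_image_grassmannian[OF g] that by simp
    show "(\<lambda>L. gproj (g ` L)) \<in> borel_measurable (grass_borel m)"
    proof (rule borel_measurable_matrixI)
      fix x
      let ?Q = "matrix g"
      have "(\<lambda>L. ?Q *v (gproj L *v (transpose ?Q *v x))) \<in> borel_measurable (grass_borel m)" by measurable
      moreover have "gproj (g ` L) *v x = ?Q *v (gproj L *v (transpose ?Q *v x))" if "L \<in> space (grass_borel m)" for L
        using that by (simp only: gproj_orthogonal_transformation[OF g grassmannianD(1)]
            matrix_vector_mul_assoc space_grass_borel matrix_mul_assoc)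
      ultimately show "(\<lambda>L. gproj (g ` L) *v x) \<in> borel_measurable (grass_borel m)"
        by (rule measurable_cong[THEN iffD2, rotated])
    qed
  qed
  from measurable_sets[OF this A] show ?thesis by (simp add: vimage_def Int_def conj_commute)
qed

text \<open>The law of \<open>A ` L\<^sub>0\<close> for a random invertible matrix \<open>A\<close> that is uniformly distributed in a
  bounded set invariant under left multiplication by orthogonal matrices.\<close>

lemma ex_invariant_radon_prob:
  assumes m: "m \<le> CARD('n)"
  shows "\<exists>M :: (real^'n) set measure. invariant_radon_prob m M"
proof -
  obtain L :: "(real^'n) set" where L: "subspace L" "dim L = m"
    using choose_subspace_of_subspace[of m "UNIV :: (real^'n) set"] m by (auto simp: dim_UNIV)
  define U where "U = {A :: real^'n^'n. det A \<noteq> 0 \<and> norm A < 1}"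
  have cont_det: "continuous_on UNIV (\<lambda>A :: real^'n^'n. det A)"
    unfolding det_def by (intro continuous_intros)
  have od: "open {A :: real^'n^'n. det A \<noteq> 0}"
    using open_Collect_neq[OF cont_det continuous_on_const[of _ 0]] by simp
  then have oU: "open U" unfolding U_def by (intro open_Collect_conj open_Collect_less continuous_intros)
  define v where "v = norm (mat 1 :: real^'n^'n)"
  have v: "0 \<le> v" by (simp add: v_def)
  \<comment> \<open>With this scalar \<open>c *\<^sub>R mat 1\<close> is an invertible matrix of
    norm less than 1, so the open set \<open>U\<close> is nonempty and has positive measure.\<close>
  define c where "c = 1 / (2 * (v + 1))"
  have c: "0 < c" using v by (simp add: c_def)
  have "c *\<^sub>R mat 1 \<in> U"
  proof -
    have "inj ((*v) (c *\<^sub>R mat 1 :: real^'n^'n))"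
      using c by (auto simp: inj_def scaleR_matrix_vector_assoc[symmetric])
    then have "det (c *\<^sub>R mat 1 :: real^'n^'n) \<noteq> 0"
      by (simp add: invertible_det_nz[symmetric] invertible_left_inverse matrix_left_invertible_injective)
    moreover have "norm (c *\<^sub>R mat 1 :: real^'n^'n) < 1"
    proof -
      have "norm (c *\<^sub>R mat 1 :: real^'n^'n) = c * v" using c by (simp add: v_def)
      also have "c * v < 1" using v by (simp add: c_def field_simps)
      finally show ?thesis .
    qed
    ultimately show ?thesis using c by (simp add: U_def)
  qed
  then have "U \<noteq> {}" by blast
  have [measurable]: "U \<in> sets borel" using oU by simp
  have U0: "emeasure lborel U \<noteq> 0" using open_not_negligible[OF oU \<open>U \<noteq> {}\<close>] \<open>U \<in> sets borel\<close>
    by (auto simp: negligible_iff_null_sets null_sets_def)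
  have "bounded U" by (rule bounded_subset[of "ball 0 1"]) (auto simp: U_def)
  then have U1: "emeasure lborel U \<noteq> \<infinity>" using emeasure_bounded_finite[of U] by simp
  define P where "P = uniform_measure lborel U"
  have sP [measurable_cong]: "sets P = sets borel" by (simp add: P_def)
  have spP: "space P = UNIV" by (simp add: P_def)
  have eP: "emeasure P S = emeasure lborel (U \<inter> S) / emeasure lborel U" if "S \<in> sets borel" for S
    unfolding P_def using that by (intro emeasure_uniform_measure) auto
  have P1: "emeasure P UNIV = 1" using eP[of UNIV] U0 U1 by (simp add: ennreal_divide_self less_top)
  \<comment> \<open>Singular matrices get the default plane \<open>L\<close>, which keeps all values
    in the Grassmannian; they lie outside \<open>U\<close> and carry no mass.\<close>
  define X where "X A = (if det A \<noteq> 0 then (*v) A ` L else L)" for A :: "real^'n^'n"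
  have XG: "X A \<in> grassmannian m" for A
  proof (cases "det A = 0")
    case False
    then have "inj ((*v) A)" by (simp add: invertible_det_nz[symmetric] inj_matrix_vector_mult)
    then have "dim ((*v) A ` L) = dim L" by (intro dim_image_eq) (auto intro: inj_on_subset)
    then show ?thesis using False L by (auto simp: X_def grassmannian_def linear_subspace_image)
  qed (use L in \<open>simp add: X_def grassmannian_def\<close>)
  have "(\<lambda>A. if A \<in> {A. det A \<noteq> 0} then gproj ((*v) A ` L) else gproj L) \<in> borel_measurable borel"
    using od by (intro borel_measurable_continuous_on_if continuous_on_gproj_image L continuous_on_const) auto
  also have "(\<lambda>A. if A \<in> {A. det A \<noteq> 0} then gproj ((*v) A ` L) else gproj L) = (\<lambda>A. gproj (X A))"
    by (auto simp: X_def)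
  finally have X [measurable]: "X \<in> measurable P (grass_borel m)"
    by (intro measurable_grass_borelI XG) (simp add: measurable_cong_sets[OF sP refl])
  define M where "M = distr P (grass_borel m) X"
  have "invariant_radon_prob m M"
  proof (rule invariant_radon_probI)
    show "sets M = sets (grass_borel m)" by (simp add: M_def)
    have "X -` grassmannian m \<inter> space P = UNIV" using XG spP by auto
    then show "emeasure M (space M) = 1"
      unfolding M_def using emeasure_distr[OF X sets.top] P1 by simp
    fix g :: "real^'n \<Rightarrow> real^'n" and A assume g: "orthogonal_transformation g" and A: "A \<in> sets M"
    define Q where "Q = matrix g"
    have Q: "orthogonal_matrix Q" and lin: "linear g"
      using g orthogonal_transformation_matrix by (auto simp: Q_def)
    have gQ: "g = (*v) Q" using lin by (auto simp: Q_def matrix_works linear_matrix_vector_mul_eq)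
    have dQ: "det Q \<noteq> 0" using det_orthogonal_matrix[OF Q] by auto
    have A': "A \<in> sets (grass_borel m)" using A by (simp add: M_def)
    define S where "S = X -` A"
    have S [measurable]: "S \<in> sets borel" using measurable_sets[OF X A'] sP spP by (simp add: S_def)
    \<comment> \<open>Left multiplication by \<open>Q\<close> is linear and preserves the Euclidean
      norm of matrices, so it preserves Lebesgue measure on the matrix space.\<close>
    let ?T = "\<lambda>A::real^'n^'n. Q ** A"
    have linT: "linear ?T" by (rule linear_matrix_mult_left)
    then have [measurable]: "?T \<in> borel_measurable borel" by (rule borel_measurable_linear)
    have T: "orthogonal_transformation ?T"
      using linT norm_matrix_mult_orthogonal(2)[OF Q] by (simp add: orthogonal_transformation)
    have XT: "X (Q ** B) = g ` X B" if "det B \<noteq> 0" for B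
      using that dQ by (auto simp: X_def det_mul gQ image_image matrix_vector_mul_assoc)
    have gA: "{L \<in> grassmannian m. g ` L \<in> A} \<in> sets (grass_borel m)"
      using g A' by (rule sets_grass_borel_vimage)
    have "emeasure M {L \<in> grassmannian m. g ` L \<in> A} = emeasure P (X -` {L \<in> grassmannian m. g ` L \<in> A})"
      unfolding M_def using gA by (subst emeasure_distr[OF X]) (auto simp: spP)
    also have "\<dots> = emeasure lborel (U \<inter> X -` {L \<in> grassmannian m. g ` L \<in> A}) / emeasure lborel U"
      using measurable_sets[OF X gA] sP spP by (intro eP) simp
    also have "U \<inter> X -` {L \<in> grassmannian m. g ` L \<in> A} = ?T -` (U \<inter> S)"
      using XG dQ by (auto simp: U_def S_def XT det_mul norm_matrix_mult_orthogonal(2)[OF Q])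
    also have "emeasure lborel (?T -` (U \<inter> S)) = emeasure (distr lborel borel ?T) (U \<inter> S)"
      by (simp add: emeasure_distr)
    also have "\<dots> = emeasure lborel (U \<inter> S)" by (simp add: distr_lborel_orthogonal_transformation[OF T])
    also have "emeasure lborel (U \<inter> S) / emeasure lborel U = emeasure P S" by (rule eP[OF S, symmetric])
    also have "\<dots> = emeasure M A"
      unfolding M_def using A' by (simp add: emeasure_distr[OF X] S_def spP)
    finally show "emeasure M {L \<in> grassmannian m. g ` L \<in> A} = emeasure M A" .
  qed
  then show ?thesis by blast
qed

lemma invariant_radon_prob_grassmann_measure:
  assumes "m \<le> CARD('n)"
  shows "invariant_radon_prob m (grassmann_measure m :: (real^'n) set measure)"
  using ex_invariant_radon_prob[OF assms] grassmann_measure_eqI by metis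

subsection \<open>Fibering the Grassmannian over directions\<close>

text \<open>The reflection in the hyperplane orthogonal to \<open>w\<close>; for
  \<open>w = 0\<close> division by zero makes it the identity. Its explicit formula yields rotations
  that depend measurably on the direction.\<close>

definition householder :: "'a::real_inner \<Rightarrow> 'a \<Rightarrow> 'a" where
  "householder w x = x - (2 * (x \<bullet> w) / (w \<bullet> w)) *\<^sub>R w"

lemma orthogonal_transformation_householder:
  "orthogonal_transformation (householder w)" for w :: "'a::euclidean_space"
proof -
  have "linear (householder w)"
    by (rule linearI) (simp_all add: householder_def inner_add_left algebra_simps add_divide_distrib)
  moreover have "norm (householder w x) = norm x" for x
  proof (cases "w = 0")
    case False
    define c where "c = 2 * (x \<bullet> w) / (w \<bullet> w)"
    have c: "c * (w \<bullet> w) = 2 * (x \<bullet> w)" using False by (simp add: c_def)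
    have hw: "householder w x = x - c *\<^sub>R w" by (simp add: householder_def c_def)
    have "householder w x \<bullet> householder w x = x \<bullet> x - 2 * c * (x \<bullet> w) + c * (c * (w \<bullet> w))"
      unfolding hw inner_diff_left inner_diff_right inner_scaleR_left inner_scaleR_right inner_commute[of w x]
      by (simp add: algebra_simps)
    also have "\<dots> = x \<bullet> x" by (simp add: c)
    finally show ?thesis by (simp add: norm_eq_sqrt_inner)
  qed (simp add: householder_def)
  ultimately show ?thesis by (simp add: orthogonal_transformation)
qed

lemma householder_involution: "householder w (householder w x) = x"
proof (cases "w = 0")
  case False
  then have "householder w x \<bullet> w = - (x \<bullet> w)"
    by (simp add: householder_def inner_diff_left)
  then show ?thesis by (simp add: householder_def)
qed (simp add: householder_def)

lemma householder_diff:
  assumes "norm a = norm b"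
  shows "householder (a - b) a = b"
proof (cases "a = b")
  case False
  define s where "s = (a - b) \<bullet> (a - b)"
  have "2 * (a \<bullet> (a - b)) = s"
    using assms by (simp add: s_def inner_diff_left inner_diff_right inner_commute norm_eq_sqrt_inner)
  then have "householder (a - b) a = a - (s / s) *\<^sub>R (a - b)"
    unfolding householder_def by (simp only: s_def)
  moreover have "s \<noteq> 0" using False by (simp add: s_def)
  ultimately show ?thesis by simp
qed (simp add: householder_def)

text \<open>Directions are drawn from the unit ball rather than from the sphere: planes will depend
  on \<open>v\<close> only through \<open>sgn v\<close>, and no surface measure has to be
  built.\<close>

definition dirs :: "(real^'n) measure" where
  "dirs = uniform_measure lborel (cball 0 1)"

lemma cball_measure: "emeasure lborel (cball (0::real^'n) 1) \<noteq> 0" "emeasure lborel (cball (0::real^'n) 1) \<noteq> \<infinity>"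
  using content_cball_pos[of 1 "0::real^'n"] emeasure_bounded_finite[of "cball (0::real^'n) 1"]
  by (auto simp: measure_def)

lemma sets_dirs [simp, measurable_cong]: "sets dirs = sets borel" and space_dirs [simp]: "space dirs = UNIV"
  by (simp_all add: dirs_def)

lemma nn_integral_dirs:
  fixes f :: "real^'n \<Rightarrow> ennreal"
  shows "f \<in> borel_measurable borel \<Longrightarrow>
    (\<integral>\<^sup>+v. f v \<partial>dirs) = (\<integral>\<^sup>+v. f v * indicator (cball 0 1) v \<partial>lborel) / emeasure lborel (cball (0::real^'n) 1)"
  unfolding dirs_def by (rule nn_integral_uniform_measure) auto

lemma emeasure_dirs_UNIV: "emeasure (dirs :: (real^'n) measure) UNIV = 1"
  unfolding dirs_def using cball_measure[where 'n='n]
  by (subst emeasure_uniform_measure) (auto simp: ennreal_divide_self less_top)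

lemma sigma_finite_dirs: "sigma_finite_measure (dirs :: (real^'n) measure)"
  by (rule finite_measure.axioms(1)) (rule finite_measureI, simp add: emeasure_dirs_UNIV)

lemma AE_dirs_nonzero: "AE v in (dirs :: (real^'n) measure). v \<noteq> 0"
  unfolding dirs_def using AE_lborel_singleton[of 0] by (intro AE_uniform_measureI) auto

lemma nn_integral_dirs_orthogonal:
  fixes h :: "real^'n \<Rightarrow> real^'n"
  assumes h: "orthogonal_transformation h" and [measurable]: "f \<in> borel_measurable borel"
  shows "(\<integral>\<^sup>+v. f (h v) \<partial>dirs) = (\<integral>\<^sup>+v. f v \<partial>dirs)"
proof -
  have [measurable]: "cball (0::real^'n) 1 \<in> sets borel" by simp
  have [measurable]: "h \<in> borel_measurable borel" using orthogonal_transformation_linear[OF h] by (rule borel_measurable_linear)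
  have "(\<integral>\<^sup>+v. f v * indicator (cball 0 1) v \<partial>lborel) = (\<integral>\<^sup>+v. f v * indicator (cball 0 1) v \<partial>distr lborel borel h)"
    by (simp add: distr_lborel_orthogonal_transformation[OF h])
  also have "\<dots> = (\<integral>\<^sup>+v. f (h v) * indicator (cball 0 1) (h v) \<partial>lborel)"
    by (rule nn_integral_distr) auto
  also have "\<dots> = (\<integral>\<^sup>+v. f (h v) * indicator (cball 0 1) v \<partial>lborel)"
    using h by (simp add: indicator_def orthogonal_transformation_norm)
  finally show ?thesis by (simp add: nn_integral_dirs)
qed

text \<open>The index types of the space and of the hyperplane are unrelated as types.
  \<open>i0\<close> is the axis to be turned into a given direction, and \<open>\<sigma>\<close>
  matches the other coordinates with those of the hyperplane.\<close>

locale coordinate_split =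
  fixes i0 :: "'n::finite" and \<sigma> :: "'m::finite \<Rightarrow> 'n"
  assumes bij: "bij_betw \<sigma> UNIV (UNIV - {i0})"
begin

definition join :: "real \<Rightarrow> real^'m \<Rightarrow> real^'n" where
  "join t y = (\<chi> i. if i = i0 then t else y $ inv_into UNIV \<sigma> i)"

definition proj :: "real^'n \<Rightarrow> real^'m" where
  "proj x = (\<chi> j. x $ \<sigma> j)"

lemma sigma_ne: "\<sigma> j \<noteq> i0" "inj \<sigma>"
  using bij by (auto simp: bij_betw_def)

lemma join_nth [simp]: "join t y $ i0 = t" "join t y $ \<sigma> j = y $ j"
  using sigma_ne by (auto simp: join_def)

lemma index_cases: obtains "i = i0" | j where "i = \<sigma> j"
  using bij by (auto simp: bij_betw_def)

lemma proj_join [simp]: "proj (join t y) = y"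
  by (simp add: proj_def)

lemma join_proj [simp]: "join (x $ i0) (proj x) = x"
proof -
  have "join (x $ i0) (proj x) $ i = x $ i" for i
    by (rule index_cases[of i]) (auto simp: proj_def)
  then show ?thesis by (simp add: vec_eq_iff)
qed

lemma inner_join: "join t y \<bullet> join s z = t * s + y \<bullet> z"
proof -
  have "join t y \<bullet> join s z = (\<Sum>i\<in>insert i0 (UNIV - {i0}). join t y $ i * join s z $ i)"
    by (simp add: inner_vec_def insert_Diff_if insert_UNIV)
  also have "\<dots> = t * s + (\<Sum>i\<in>UNIV - {i0}. join t y $ i * join s z $ i)"
    by (subst sum.insert) auto
  also have "(\<Sum>i\<in>UNIV - {i0}. join t y $ i * join s z $ i) = (\<Sum>j\<in>UNIV. join t y $ \<sigma> j * join s z $ \<sigma> j)"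
    by (rule sum.reindex_bij_betw[OF bij, symmetric])
  also have "\<dots> = y \<bullet> z" by (simp add: inner_vec_def)
  finally show ?thesis .
qed

lemma linear_join: "linear (\<lambda>p. join (fst p) (snd p))"
  by (rule linearI) (auto simp: join_def vec_eq_iff)

lemma linear_proj: "linear proj"
  by (rule linearI) (auto simp: proj_def vec_eq_iff)

lemma measurable_join [measurable]:
  assumes [measurable]: "f \<in> borel_measurable M" "g \<in> borel_measurable M"
  shows "(\<lambda>x. join (f x) (g x)) \<in> borel_measurable M"
proof -
  have "(\<lambda>x. (f x, g x)) \<in> borel_measurable M" by measurable
  from measurable_compose[OF this borel_measurable_linear[OF linear_join]] show ?thesis by simp
qed

lemma measurable_proj [measurable]: "proj \<in> borel_measurable borel"
  by (rule borel_measurable_linear[OF linear_proj])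

lemma proj_diff: "proj (x - y) = proj x - proj y"
  by (rule linear_diff[OF linear_proj])

lemma norm_join: "norm (join t y) ^ 2 = t ^ 2 + norm y ^ 2"
  unfolding power2_norm_eq_inner inner_join by (simp add: power2_eq_square)

lemma norm_proj_le: "norm (proj x) \<le> norm x" and abs_nth_le: "\<bar>x $ i0\<bar> \<le> norm x"
proof -
  have "norm x ^ 2 = (x $ i0) ^ 2 + norm (proj x) ^ 2" using norm_join[of "x $ i0" "proj x"] by simp
  then have "norm (proj x) ^ 2 \<le> norm x ^ 2" by simp
  then show "norm (proj x) \<le> norm x" by (rule power2_le_imp_le) simp
  show "\<bar>x $ i0\<bar> \<le> norm x" by (rule component_le_norm_cart)
qed

lemma distr_lborel_join: "distr lborel borel (\<lambda>p. join (fst p) (snd p)) = lborel"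
proof (rule distr_lborel_Basis_bij[OF linear_join])
  have a: "join 1 0 = axis i0 1" "join 0 (axis j 1) = axis (\<sigma> j) 1" for j
  proof -
    have "join 1 0 $ i = axis i0 1 $ i" "join 0 (axis j 1) $ i = axis (\<sigma> j) 1 $ i" for i
      by (rule index_cases[of i]; use sigma_ne in \<open>auto simp: axis_def inj_eq\<close>)+
    then show "join 1 0 = axis i0 1" "join 0 (axis j 1) = axis (\<sigma> j) 1" by (simp_all add: vec_eq_iff)
  qed
  have "inj (\<lambda>p. join (fst p) (snd p))"
    by (rule injI) (metis join_nth(1) prod_eq_iff proj_join)
  moreover have "(\<lambda>p. join (fst p) (snd p)) ` Basis = Basis"
  proof -
    have "(\<lambda>p. join (fst p) (snd p)) ` Basis = insert (join 1 0) ((\<lambda>j. join 0 (axis j 1)) ` UNIV)"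
      by (auto simp: Basis_prod_def Basis_vec_def image_Un image_image)
    also have "\<dots> = insert (axis i0 1) ((\<lambda>i. axis i 1) ` (\<sigma> ` UNIV))"
      by (simp add: a image_image)
    also have "\<dots> = (\<lambda>i. axis i 1) ` UNIV"
      using bij by (auto simp: bij_betw_def)
    finally show ?thesis by (auto simp: Basis_vec_def)
  qed
  ultimately show "bij_betw (\<lambda>p. join (fst p) (snd p)) Basis Basis"
    by (auto simp: bij_betw_def intro: inj_on_subset)
qed

text \<open>For \<open>v \<noteq> 0\<close> a reflection that exchanges the axis \<open>i0\<close>
  with the direction of \<open>v\<close>; being an involution, it is its own inverse. At
  \<open>v = 0\<close> it is still orthogonal, and that point is null for
  \<open>dirs\<close>.\<close>

definition rot :: "real^'n \<Rightarrow> real^'n \<Rightarrow> real^'n" where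
  "rot v = householder (join 1 0 - sgn v)"

lemma orthogonal_transformation_rot: "orthogonal_transformation (rot v)"
  unfolding rot_def by (rule orthogonal_transformation_householder)

lemma linear_rot: "linear (rot v)"
  using orthogonal_transformation_rot by (rule orthogonal_transformation_linear)

lemma norm_rot [simp]: "norm (rot v x) = norm x"
  using orthogonal_transformation_rot by (rule orthogonal_transformation_norm)

lemma rot_rot [simp]: "rot v (rot v x) = x"
  by (simp add: rot_def householder_involution)

lemma rot_e: "v \<noteq> 0 \<Longrightarrow> rot v (join 1 0) = sgn v"
  unfolding rot_def
  by (rule householder_diff) (simp add: norm_eq_sqrt_inner[of "join 1 0"] inner_join norm_sgn)

lemma measurable_rot [measurable]:
  assumes [measurable]: "f \<in> borel_measurable M" "g \<in> borel_measurable M"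
  shows "(\<lambda>x. rot (f x) (g x)) \<in> borel_measurable M"
  unfolding rot_def householder_def sgn_div_norm by measurable

text \<open>Slicing of space into lines parallel to \<open>v\<close>: the rotation preserves
  Lebesgue measure and \<open>join\<close> only relabels coordinates.\<close>

lemma nn_integral_rot_join:
  assumes [measurable]: "F \<in> borel_measurable borel"
  shows "(\<integral>\<^sup>+y. (\<integral>\<^sup>+t. F (rot v (join t y)) \<partial>lborel) \<partial>lborel) = (\<integral>\<^sup>+x. F x \<partial>lborel)"
proof -
  have "(\<integral>\<^sup>+x. F x \<partial>lborel) = (\<integral>\<^sup>+x. F x \<partial>distr lborel borel (rot v))"
    by (simp add: distr_lborel_orthogonal_transformation[OF orthogonal_transformation_rot])
  also have "\<dots> = (\<integral>\<^sup>+x. F (rot v x) \<partial>lborel)" by (rule nn_integral_distr) auto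
  also have "\<dots> = (\<integral>\<^sup>+x. F (rot v x) \<partial>distr lborel borel (\<lambda>p. join (fst p) (snd p)))"
    by (simp add: distr_lborel_join)
  also have "\<dots> = (\<integral>\<^sup>+p. F (rot v (join (fst p) (snd p))) \<partial>lborel)"
    by (rule nn_integral_distr) (auto simp: borel_prod[symmetric])
  also have "\<dots> = (\<integral>\<^sup>+p. F (rot v (join (fst p) (snd p))) \<partial>(lborel \<Otimes>\<^sub>M lborel))"
    by (simp add: lborel_prod)
  also have "\<dots> = (\<integral>\<^sup>+y. (\<integral>\<^sup>+t. F (rot v (join t y)) \<partial>lborel) \<partial>lborel)"
    by (subst lborel_pair.nn_integral_snd[symmetric]) auto
  finally show ?thesis ..
qed

text \<open>For \<open>v \<noteq> 0\<close> this is the span of \<open>v\<close> and a copy of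
  \<open>L\<close> in the hyperplane orthogonal to \<open>v\<close>.\<close>

definition lift_plane :: "real^'n \<Rightarrow> (real^'m) set \<Rightarrow> (real^'n) set" where
  "lift_plane v L = rot v ` {x. proj x \<in> L}"

lemma mem_lift_plane: "x \<in> lift_plane v L \<longleftrightarrow> proj (rot v x) \<in> L"
  unfolding lift_plane_def by (metis (mono_tags, lifting) imageE image_eqI mem_Collect_eq rot_rot)

lemma subspace_cylinder: "subspace L \<Longrightarrow> subspace {x. proj x \<in> L}"
  using linear_subspace_vimage[OF linear_proj] by (simp add: vimage_def)

lemma lift_plane_in_grassmannian:
  assumes L: "L \<in> grassmannian m"
  shows "lift_plane v L \<in> grassmannian (Suc m)"
proof -
  let ?C = "{x. proj x \<in> L}"
  have eq: "?C = (\<lambda>p. join (fst p) (snd p)) ` (UNIV \<times> L)"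
  proof (rule antisym; rule subsetI)
    fix x assume "x \<in> ?C"
    then have "x = join (fst (x $ i0, proj x)) (snd (x $ i0, proj x))" "(x $ i0, proj x) \<in> UNIV \<times> L" by auto
    then show "x \<in> (\<lambda>p. join (fst p) (snd p)) ` (UNIV \<times> L)" by (rule image_eqI)
  qed auto
  have inj: "inj (\<lambda>p. join (fst p) (snd p))"
    by (rule injI) (metis join_nth(1) prod_eq_iff proj_join)
  have "dim ?C = dim (UNIV \<times> L :: (real \<times> (real^'m)) set)"
    unfolding eq by (rule dim_image_eq[OF linear_join]) (rule inj_on_subset[OF inj], simp)
  also have "\<dots> = Suc m" using L by (simp add: grassmannian_def dim_Times)
  finally have "?C \<in> grassmannian (Suc m)" using L subspace_cylinder by (simp add: grassmannian_def)
  then show ?thesis unfolding lift_plane_def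
    by (rule orthogonal_transformation_image_grassmannian[OF orthogonal_transformation_rot])
qed

lemma closest_point_lift_plane:
  assumes L: "subspace L"
  shows "closest_point (lift_plane v L) x = rot v (join (rot v x $ i0) (closest_point L (proj (rot v x))))"
proof -
  have "closest_point {x. proj x \<in> L} y = join (y $ i0) (closest_point L (proj y))" for y
  proof (rule closest_point_eqI[OF subspace_cylinder[OF L]])
    show "join (y $ i0) (closest_point L (proj y)) \<in> {x. proj x \<in> L}"
      using closest_point_in_subspace[OF L] by simp
    fix w assume w: "w \<in> {x. proj x \<in> L}"
    have "y - join (y $ i0) (closest_point L (proj y)) = join 0 (proj y - closest_point L (proj y))"
      using linear_diff[OF linear_join, of "(y $ i0, proj y)" "(y $ i0, closest_point L (proj y))"] by simp
    then have "(y - join (y $ i0) (closest_point L (proj y))) \<bullet> w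
      = join 0 (proj y - closest_point L (proj y)) \<bullet> join (w $ i0) (proj w)" by simp
    also have "\<dots> = 0" unfolding inner_join using closest_point_orthogonal[OF L, of "proj w" "proj y"] w by simp
    finally show "(y - join (y $ i0) (closest_point L (proj y))) \<bullet> w = 0" .
  qed
  then show ?thesis
    using closest_point_orthogonal_transformation[OF orthogonal_transformation_rot subspace_cylinder[OF L], of v "rot v x"]
    by (simp add: lift_plane_def)
qed

lemma measurable_lift_plane [measurable]:
  "(\<lambda>p. lift_plane (fst p) (snd p)) \<in> measurable (borel \<Otimes>\<^sub>M grass_borel m) (grass_borel (Suc m))"
proof (rule measurable_grass_borelI)
  let ?M = "(borel :: (real^'n) measure) \<Otimes>\<^sub>M (grass_borel m :: (real^'m) set measure)"
  have sub: "snd p \<in> grassmannian m" if "p \<in> space ?M" for p using that by (auto simp: space_pair_measure)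
  show "lift_plane (fst p) (snd p) \<in> grassmannian (Suc m)" if "p \<in> space ?M" for p
    using sub[OF that] by (rule lift_plane_in_grassmannian)
  show "(\<lambda>p. gproj (lift_plane (fst p) (snd p))) \<in> borel_measurable ?M"
  proof (rule borel_measurable_matrixI)
    fix x :: "real^'n"
    have "(\<lambda>y::real^'n. y $ i0) \<in> borel_measurable borel" by (intro borel_measurable_continuous_onI continuous_intros)
    then have [measurable]: "(\<lambda>p. rot (fst p) x $ i0) \<in> borel_measurable ?M"
      by (rule measurable_compose[rotated]) measurable
    have "(\<lambda>p. rot (fst p) (join (rot (fst p) x $ i0) (closest_point (snd p) (proj (rot (fst p) x))))) \<in> borel_measurable ?M"
      by measurable
    moreover have "gproj (lift_plane (fst p) (snd p)) *v x =
        rot (fst p) (join (rot (fst p) x $ i0) (closest_point (snd p) (proj (rot (fst p) x))))" if "p \<in> space ?M" for p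
      using lift_plane_in_grassmannian[OF sub[OF that], of "fst p"] sub[OF that]
      by (simp add: gproj_works grassmannian_def closest_point_lift_plane)
    ultimately show "(\<lambda>p. gproj (lift_plane (fst p) (snd p)) *v x) \<in> borel_measurable ?M"
      by (rule measurable_cong[THEN iffD2, rotated])
  qed
qed

text \<open>An orthogonal map turns the fibre over \<open>v\<close> into the fibre over its image, up to an orthogonal map
  of the fibre.\<close>

lemma orthogonal_image_lift_plane:
  assumes h: "orthogonal_transformation h" and v: "v \<noteq> 0"
  obtains u where "orthogonal_transformation u" "\<And>L. h ` lift_plane v L = lift_plane (h v) (u ` L)"
proof -
  have linh: "linear h" using h by (rule orthogonal_transformation_linear)
  have nh: "norm (h x) = norm x" for x using h by (rule orthogonal_transformation_norm)
  have hv: "h v \<noteq> 0" using v nh[of v] by (metis norm_eq_zero)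
  \<comment> \<open>In rotated coordinates \<open>h\<close> becomes a map that fixes the axis
    \<open>i0\<close>, hence acts on the remaining coordinates only; \<open>u\<close> is this
    action.\<close>
  define U where "U = rot (h v) \<circ> h \<circ> rot v"
  have U: "orthogonal_transformation U"
    unfolding U_def by (intro orthogonal_transformation_compose orthogonal_transformation_rot h)
  have linU: "linear U" using U by (rule orthogonal_transformation_linear)
  have "h (sgn v) = sgn (h v)" using linear_cmul[OF linh] by (simp add: sgn_div_norm nh)
  then have Ue: "U (join 1 0) = join 1 0"
    using rot_e[OF v] rot_e[OF hv] by (simp add: U_def) (metis rot_rot)
  define u where "u y = proj (U (join 0 y))" for y
  have U0: "U (join 0 y) $ i0 = 0" for y
  proof -
    have "U (join 0 y) $ i0 = join (U (join 0 y) $ i0) (proj (U (join 0 y))) \<bullet> join 1 0" by (subst inner_join) simp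
    also have "\<dots> = U (join 0 y) \<bullet> U (join 1 0)" by (simp add: Ue)
    also have "\<dots> = join 0 y \<bullet> join 1 0" using U by (simp only: orthogonal_transformation_def)
    finally show ?thesis by (simp add: inner_join)
  qed
  have Ujoin: "U (join t y) = join t (u y)" for t y
  proof -
    have "join t y = t *\<^sub>R join 1 0 + join 0 y"
      using linear_add[OF linear_join, of "(t, 0)" "(0, y)"] linear_cmul[OF linear_join, of t "(1, 0)"] by simp
    then have "U (join t y) = t *\<^sub>R join 1 0 + U (join 0 y)"
      by (simp only: linear_add[OF linU] linear_cmul[OF linU] Ue)
    also have "U (join 0 y) = join 0 (u y)" using join_proj[of "U (join 0 y)"] by (simp add: U0 u_def)
    also have "t *\<^sub>R join 1 0 + join 0 (u y) = join t (u y)"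
      using linear_add[OF linear_join, of "(t, 0)" "(0, u y)"] linear_cmul[OF linear_join, of t "(1, 0)"] by simp
    finally show ?thesis .
  qed
  have "linear u"
    using linear_compose[OF linear_compose[OF _ linU] linear_proj, of "\<lambda>y. join 0 y"]
      linear_compose[OF _ linear_join, of "\<lambda>y. (0, y)"]
    by (simp add: u_def[abs_def] o_def linear_iff)
  moreover have "norm (u y) = norm y" for y
  proof -
    have "norm (join 0 (u y)) = norm (join 0 y)" using Ujoin[of 0 y] U orthogonal_transformation_norm by metis
    then have "norm (join 0 (u y)) ^ 2 = norm (join 0 y) ^ 2" by simp
    then show ?thesis unfolding norm_join by simp
  qed
  ultimately have ou: "orthogonal_transformation u" by (simp add: orthogonal_transformation)
  have UC: "U ` {x. proj x \<in> L} = {x. proj x \<in> u ` L}" for L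
  proof (rule antisym; rule subsetI)
    fix x assume "x \<in> U ` {x. proj x \<in> L}"
    then obtain z where z: "proj z \<in> L" "x = U z" by blast
    then have "proj x = u (proj z)" using Ujoin[of "z $ i0" "proj z"] by simp
    then show "x \<in> {x. proj x \<in> u ` L}" using z by blast
  next
    fix x assume "x \<in> {x. proj x \<in> u ` L}"
    then obtain y where y: "y \<in> L" "proj x = u y" by blast
    then have "x = U (join (x $ i0) y)" using Ujoin[of "x $ i0" y] join_proj[of x] by simp
    then show "x \<in> U ` {x. proj x \<in> L}" using y by auto
  qed
  have "h ` lift_plane v L = lift_plane (h v) (u ` L)" for L
  proof -
    have "h ` lift_plane v L = rot (h v) ` U ` {x. proj x \<in> L}"
      unfolding lift_plane_def U_def by (simp add: image_image)
    then show ?thesis by (simp add: UC lift_plane_def)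
  qed
  with ou show ?thesis by (rule that)
qed

text \<open>By uniqueness it suffices that the law on the right is invariant. An orthogonal
  \<open>h\<close> sends the fibre over \<open>v\<close> to the fibre over \<open>h v\<close> up to
  some \<open>u\<close> depending on \<open>v\<close>; invariance of the measure on the fibre
  absorbs \<open>u\<close>, and rotation invariance of \<open>dirs\<close> absorbs the move of
  \<open>v\<close>.\<close>

lemma grassmann_measure_fibre:
  assumes m: "m \<le> CARD('m)"
  shows "grassmann_measure (Suc m) =
    distr (dirs \<Otimes>\<^sub>M grassmann_measure m) (grass_borel (Suc m)) (\<lambda>p. lift_plane (fst p) (snd p))"
proof (rule grassmann_measure_eqI, rule invariant_radon_probI)
  define N where "N = (grassmann_measure m :: (real^'m) set measure)"
  note inv = invariant_radon_prob_grassmann_measure[OF m, folded N_def]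
  have sN [measurable_cong]: "sets N = sets (grass_borel m)" using invariant_radon_probD(1)[OF inv] .
  have spN: "space N = grassmannian m" using sN by (auto dest: sets_eq_imp_space_eq)
  have pN: "emeasure N (grassmannian m) = 1" using invariant_radon_probD(2)[OF inv] spN by simp
  interpret N: finite_measure N using pN spN by (intro finite_measureI) auto
  interpret D: sigma_finite_measure "dirs :: (real^'n) measure" by (rule sigma_finite_dirs)
  interpret pair_sigma_finite "dirs :: (real^'n) measure" N by unfold_locales
  let ?X = "\<lambda>p. lift_plane (fst p) (snd p)"
  have X [measurable]: "?X \<in> measurable (dirs \<Otimes>\<^sub>M N) (grass_borel (Suc m))"
    using measurable_lift_plane[of m] by (simp add: measurable_cong_sets[OF sets_pair_measure_cong[OF sets_dirs sN] refl])
  define M where "M = distr (dirs \<Otimes>\<^sub>M N) (grass_borel (Suc m)) ?X"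
  show "sets (distr (dirs \<Otimes>\<^sub>M grassmann_measure m) (grass_borel (Suc m)) ?X) = sets (grass_borel (Suc m))" by simp
  have eM: "emeasure M A = (\<integral>\<^sup>+v. emeasure N {L \<in> grassmannian m. lift_plane v L \<in> A} \<partial>dirs)"
    if A: "A \<in> sets (grass_borel (Suc m))" for A
  proof -
    have "emeasure M A = emeasure (dirs \<Otimes>\<^sub>M N) (?X -` A \<inter> space (dirs \<Otimes>\<^sub>M N))"
      unfolding M_def by (rule emeasure_distr[OF X A])
    also have "\<dots> = (\<integral>\<^sup>+v. emeasure N (Pair v -` (?X -` A \<inter> space (dirs \<Otimes>\<^sub>M N))) \<partial>dirs)"
      by (rule N.emeasure_pair_measure_alt) (rule measurable_sets[OF X A])
    also have "\<dots> = (\<integral>\<^sup>+v. emeasure N {L \<in> grassmannian m. lift_plane v L \<in> A} \<partial>dirs)"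
      by (intro nn_integral_cong arg_cong[where f="emeasure N"]) (auto simp: space_pair_measure spN)
    finally show ?thesis .
  qed
  have meas: "{L \<in> grassmannian m. lift_plane v L \<in> A} \<in> sets N" if A: "A \<in> sets (grass_borel (Suc m))" for A v
  proof -
    have "Pair v -` (?X -` A \<inter> space (dirs \<Otimes>\<^sub>M N)) \<in> sets N"
      by (rule sets_Pair1) (rule measurable_sets[OF X A])
    also have "Pair v -` (?X -` A \<inter> space (dirs \<Otimes>\<^sub>M N)) = {L \<in> grassmannian m. lift_plane v L \<in> A}"
      by (auto simp: space_pair_measure spN)
    finally show ?thesis .
  qed
  have meas2: "(\<lambda>v. emeasure N {L \<in> grassmannian m. lift_plane v L \<in> A}) \<in> borel_measurable borel"
    if A: "A \<in> sets (grass_borel (Suc m))" for A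
  proof -
    have "(\<lambda>v. emeasure N (Pair v -` (?X -` A \<inter> space (dirs \<Otimes>\<^sub>M N)))) \<in> borel_measurable dirs"
      by (rule N.measurable_emeasure_Pair) (rule measurable_sets[OF X A])
    also have "(\<lambda>v. Pair v -` (?X -` A \<inter> space (dirs \<Otimes>\<^sub>M N))) = (\<lambda>v. {L \<in> grassmannian m. lift_plane v L \<in> A})"
      by (auto simp: space_pair_measure spN fun_eq_iff)
    finally show ?thesis by (simp add: measurable_cong_sets[OF sets_dirs refl] fun_eq_iff)
  qed
  have "emeasure M (grassmannian (Suc m)) = (\<integral>\<^sup>+v. emeasure N {L \<in> grassmannian m. lift_plane v L \<in> grassmannian (Suc m)} \<partial>dirs)"
    by (rule eM) (metis sets.top space_grass_borel)
  also have "\<dots> = (\<integral>\<^sup>+v. 1 \<partial>(dirs :: (real^'n) measure))"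
    using pN by (intro nn_integral_cong) (simp add: lift_plane_in_grassmannian cong: conj_cong)
  finally have "emeasure M (grassmannian (Suc m)) = 1" by (simp add: emeasure_dirs_UNIV)
  then show "emeasure (distr (dirs \<Otimes>\<^sub>M grassmann_measure m) (grass_borel (Suc m)) ?X)
      (space (distr (dirs \<Otimes>\<^sub>M grassmann_measure m) (grass_borel (Suc m)) ?X)) = 1"
    by (simp add: M_def N_def)
  fix h :: "real^'n \<Rightarrow> real^'n" and A
  assume h: "orthogonal_transformation h"
    and "A \<in> sets (distr (dirs \<Otimes>\<^sub>M grassmann_measure m) (grass_borel (Suc m)) ?X)"
  then have A: "A \<in> sets (grass_borel (Suc m))" by simp
  have AG: "A \<subseteq> grassmannian (Suc m)" using sets.sets_into_space[OF A] by simp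
  have hA: "{L \<in> grassmannian (Suc m). h ` L \<in> A} \<in> sets (grass_borel (Suc m))"
    using h A by (rule sets_grass_borel_vimage)
  have "emeasure M {L \<in> grassmannian (Suc m). h ` L \<in> A}
     = (\<integral>\<^sup>+v. emeasure N {L \<in> grassmannian m. lift_plane v L \<in> {L \<in> grassmannian (Suc m). h ` L \<in> A}} \<partial>dirs)"
    by (rule eM[OF hA])
  also have "\<dots> = (\<integral>\<^sup>+v. emeasure N {L \<in> grassmannian m. lift_plane (h v) L \<in> A} \<partial>dirs)"
  proof (intro nn_integral_cong_AE, use AE_dirs_nonzero in eventually_elim)
    case (elim v)
    obtain u where u: "orthogonal_transformation u" "\<And>L. h ` lift_plane v L = lift_plane (h v) (u ` L)"
      using orthogonal_image_lift_plane[OF h elim] by blast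
    define B where "B = {L \<in> grassmannian m. lift_plane (h v) L \<in> A}"
    have B: "B \<in> sets N" unfolding B_def by (rule meas[OF A])
    have iu: "orthogonal_transformation (inv u)" using u(1) by (rule orthogonal_transformation_inv)
    have "inv (inv u) = u" using orthogonal_transformation_bij[OF u(1)] by (rule inv_inv_eq)
    then have "(\<lambda>L. inv u ` L) ` B = {L \<in> grassmannian m. u ` L \<in> B}"
      using grass_image_eq_vimage[OF iu, of B m] by (auto simp: B_def)
    also have "\<dots> = {L \<in> grassmannian m. lift_plane v L \<in> {L \<in> grassmannian (Suc m). h ` L \<in> A}}"
      using orthogonal_transformation_image_grassmannian[OF u(1)]
      by (auto simp: B_def u(2) lift_plane_in_grassmannian)
    finally show ?case using invariant_radon_probD(3)[OF inv iu B] by (simp add: B_def)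
  qed
  also have "\<dots> = (\<integral>\<^sup>+v. emeasure N {L \<in> grassmannian m. lift_plane v L \<in> A} \<partial>dirs)"
    by (rule nn_integral_dirs_orthogonal[OF h meas2[OF A]])
  also have "\<dots> = emeasure M A" by (rule eM[OF A, symmetric])
  finally show "emeasure (distr (dirs \<Otimes>\<^sub>M grassmann_measure m) (grass_borel (Suc m)) ?X) {L \<in> grassmannian (Suc m). h ` L \<in> A}
    = emeasure (distr (dirs \<Otimes>\<^sub>M grassmann_measure m) (grass_borel (Suc m)) ?X) A"
    by (simp add: M_def N_def)
qed

end

subsection \<open>Mixed norm estimates for the X-ray transform\<close>

text \<open>Bounded with bounded support, so every positive power is integrable and every line meets
  the support in a segment of length at most 4. The radius 2 is what a plate of centre
  \<open>a\<close> needs when \<open>b\<close> is within distance 1 of \<open>a\<close>.\<close>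

definition bump :: "real \<Rightarrow> 'a::euclidean_space \<Rightarrow> ('a \<Rightarrow> real) \<Rightarrow> bool" where
  "bump H b f \<longleftrightarrow> f \<in> borel_measurable borel \<and> (\<forall>x. 0 \<le> f x \<and> f x \<le> H) \<and> (\<forall>x. 2 \<le> dist x b \<longrightarrow> f x = 0)"

lemma bumpD:
  assumes "bump H b f"
  shows "f \<in> borel_measurable borel" "0 \<le> f x" "f x \<le> H" "2 \<le> dist x b \<Longrightarrow> f x = 0" "0 \<le> H"
  using assms order_trans[of 0 "f x" H] by (auto simp: bump_def)

lemma bump_powr:
  assumes f: "bump H b f" and s: "0 < s"
  shows "bump (H powr s) b (\<lambda>x. f x powr s)"
  unfolding bump_def
proof (intro conjI allI impI)
  have [measurable]: "f \<in> borel_measurable borel" by (rule bumpD(1)[OF f])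
  show "(\<lambda>x. f x powr s) \<in> borel_measurable borel" by measurable
  fix x
  show "0 \<le> f x powr s" by simp
  show "f x powr s \<le> H powr s" using bumpD(2,3)[OF f] s by (intro powr_mono2) auto
  show "f x powr s = 0" if "2 \<le> dist x b" using bumpD(4)[OF f that] by simp
qed

lemma bump_nn_integral_finite:
  fixes f :: "'a::euclidean_space \<Rightarrow> real"
  assumes f: "bump H b f"
  shows "(\<integral>\<^sup>+x. f x \<partial>lborel) < \<infinity>"
proof -
  have "(\<integral>\<^sup>+x. f x \<partial>lborel) \<le> (\<integral>\<^sup>+x. ennreal H * indicator (ball b 2) x \<partial>lborel)"
    using bumpD[OF f] by (intro nn_integral_mono) (auto simp: indicator_def dist_commute ennreal_leI not_less)
  also have "\<dots> = ennreal H * emeasure lborel (ball b 2)" by (simp add: nn_integral_cmult_indicator)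
  also have "\<dots> < \<infinity>" using emeasure_bounded_finite[of "ball b 2"] by (simp add: ennreal_mult_less_top)
  finally show ?thesis .
qed

lemma bump_integrable:
  fixes f :: "'a::euclidean_space \<Rightarrow> real"
  assumes f: "bump H b f"
  shows "integrable lborel f"
proof (rule integrableI_nonneg)
  show "f \<in> borel_measurable lborel" using bumpD(1)[OF f] by simp
  show "AE x in lborel. 0 \<le> f x" using bumpD(2)[OF f] by simp
  show "(\<integral>\<^sup>+x. f x \<partial>lborel) < \<infinity>" by (rule bump_nn_integral_finite[OF f])
qed

lemma bump_nn_integral_eq:
  fixes f :: "'a::euclidean_space \<Rightarrow> real"
  assumes f: "bump H b f"
  shows "(\<integral>\<^sup>+x. f x \<partial>lborel) = ennreal (LINT x|lborel. f x)"
  using bump_integrable[OF f] bumpD(2)[OF f] by (intro nn_integral_eq_integral) auto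

context coordinate_split
begin

lemma bump_line:
  assumes f: "bump H b f"
  shows "bump H (rot v b $ i0) (\<lambda>t. f (rot v (join t y)))"
  unfolding bump_def
proof (intro conjI allI impI)
  have [measurable]: "f \<in> borel_measurable borel" by (rule bumpD(1)[OF f])
  show "(\<lambda>t. f (rot v (join t y))) \<in> borel_measurable borel" by measurable
  fix t
  show "0 \<le> f (rot v (join t y))" "f (rot v (join t y)) \<le> H" using bumpD[OF f] by auto
  assume "2 \<le> dist t (rot v b $ i0)"
  also have "\<dots> = \<bar>(join t y - rot v b) $ i0\<bar>" by (simp add: dist_real_def)
  also have "\<dots> \<le> norm (join t y - rot v b)" by (rule abs_nth_le)
  also have "\<dots> = norm (rot v (join t y - rot v b))" by simp
  also have "\<dots> = dist (rot v (join t y)) b" by (simp add: linear_diff[OF linear_rot] dist_norm del: norm_rot)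
  finally show "f (rot v (join t y)) = 0" by (rule bumpD(4)[OF f])
qed

definition xray :: "(real^'n \<Rightarrow> real) \<Rightarrow> real^'n \<Rightarrow> real^'m \<Rightarrow> real" where
  "xray f v y = (LINT t|lborel. f (rot v (join t y)))"

lemma ennreal_xray: "bump H b f \<Longrightarrow> ennreal (xray f v y) = (\<integral>\<^sup>+t. f (rot v (join t y)) \<partial>lborel)"
  unfolding xray_def by (rule bump_nn_integral_eq[OF bump_line, symmetric])

lemma xray_nonneg: "bump H b f \<Longrightarrow> 0 \<le> xray f v y"
  unfolding xray_def by (intro Bochner_Integration.integral_nonneg) (auto dest: bumpD(2))

lemma measurable_xray [measurable]:
  assumes [measurable]: "f \<in> borel_measurable borel" "g \<in> borel_measurable M" "h \<in> borel_measurable M"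
  shows "(\<lambda>x. xray f (g x) (h x)) \<in> borel_measurable M"
  unfolding xray_def by measurable

text \<open>The class is stable under the transform: a ball of radius 2 projects into one of radius
  2, and the segments on which \<open>f\<close> lives have length at most 4.\<close>

lemma bump_xray:
  assumes f: "bump H b f"
  shows "bump (4 * H) (proj (rot v b)) (xray f v)"
  unfolding bump_def
proof (intro conjI allI impI)
  have [measurable]: "f \<in> borel_measurable borel" by (rule bumpD(1)[OF f])
  show "xray f v \<in> borel_measurable borel" by measurable
  fix y
  show "0 \<le> xray f v y" by (rule xray_nonneg[OF f])
  have "ennreal (xray f v y) \<le> (\<integral>\<^sup>+t. ennreal H * indicator {rot v b $ i0 - 2..rot v b $ i0 + 2} t \<partial>lborel)"
    unfolding ennreal_xray[OF f] using bumpD[OF bump_line[OF f, of v y]]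
    by (intro nn_integral_mono) (auto simp: indicator_def ennreal_leI dist_real_def not_le)
  also have "\<dots> = ennreal H * ennreal 4" by (subst nn_integral_cmult_indicator) auto
  also have "\<dots> = ennreal (4 * H)" using bumpD(5)[OF f] by (simp add: ennreal_mult mult.commute)
  finally show "xray f v y \<le> 4 * H" using bumpD(5)[OF f] by simp
  assume far: "2 \<le> dist y (proj (rot v b))"
  have "f (rot v (join t y)) = 0" for t
  proof (rule bumpD(4)[OF f])
    have "norm (proj (join t y - rot v b)) \<le> norm (join t y - rot v b)" by (rule norm_proj_le)
    also have "\<dots> = norm (rot v (join t y - rot v b))" by simp
    also have "\<dots> = dist (rot v (join t y)) b" by (simp add: linear_diff[OF linear_rot] dist_norm del: norm_rot)
    finally show "2 \<le> dist (rot v (join t y)) b" using far by (simp add: proj_diff dist_norm)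
  qed
  then show "xray f v y = 0" by (simp add: xray_def)
qed

text \<open>Cauchy--Schwarz on each line against the indicator of a segment of length 4, then
  slicing. The bound holds for each direction separately, so it is uniform in
  \<open>v\<close>.\<close>

lemma xray_L2:
  assumes f: "bump H b f"
  shows "(\<integral>\<^sup>+y. ennreal (xray f v y ^ 2) \<partial>lborel) \<le> 4 * (\<integral>\<^sup>+x. ennreal (f x ^ 2) \<partial>lborel)"
proof -
  have [measurable]: "f \<in> borel_measurable borel" by (rule bumpD(1)[OF f])
  have pw: "ennreal (xray f v y ^ 2) \<le> 4 * (\<integral>\<^sup>+t. ennreal (f (rot v (join t y)) ^ 2) \<partial>lborel)" for y
  proof -
    define h where "h t = f (rot v (join t y))" for t
    define c where "c = rot v b $ i0"
    have h: "bump H c h" unfolding h_def c_def by (rule bump_line[OF f])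
    have [measurable]: "h \<in> borel_measurable borel" by (rule bumpD(1)[OF h])
    have h2: "bump (H powr 2) c (\<lambda>t. h t powr 2)" by (rule bump_powr[OF h]) simp
    define A where "A = (LINT t|lborel. h t powr 2)"
    have A: "(\<integral>\<^sup>+t. ennreal (h t powr 2) \<partial>lborel) = ennreal A" "0 \<le> A"
      unfolding A_def by (rule bump_nn_integral_eq[OF h2]) simp
    have "ennreal (xray f v y) = (\<integral>\<^sup>+t. ennreal ((h t powr 2) powr (1/2) * (indicator {c - 2..c + 2} t) powr (1/2)) \<partial>lborel)"
      unfolding ennreal_xray[OF f] h_def[symmetric]
    proof (rule nn_integral_cong)
      fix t show "ennreal (h t) = ennreal ((h t powr 2) powr (1/2) * (indicator {c - 2..c + 2} t) powr (1/2))"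
        using bumpD(2,4)[OF h, of t] by (auto simp: indicator_def powr_powr dist_real_def)
    qed
    also have "\<dots> \<le> ennreal (A powr (1/2) * 4 powr (1/2))"
    proof (rule nn_integral_Holder)
      show "(\<integral>\<^sup>+t. ennreal (indicator {c - 2..c + 2} t) \<partial>lborel) \<le> ennreal 4"
        by (simp add: ennreal_indicator)
    qed (use A in auto)
    finally have "xray f v y \<le> A powr (1/2) * 4 powr (1/2)" by simp
    then have "xray f v y ^ 2 \<le> (A powr (1/2) * 4 powr (1/2)) ^ 2"
      using xray_nonneg[OF f] by (rule power_mono)
    also have "\<dots> = 4 * A" using A by (simp add: power_mult_distrib powr_half_sqrt)
    finally have "ennreal (xray f v y ^ 2) \<le> ennreal 4 * ennreal A"
      using A by (subst ennreal_mult[symmetric]) (auto intro: ennreal_leI)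
    also have "ennreal A = (\<integral>\<^sup>+t. ennreal (f (rot v (join t y)) ^ 2) \<partial>lborel)"
      unfolding A(1)[symmetric] h_def using bumpD(2)[OF f] by (simp add: powr_numeral)
    finally show ?thesis by simp
  qed
  have "(\<integral>\<^sup>+y. ennreal (xray f v y ^ 2) \<partial>lborel) \<le> (\<integral>\<^sup>+y. 4 * (\<integral>\<^sup>+t. ennreal (f (rot v (join t y)) ^ 2) \<partial>lborel) \<partial>lborel)"
    by (intro nn_integral_mono pw)
  also have "\<dots> = 4 * (\<integral>\<^sup>+y. (\<integral>\<^sup>+t. ennreal (f (rot v (join t y)) ^ 2) \<partial>lborel) \<partial>lborel)"
    by (rule nn_integral_cmult) measurable
  also have "\<dots> = 4 * (\<integral>\<^sup>+x. ennreal (f x ^ 2) \<partial>lborel)" by (subst nn_integral_rot_join) auto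
  finally show ?thesis .
qed

text \<open>The first factor comes from the reversed inequality on lines, 2/d from polar
  coordinates, and the division from normalising \<open>dirs\<close>.\<close>

definition endpoint_const :: ennreal where
  "endpoint_const = ennreal (32 ^ CARD('n)) * (ennreal (2 / CARD('n)) / emeasure lborel (cball (0::real^'n) 1))"

lemma endpoint_const_finite: "endpoint_const < \<infinity>"
proof -
  have "ennreal (2 / CARD('n)) / emeasure lborel (cball (0::real^'n) 1) \<noteq> top"
    using cball_measure[where 'n='n] by (auto simp: ennreal_divide_eq_top_iff)
  then show ?thesis by (simp add: endpoint_const_def ennreal_mult_eq_top_iff less_top[symmetric])
qed

text \<open>Two points determine a line: after the reversed Hardy--Littlewood--Sobolev inequality on each line,
  the double integral over pairs of points of a line unfolds to a double integral over space.\<close>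

lemma xray_endpoint:
  fixes f :: "real^'n \<Rightarrow> real"
  assumes f: "bump H b f"
  defines "a \<equiv> (real CARD('n) + 1) / 2"
  shows "(\<integral>\<^sup>+v. (\<integral>\<^sup>+y. ennreal (xray f v y ^ (CARD('n) + 1)) \<partial>lborel) \<partial>dirs)
    \<le> endpoint_const * (\<integral>\<^sup>+x. ennreal (f x powr a) \<partial>lborel) ^ 2"
proof -
  let ?d = "CARD('n)"
  have d: "1 \<le> ?d" by (simp add: Suc_leI)
  have [measurable]: "f \<in> borel_measurable borel" by (rule bumpD(1)[OF f])
  have [measurable]: "cball (0::real^'n) 1 \<in> sets borel" by simp
  define F where "F x = ennreal (f x powr a)" for x
  have [measurable]: "F \<in> borel_measurable borel" unfolding F_def by measurable
  \<comment> \<open>The contribution of a second point on the line through \<open>x\<close> in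
    direction \<open>v\<close>, with the kernel of the reversed inequality as weight.\<close>
  define G where "G v x = (\<integral>\<^sup>+u. F (x + u *\<^sub>R sgn v) * ennreal (\<bar>u\<bar> ^ (?d - 1)) \<partial>lborel)" for v x
  have G_meas [measurable]: "(\<lambda>p. G (fst p) (snd p)) \<in> borel_measurable (borel \<Otimes>\<^sub>M borel)"
    unfolding G_def sgn_div_norm by measurable
  have step: "(\<integral>\<^sup>+y. ennreal (xray f v y ^ (?d + 1)) \<partial>lborel) \<le> ennreal (32 ^ ?d) * (\<integral>\<^sup>+x. F x * G v x \<partial>lborel)"
    if v: "v \<noteq> 0" for v
  proof -
    have "ennreal (xray f v y ^ (?d + 1)) \<le> ennreal (32 ^ ?d) * (\<integral>\<^sup>+t. F (rot v (join t y)) * G v (rot v (join t y)) \<partial>lborel)" for y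
    proof -
      define h where "h t = f (rot v (join t y))" for t
      define c where "c = rot v b $ i0"
      have h: "bump H c h" unfolding h_def c_def by (rule bump_line[OF f])
      note [measurable] = bumpD(1)[OF h]
      have "ennreal (xray f v y ^ (?d + 1)) \<le> ennreal (32 ^ ?d) *
          (\<integral>\<^sup>+t. (\<integral>\<^sup>+s. ennreal (h t powr a * h s powr a * \<bar>s - t\<bar> ^ (?d - 1)) \<partial>lborel) \<partial>lborel)"
        unfolding a_def
      proof (rule reverse_HLS_line[where S="ball c 2" and H=H])
        show "(\<integral>\<^sup>+x. ennreal (h x) \<partial>lborel) = ennreal (xray f v y)" unfolding h_def by (rule ennreal_xray[OF f, symmetric])
        show "h x = 0" if "x \<notin> ball c 2" for x using bumpD(4)[OF h, of x] that by (simp add: dist_commute)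
        show "emeasure lborel (ball c 2) < \<infinity>" using emeasure_bounded_finite[of "ball c 2"] by simp
      qed (use bumpD[OF h] xray_nonneg[OF f] d in auto)
      also have "(\<integral>\<^sup>+t. (\<integral>\<^sup>+s. ennreal (h t powr a * h s powr a * \<bar>s - t\<bar> ^ (?d - 1)) \<partial>lborel) \<partial>lborel)
        = (\<integral>\<^sup>+t. F (rot v (join t y)) * G v (rot v (join t y)) \<partial>lborel)"
      proof (rule nn_integral_cong)
        fix t
        have line: "rot v (join (t + u) y) = rot v (join t y) + u *\<^sub>R sgn v" for u
        proof -
          have "join (t + u) y = join t y + u *\<^sub>R join 1 0"
            using linear_add[OF linear_join, of "(t, y)" "(u, 0)"] linear_cmul[OF linear_join, of u "(1, 0)"] by simp
          then show ?thesis by (simp only: linear_add[OF linear_rot] linear_cmul[OF linear_rot] rot_e[OF v])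
        qed
        have "(\<integral>\<^sup>+s. ennreal (h t powr a * h s powr a * \<bar>s - t\<bar> ^ (?d - 1)) \<partial>lborel)
          = (\<integral>\<^sup>+u. ennreal (h t powr a * h (t + u) powr a * \<bar>u\<bar> ^ (?d - 1)) \<partial>lborel)"
          by (subst nn_integral_real_affine[of _ 1 t]) auto
        also have "\<dots> = (\<integral>\<^sup>+u. F (rot v (join t y)) * (F (rot v (join t y) + u *\<^sub>R sgn v) * ennreal (\<bar>u\<bar> ^ (?d - 1))) \<partial>lborel)"
          by (intro nn_integral_cong) (simp add: F_def h_def line ennreal_mult mult.assoc)
        also have "\<dots> = F (rot v (join t y)) * G v (rot v (join t y))"
          unfolding G_def by (rule nn_integral_cmult) measurable
        finally show "(\<integral>\<^sup>+s. ennreal (h t powr a * h s powr a * \<bar>s - t\<bar> ^ (?d - 1)) \<partial>lborel) = F (rot v (join t y)) * G v (rot v (join t y))" .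
      qed
      finally show ?thesis .
    qed
    then have "(\<integral>\<^sup>+y. ennreal (xray f v y ^ (?d + 1)) \<partial>lborel)
      \<le> (\<integral>\<^sup>+y. ennreal (32 ^ ?d) * (\<integral>\<^sup>+t. F (rot v (join t y)) * G v (rot v (join t y)) \<partial>lborel) \<partial>lborel)"
      by (intro nn_integral_mono)
    also have "\<dots> = ennreal (32 ^ ?d) * (\<integral>\<^sup>+y. (\<integral>\<^sup>+t. F (rot v (join t y)) * G v (rot v (join t y)) \<partial>lborel) \<partial>lborel)"
      by (rule nn_integral_cmult) (unfold G_def, measurable)
    also have "\<dots> = ennreal (32 ^ ?d) * (\<integral>\<^sup>+x. F x * G v x \<partial>lborel)"
      by (subst nn_integral_rot_join[of "\<lambda>x. F x * G v x"]) (unfold G_def, auto)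
    finally show ?thesis .
  qed
  have FG [measurable]: "(\<lambda>v. \<integral>\<^sup>+x. F x * G v x \<partial>lborel) \<in> borel_measurable borel"
    unfolding G_def sgn_div_norm by measurable
  have "(\<integral>\<^sup>+v. (\<integral>\<^sup>+y. ennreal (xray f v y ^ (?d + 1)) \<partial>lborel) \<partial>dirs)
    \<le> (\<integral>\<^sup>+v. ennreal (32 ^ ?d) * (\<integral>\<^sup>+x. F x * G v x \<partial>lborel) \<partial>dirs)"
    by (intro nn_integral_mono_AE, use AE_dirs_nonzero in eventually_elim) (rule step)
  also have "\<dots> = ennreal (32 ^ ?d) * (\<integral>\<^sup>+v. (\<integral>\<^sup>+x. F x * G v x \<partial>lborel) \<partial>dirs)"
    by (rule nn_integral_cmult) (simp add: measurable_cong_sets[OF sets_dirs refl])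
  also have "(\<integral>\<^sup>+v. (\<integral>\<^sup>+x. F x * G v x \<partial>lborel) \<partial>dirs)
    = (\<integral>\<^sup>+v. (\<integral>\<^sup>+x. F x * G v x \<partial>lborel) * indicator (cball 0 1) v \<partial>lborel) / emeasure lborel (cball (0::real^'n) 1)"
    by (rule nn_integral_dirs[OF FG])
  also have "(\<integral>\<^sup>+v. (\<integral>\<^sup>+x. F x * G v x \<partial>lborel) * indicator (cball 0 1) v \<partial>lborel)
    = (\<integral>\<^sup>+v. (\<integral>\<^sup>+x. F x * G v x * indicator (cball 0 1) v \<partial>lborel) \<partial>lborel)"
    by (intro nn_integral_cong nn_integral_multc[symmetric]) (unfold G_def, measurable)
  also have "\<dots> = (\<integral>\<^sup>+x. (\<integral>\<^sup>+v. F x * G v x * indicator (cball 0 1) v \<partial>lborel) \<partial>lborel)"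
    by (rule lborel_pair.Fubini') (unfold G_def sgn_div_norm, measurable)
  also have "\<dots> = (\<integral>\<^sup>+x. F x * (ennreal (2 / ?d) * (\<integral>\<^sup>+z. F z \<partial>lborel)) \<partial>lborel)"
  proof (rule nn_integral_cong)
    fix x
    have "(\<integral>\<^sup>+v. F x * G v x * indicator (cball 0 1) v \<partial>lborel) = F x * (\<integral>\<^sup>+v. G v x * indicator (cball 0 1) v \<partial>lborel)"
      unfolding mult.assoc by (rule nn_integral_cmult) (unfold G_def sgn_div_norm, measurable)
    \<comment> \<open>Averaging over directions lets the second point range over all of space: the
      kernel |u|^(d-1) is exactly the Jacobian of polar coordinates about \<open>x\<close>.\<close>
    also have "(\<integral>\<^sup>+v. G v x * indicator (cball 0 1) v \<partial>lborel) = ennreal (2 / ?d) * (\<integral>\<^sup>+z. F (x + z) \<partial>lborel)"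
      unfolding G_def using polar_coordinates_lborel[of "\<lambda>z. F (x + z)"] by simp
    also have "(\<integral>\<^sup>+z. F (x + z) \<partial>lborel) = (\<integral>\<^sup>+z. F z \<partial>lborel)"
      using nn_integral_lborel_translate[of F x] by (simp add: add.commute)
    finally show "(\<integral>\<^sup>+v. F x * G v x * indicator (cball 0 1) v \<partial>lborel) = F x * (ennreal (2 / ?d) * (\<integral>\<^sup>+z. F z \<partial>lborel))" .
  qed
  also have "\<dots> = (\<integral>\<^sup>+x. F x \<partial>lborel) * (ennreal (2 / ?d) * (\<integral>\<^sup>+z. F z \<partial>lborel))"
    by (rule nn_integral_multc) measurable
  also have "ennreal (32 ^ ?d) * ((\<integral>\<^sup>+x. F x \<partial>lborel) * (ennreal (2 / ?d) * (\<integral>\<^sup>+z. F z \<partial>lborel)) / emeasure lborel (cball (0::real^'n) 1))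
    = endpoint_const * (\<integral>\<^sup>+x. F x \<partial>lborel) ^ 2"
    unfolding endpoint_const_def divide_ennreal_def power2_eq_square by (simp only: mult_ac)
  finally show ?thesis unfolding F_def .
qed

text \<open>Hoelder on each line interpolates between the trivial bound on \<open>L\<^sup>2\<close> and the endpoint bound.\<close>

lemma xray_mixed_norm:
  fixes f :: "real^'n \<Rightarrow> real"
  assumes f: "bump H b f" and \<rho>: "1 \<le> \<rho>"
  defines "R \<equiv> real CARD('n) - 1 + 2 * \<rho>"
  defines "F \<equiv> LINT x|lborel. f x powr (R / (1 + \<rho>))"
  shows "(\<integral>\<^sup>+v. ennreal ((LINT y|lborel. xray f v y powr (R / \<rho>)) powr \<rho>) \<partial>dirs)
    \<le> ennreal (enn2real endpoint_const * 4 powr (\<rho> - 1) * F powr (\<rho> + 1))"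
proof -
  let ?d = "CARD('n)"
  have d: "1 \<le> real ?d" using Suc_leI[of 0 ?d] by simp
  have R: "0 < R" "2 \<le> R" unfolding R_def using \<rho> d by linarith+
  define pt where "pt = R / (1 + \<rho>)"
  have pt: "0 < pt" using R \<rho> by (simp add: pt_def)
  \<comment> \<open>The powers are chosen so that g^2 and h^((d+1)/2) both equal
    \<open>f powr pt\<close>; both known bounds then feature the same integral
    \<open>F\<close>.\<close>
  define g where "g x = f x powr (pt / 2)" for x
  define h where "h x = f x powr (2 * pt / (?d + 1))" for x
  have g: "bump (H powr (pt / 2)) b g" unfolding g_def using pt by (intro bump_powr[OF f]) auto
  have h: "bump (H powr (2 * pt / (?d + 1))) b h" unfolding h_def using pt d by (intro bump_powr[OF f]) auto
  note [measurable] = bumpD(1)[OF f] bumpD(1)[OF g] bumpD(1)[OF h]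
  have Fb: "(\<integral>\<^sup>+x. ennreal (f x powr pt) \<partial>lborel) = ennreal F"
    unfolding F_def pt_def[symmetric] by (rule bump_nn_integral_eq[OF bump_powr[OF f pt]])
  have F0: "0 \<le> F" unfolding F_def by (rule Bochner_Integration.integral_nonneg) simp
  \<comment> \<open>With this \<open>s\<close> the powers of \<open>f\<close> in
    \<open>g powr (1 - s) * h powr s\<close> add up to 1, and after raising to R/\<rho> the
    transforms of \<open>h\<close> and \<open>g\<close> appear with exponents (d+1)/\<rho> and
    2(\<rho>-1)/\<rho>. The bound \<open>s \<le> 1\<close> is \<open>1 \<le> \<rho>\<close>.\<close>
  define s where "s = (?d + 1) / R"
  have s: "0 < s" "s \<le> 1" using \<rho> d R by (simp_all add: s_def) (simp add: R_def)
  have s1: "1 - s = 2 * (\<rho> - 1) / R" using R by (simp add: s_def R_def field_simps)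
  have exps: "(pt / 2) * (1 - s) + (2 * pt / (?d + 1)) * s = 1"
  proof -
    have a: "(2 * pt / (?d + 1)) * s = 2 * pt / R" using d by (simp add: s_def)
    have b: "(pt / 2) * (1 - s) = pt * (\<rho> - 1) / R" unfolding s1 using R by (simp add: field_simps)
    have "(pt / 2) * (1 - s) + (2 * pt / (?d + 1)) * s = (pt * (\<rho> - 1) + 2 * pt) / R"
      by (simp only: a b add_divide_distrib)
    also have "\<dots> = pt * (1 + \<rho>) / R" by (simp add: algebra_simps)
    also have "\<dots> = 1" using R \<rho> by (simp add: pt_def)
    finally show ?thesis .
  qed
  have fgh: "f x = g x powr (1 - s) * h x powr s" for x
  proof (cases "f x = 0")
    case False
    then have "0 < f x" using bumpD(2)[OF f, of x] by simp
    then show ?thesis using exps by (simp add: g_def h_def powr_powr powr_add[symmetric])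
  qed (use s in \<open>simp add: g_def h_def\<close>)
  have X: "xray f v y \<le> xray g v y powr (1 - s) * xray h v y powr s" for v y
  proof -
    have "ennreal (xray f v y) = (\<integral>\<^sup>+t. ennreal (g (rot v (join t y)) powr (1 - s) * h (rot v (join t y)) powr s) \<partial>lborel)"
      unfolding ennreal_xray[OF f] by (subst fgh) simp
    also have "\<dots> \<le> ennreal (xray g v y powr (1 - s) * xray h v y powr s)"
      by (rule nn_integral_Holder)
        (use s bumpD(2)[OF g] bumpD(2)[OF h] ennreal_xray[OF g] ennreal_xray[OF h] xray_nonneg[OF g] xray_nonneg[OF h] in auto)
    finally show ?thesis by simp
  qed
  define P where "P = R / \<rho>"
  have P: "0 < P" using R \<rho> by (simp add: P_def)
  define Z where "Z v = (LINT y|lborel. xray f v y powr P)" for v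
  define W where "W v = (LINT y|lborel. xray h v y ^ (?d + 1))" for v
  have Z0: "0 \<le> Z v" and W0: "0 \<le> W v" for v
    unfolding Z_def W_def using xray_nonneg[OF h] by (auto intro!: Bochner_Integration.integral_nonneg)
  have Zn: "(\<integral>\<^sup>+y. ennreal (xray f v y powr P) \<partial>lborel) = ennreal (Z v)" for v
    unfolding Z_def by (rule bump_nn_integral_eq[OF bump_powr[OF bump_xray[OF f] P]])
  have hpow: "xray h v y ^ (?d + 1) = xray h v y powr (?d + 1)" for v y
    using powr_realpow'[OF xray_nonneg[OF h, of v y], of "?d + 1"] by (simp add: add.commute)
  have Wn: "(\<integral>\<^sup>+y. ennreal (xray h v y ^ (?d + 1)) \<partial>lborel) = ennreal (W v)" for v
    unfolding W_def hpow by (rule bump_nn_integral_eq[OF bump_powr[OF bump_xray[OF h]]]) simp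
  have Vn: "(\<integral>\<^sup>+y. ennreal (xray g v y ^ 2) \<partial>lborel) \<le> ennreal (4 * F)" for v
  proof -
    have "(\<integral>\<^sup>+y. ennreal (xray g v y ^ 2) \<partial>lborel) \<le> 4 * (\<integral>\<^sup>+x. ennreal (g x ^ 2) \<partial>lborel)" by (rule xray_L2[OF g])
    also have "(\<integral>\<^sup>+x. ennreal (g x ^ 2) \<partial>lborel) = ennreal F"
      unfolding Fb[symmetric] by (intro nn_integral_cong) (simp add: g_def powr_powr flip: powr_numeral)
    also have "4 * ennreal F = ennreal (4 * F)" using F0 by (simp add: ennreal_mult)
    finally show ?thesis .
  qed
  \<comment> \<open>A second Hoelder inequality, over \<open>y\<close> for fixed \<open>v\<close>,
    with weights 1/\<rho> and (\<rho>-1)/\<rho>. The L^2 factor is bounded uniformly in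
    \<open>v\<close>, so only \<open>W\<close> is left to be integrated over directions, where the
    endpoint bound applies.\<close>
  have ZW: "Z v powr \<rho> \<le> W v * (4 * F) powr (\<rho> - 1)" for v
  proof -
    have pw: "xray f v y powr P \<le> (xray h v y ^ (?d + 1)) powr (1 / \<rho>) * (xray g v y ^ 2) powr ((\<rho> - 1) / \<rho>)" for y
    proof -
      have e1: "s * P = (?d + 1) * (1 / \<rho>)" using R \<rho> by (simp add: s_def P_def)
      have e2: "(1 - s) * P = 2 * ((\<rho> - 1) / \<rho>)" unfolding s1 using R \<rho> by (simp add: P_def)
      have "xray f v y powr P \<le> (xray g v y powr (1 - s) * xray h v y powr s) powr P"
        using X xray_nonneg[OF f] P by (intro powr_mono2) auto
      also have "\<dots> = xray g v y powr ((1 - s) * P) * xray h v y powr (s * P)"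
        by (simp add: powr_mult powr_powr)
      also have "\<dots> = (xray g v y powr 2) powr ((\<rho> - 1) / \<rho>) * (xray h v y powr (?d + 1)) powr (1 / \<rho>)"
        unfolding e1 e2 powr_powr ..
      also have "\<dots> = (xray g v y ^ 2) powr ((\<rho> - 1) / \<rho>) * (xray h v y ^ (?d + 1)) powr (1 / \<rho>)"
        using xray_nonneg[OF g] hpow by simp
      finally show ?thesis by (simp add: mult.commute)
    qed
    have "ennreal (Z v) \<le> (\<integral>\<^sup>+y. ennreal ((xray h v y ^ (?d + 1)) powr (1 / \<rho>) * (xray g v y ^ 2) powr ((\<rho> - 1) / \<rho>)) \<partial>lborel)"
      unfolding Zn[symmetric] by (intro nn_integral_mono ennreal_leI pw)
    also have "\<dots> \<le> ennreal (W v powr (1 / \<rho>) * (4 * F) powr ((\<rho> - 1) / \<rho>))"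
      by (rule nn_integral_Holder)
        (use Wn Vn \<rho> W0 F0 xray_nonneg[OF h] in \<open>auto simp: field_simps\<close>)
    finally have "Z v \<le> W v powr (1 / \<rho>) * (4 * F) powr ((\<rho> - 1) / \<rho>)" by simp
    then have "Z v powr \<rho> \<le> (W v powr (1 / \<rho>) * (4 * F) powr ((\<rho> - 1) / \<rho>)) powr \<rho>"
      using Z0 \<rho> by (intro powr_mono2) auto
    also have "\<dots> = W v * (4 * F) powr (\<rho> - 1)"
      using \<rho> W0[of v] by (simp add: powr_mult powr_powr)
    finally show ?thesis .
  qed
  have [measurable]: "W \<in> borel_measurable borel" unfolding W_def by measurable
  have "(\<integral>\<^sup>+v. ennreal (Z v powr \<rho>) \<partial>dirs) \<le> (\<integral>\<^sup>+v. ennreal (W v) * ennreal ((4 * F) powr (\<rho> - 1)) \<partial>dirs)"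
    using ZW W0 by (intro nn_integral_mono) (simp add: ennreal_mult[symmetric] ennreal_leI)
  also have "\<dots> = (\<integral>\<^sup>+v. ennreal (W v) \<partial>dirs) * ennreal ((4 * F) powr (\<rho> - 1))"
    by (rule nn_integral_multc) (simp add: measurable_cong_sets[OF sets_dirs refl])
  also have "(\<integral>\<^sup>+v. ennreal (W v) \<partial>dirs) \<le> endpoint_const * ennreal F ^ 2"
  proof -
    have "(\<integral>\<^sup>+v. ennreal (W v) \<partial>dirs) = (\<integral>\<^sup>+v. (\<integral>\<^sup>+y. ennreal (xray h v y ^ (?d + 1)) \<partial>lborel) \<partial>dirs)" by (simp only: Wn)
    also have "\<dots> \<le> endpoint_const * (\<integral>\<^sup>+x. ennreal (h x powr ((real ?d + 1) / 2)) \<partial>lborel) ^ 2"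
      by (rule xray_endpoint[OF h])
    also have "(\<integral>\<^sup>+x. ennreal (h x powr ((real ?d + 1) / 2)) \<partial>lborel) = ennreal F"
    proof -
      have "(2 * pt / (?d + 1)) * ((real ?d + 1) / 2) = pt" using d by (simp add: field_simps)
      then show ?thesis unfolding Fb[symmetric] by (intro nn_integral_cong) (simp only: h_def powr_powr)
    qed
    finally show ?thesis .
  qed
  also have "endpoint_const * ennreal F ^ 2 * ennreal ((4 * F) powr (\<rho> - 1))
    = ennreal (enn2real endpoint_const * F ^ 2 * (4 * F) powr (\<rho> - 1))"
    using endpoint_const_finite F0 by (simp add: ennreal_mult ennreal_power)
  also have "enn2real endpoint_const * F ^ 2 * (4 * F) powr (\<rho> - 1) = enn2real endpoint_const * 4 powr (\<rho> - 1) * F powr (\<rho> + 1)"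
  proof -
    have "F ^ 2 * F powr (\<rho> - 1) = F powr (\<rho> + 1)"
      using F0 by (cases "F = 0") (auto simp: powr_add[symmetric] add.commute simp flip: powr_numeral)
    then show ?thesis by (simp add: powr_mult mult_ac)
  qed
  finally show ?thesis unfolding Z_def P_def by (simp add: mult_right_mono)
qed

end

subsection \<open>Plates\<close>

lemma mem_plate: "y \<in> plate \<delta> L a \<longleftrightarrow> (\<exists>w\<in>L. norm w \<le> 1/2 \<and> norm (y - a - w) < \<delta>)"
proof -
  have "y \<in> plate \<delta> L a \<longleftrightarrow> (\<exists>w\<in>L. a + w \<in> cball a (1/2) \<and> y \<in> ball (a + w) \<delta>)"
    unfolding plate_def by blast
  moreover have "dist (a + w) y = norm (y - a - w)" "dist a (a + w) = norm w" for w
    by (simp_all add: dist_norm norm_minus_commute[of "a + w"] diff_diff_eq)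
  ultimately show ?thesis by simp
qed

lemma plate_translate: "y \<in> plate \<delta> L a \<longleftrightarrow> y - a \<in> plate \<delta> L 0"
  by (simp add: mem_plate)

lemma open_plate: "open (plate \<delta> L a)"
  unfolding plate_def by auto

lemma sets_plate [measurable, simp]: "plate \<delta> L a \<in> sets borel"
  by (rule borel_open[OF open_plate])

lemma plate_subset_ball: "\<delta> \<le> 1/2 \<Longrightarrow> plate \<delta> L a \<subseteq> ball a 1"
proof
  fix y assume d: "\<delta> \<le> 1/2" and "y \<in> plate \<delta> L a"
  then obtain w where w: "norm w \<le> 1/2" "norm (y - a - w) < \<delta>" by (auto simp: mem_plate)
  have "norm (y - a) \<le> norm (y - a - w) + norm w" by (metis diff_add_cancel norm_triangle_ineq)
  then have "norm (y - a) < 1" using w d by simp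
  then show "y \<in> ball a 1" by (simp add: dist_norm norm_minus_commute)
qed

lemma ball_subset_plate: "subspace L \<Longrightarrow> ball a \<delta> \<subseteq> plate \<delta> L a"
  by (auto simp: mem_plate dist_norm norm_minus_commute subspace_0 intro!: bexI[of _ 0])

text \<open>Convexity is wanted because the frontier of a convex set is Lebesgue null.\<close>

lemma convex_plate:
  assumes L: "subspace L"
  shows "convex (plate \<delta> L a)"
proof (rule convexI)
  fix x y and u v :: real assume xy: "x \<in> plate \<delta> L a" "y \<in> plate \<delta> L a" and uv: "0 \<le> u" "0 \<le> v" "u + v = 1"
  obtain w where w: "w \<in> L" "norm w \<le> 1/2" "norm (x - a - w) < \<delta>" using xy by (auto simp: mem_plate)
  obtain z where z: "z \<in> L" "norm z \<le> 1/2" "norm (y - a - z) < \<delta>" using xy by (auto simp: mem_plate)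
  have "norm (u *\<^sub>R w + v *\<^sub>R z) \<le> u * norm w + v * norm z"
    using uv norm_triangle_ineq[of "u *\<^sub>R w" "v *\<^sub>R z"] by simp
  also have "\<dots> \<le> 1/2" using w z uv by (intro convex_bound_le) auto
  finally have 1: "norm (u *\<^sub>R w + v *\<^sub>R z) \<le> 1/2" .
  have "u *\<^sub>R x + v *\<^sub>R y - a - (u *\<^sub>R w + v *\<^sub>R z) = u *\<^sub>R (x - a - w) + v *\<^sub>R (y - a - z)"
  proof -
    have "a = u *\<^sub>R a + v *\<^sub>R a" using uv by (metis scaleR_left_distrib scaleR_one)
    then show ?thesis by (simp add: algebra_simps)
  qed
  then have "norm (u *\<^sub>R x + v *\<^sub>R y - a - (u *\<^sub>R w + v *\<^sub>R z)) \<le> u * norm (x - a - w) + v * norm (y - a - z)"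
    using uv norm_triangle_ineq[of "u *\<^sub>R (x - a - w)" "v *\<^sub>R (y - a - z)"] by simp
  also have "\<dots> < \<delta>" using w z uv by (intro convex_bound_lt) auto
  finally show "u *\<^sub>R x + v *\<^sub>R y \<in> plate \<delta> L a"
    using 1 w z L by (auto simp: mem_plate subspace_add subspace_scale intro!: bexI[of _ "u *\<^sub>R w + v *\<^sub>R z"])
qed

definition plate_vol :: "real \<Rightarrow> 'a::euclidean_space set \<Rightarrow> real" where
  "plate_vol \<delta> L = measure lborel (plate \<delta> L 0)"

lemma emeasure_plate:
  assumes "0 < \<delta>" "\<delta> \<le> 1/2"
  shows "emeasure lborel (plate \<delta> L a) = ennreal (plate_vol \<delta> L)"
proof -
  have "emeasure lborel (plate \<delta> L 0) < \<infinity>"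
    using plate_subset_ball[of \<delta> L 0] assms bounded_subset[OF bounded_ball] by (intro emeasure_bounded_finite) blast
  then have "emeasure lborel (plate \<delta> L 0) = ennreal (plate_vol \<delta> L)"
    unfolding plate_vol_def by (intro emeasure_eq_ennreal_measure) auto
  moreover have "emeasure lborel (plate \<delta> L a) = (\<integral>\<^sup>+y. indicator (plate \<delta> L a) (y + a) \<partial>lborel)"
    by (subst nn_integral_lborel_translate) auto
  moreover have "\<dots> = (\<integral>\<^sup>+y. indicator (plate \<delta> L 0) y \<partial>lborel)"
    by (intro nn_integral_cong) (simp add: indicator_def plate_translate[of _ \<delta> L a])
  ultimately show ?thesis by simp
qed

lemma plate_vol_pos:
  assumes L: "subspace L" and \<delta>: "0 < \<delta>" "\<delta> \<le> 1/2"
  shows "0 < plate_vol \<delta> L"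
proof -
  have "0 < measure lborel (ball 0 \<delta> :: 'a set)" using content_ball_pos[OF \<delta>(1), of "0::'a"] by simp
  also have "\<dots> \<le> plate_vol \<delta> L" unfolding plate_vol_def
    using emeasure_plate[OF \<delta>, of L 0] ball_subset_plate[OF L, of 0 \<delta>]
    by (intro measure_mono_fmeasurable) (auto simp: fmeasurable_def)
  finally show ?thesis .
qed

definition plate_avg :: "real \<Rightarrow> ('a::euclidean_space \<Rightarrow> real) \<Rightarrow> 'a set \<Rightarrow> 'a \<Rightarrow> real" where
  "plate_avg \<delta> f L a = (LINT y|lborel. indicator (plate \<delta> L a) y * f y) / plate_vol \<delta> L"

lemma plate_maximal_eq:
  assumes f: "f \<in> borel_measurable borel" and \<delta>: "0 < \<delta>" "\<delta> \<le> 1/2"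
  shows "plate_maximal \<delta> f L = (SUP a. plate_avg \<delta> f L a)"
proof -
  have "1 / measure lebesgue (plate \<delta> L a) * (LINT y : plate \<delta> L a | lebesgue. f y) = plate_avg \<delta> f L a" for a
  proof -
    have "measure lebesgue (plate \<delta> L a) = plate_vol \<delta> L"
      using emeasure_plate[OF \<delta>, of L a] by (simp add: measure_def plate_vol_def enn2real_eq_0_iff)
    moreover have "(LINT y : plate \<delta> L a | lebesgue. f y) = (LINT y|lborel. indicator (plate \<delta> L a) y * f y)"
      unfolding set_lebesgue_integral_def using f by (subst integral_completion) auto
    ultimately show ?thesis by (simp add: plate_avg_def)
  qed
  then show ?thesis by (simp add: plate_maximal_def)
qed

text \<open>The inequality |f| \<le> 1 + |f|^s makes \<open>f\<close> integrable on bounded sets and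
  its averages bounded uniformly in the centre, so that the real suprema below are genuine and not
  default values.\<close>

locale locally_bounded_average =
  fixes f :: "'a::euclidean_space \<Rightarrow> real" and s \<delta> :: real
  assumes f [measurable]: "f \<in> borel_measurable borel" and s: "1 \<le> s"
    and int: "integrable lborel (\<lambda>x. \<bar>f x\<bar> powr s)" and \<delta>: "0 < \<delta>" "\<delta> \<le> 1/2"
begin

lemma le_one_add_powr: "\<bar>f x\<bar> \<le> 1 + \<bar>f x\<bar> powr s"
proof (cases "\<bar>f x\<bar> \<le> 1")
  case False
  then have "\<bar>f x\<bar> powr 1 \<le> \<bar>f x\<bar> powr s" using s by (intro powr_mono) auto
  then show ?thesis using False by simp
qed (simp add: add_increasing2)

lemma integrable_on_bounded:
  assumes [measurable]: "A \<in> sets borel" and A: "bounded A"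
  shows "integrable lborel (\<lambda>y. indicator A y * f y)"
proof (rule Bochner_Integration.integrable_bound)
  have "integrable lborel (indicator A :: 'a \<Rightarrow> real)"
    using emeasure_bounded_finite[OF A] by (intro integrable_real_indicator) auto
  then show "integrable lborel (\<lambda>y. indicator A y + \<bar>f y\<bar> powr s)" using int by (rule Bochner_Integration.integrable_add)
  show "AE y in lborel. norm (indicator A y * f y) \<le> norm (indicator A y + \<bar>f y\<bar> powr s)"
  proof (rule AE_I2)
    fix y show "norm (indicator A y * f y) \<le> norm (indicator A y + \<bar>f y\<bar> powr s)"
      using le_one_add_powr[of y] by (auto simp: indicator_def)
  qed
qed measurable

lemma integrable_plate: "integrable lborel (\<lambda>y. indicator (plate \<delta> L a) y * f y)"
  using plate_subset_ball[OF \<delta>(2), of L a] bounded_subset[OF bounded_ball] by (intro integrable_on_bounded) auto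

lemma plate_avg_abs_le: "\<bar>plate_avg \<delta> f L a\<bar> \<le> plate_avg \<delta> (\<lambda>x. \<bar>f x\<bar>) L a"
proof -
  have "\<bar>LINT y|lborel. indicator (plate \<delta> L a) y * f y\<bar> \<le> (LINT y|lborel. \<bar>indicator (plate \<delta> L a) y * f y\<bar>)"
    by (rule integral_abs_bound)
  then show ?thesis
    by (auto simp: plate_avg_def abs_mult plate_vol_def intro!: divide_right_mono)
qed

lemma plate_avg_abs_bound:
  assumes L: "subspace L"
  shows "plate_avg \<delta> (\<lambda>x. \<bar>f x\<bar>) L a \<le> 1 + (LINT x|lborel. \<bar>f x\<bar> powr s) / plate_vol \<delta> L"
proof -
  have v: "0 < plate_vol \<delta> L" using L \<delta> by (rule plate_vol_pos)
  have i1: "integrable lborel (indicator (plate \<delta> L a) :: 'a \<Rightarrow> real)"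
    using emeasure_plate[OF \<delta>, of L a] by (intro integrable_real_indicator) auto
  have abs: "integrable lborel (\<lambda>y. indicator (plate \<delta> L a) y * \<bar>f y\<bar>)"
    using integrable_abs[OF integrable_plate[of L a]] by (simp add: abs_mult)
  have "(LINT y|lborel. indicator (plate \<delta> L a) y * \<bar>f y\<bar>) \<le> (LINT y|lborel. indicator (plate \<delta> L a) y + \<bar>f y\<bar> powr s)"
  proof (rule integral_mono[OF abs])
    show "integrable lborel (\<lambda>y. indicator (plate \<delta> L a) y + \<bar>f y\<bar> powr s)" using i1 int by (rule Bochner_Integration.integrable_add)
    show "indicator (plate \<delta> L a) y * \<bar>f y\<bar> \<le> indicator (plate \<delta> L a) y + \<bar>f y\<bar> powr s" for y
      using le_one_add_powr[of y] by (auto simp: indicator_def)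
  qed
  also have "\<dots> = measure lborel (plate \<delta> L a) + (LINT x|lborel. \<bar>f x\<bar> powr s)"
    using i1 int by simp
  also have "measure lborel (plate \<delta> L a) = plate_vol \<delta> L"
    using emeasure_plate[OF \<delta>, of L a] v by (simp add: measure_def)
  finally show ?thesis using v by (simp add: plate_avg_def field_simps)
qed

lemma bdd_above_plate_avg:
  assumes L: "subspace L"
  shows "bdd_above (range (plate_avg \<delta> f L))" "bdd_above (range (plate_avg \<delta> (\<lambda>x. \<bar>f x\<bar>) L))"
proof -
  show "bdd_above (range (plate_avg \<delta> (\<lambda>x. \<bar>f x\<bar>) L))"
    using plate_avg_abs_bound[OF L] by (rule bdd_aboveI2)
  have "plate_avg \<delta> f L a \<le> 1 + (LINT x|lborel. \<bar>f x\<bar> powr s) / plate_vol \<delta> L" for a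
    using plate_avg_abs_le[of L a] plate_avg_abs_bound[OF L, of a] by linarith
  then show "bdd_above (range (plate_avg \<delta> f L))" by (rule bdd_aboveI2)
qed

text \<open>The boundary of the convex plate is a null set, so the averages depend continuously on the centre.\<close>

lemma continuous_plate_avg:
  assumes L: "subspace L"
  shows "continuous_on UNIV (plate_avg \<delta> f L)"
proof -
  have "isCont (\<lambda>a. LINT y|lborel. indicator (plate \<delta> L a) y * f y) a" for a
    unfolding continuous_at_sequentially
  proof (intro allI impI)
    fix x assume x: "x \<longlonglongrightarrow> a"
    then obtain B where B: "\<And>n. norm (x n) \<le> B" using convergent_imp_Bseq[of x] by (auto simp: Bseq_def convergent_def)
    have sub: "plate \<delta> L (x n) \<subseteq> ball 0 (B + 1)" for n
    proof
      fix y assume "y \<in> plate \<delta> L (x n)"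
      then have "dist (x n) y < 1" using plate_subset_ball[OF \<delta>(2)] by fastforce
      then have "norm (y - x n) < 1" by (simp add: dist_norm norm_minus_commute)
      then have "norm y < B + 1" using B[of n] norm_triangle_sub[of y "x n"] by simp
      then show "y \<in> ball 0 (B + 1)" by simp
    qed
    have fr: "negligible ((+) a ` frontier (plate \<delta> L 0))"
      by (intro negligible_translation negligible_convex_frontier convex_plate L)
    have "AE y in lborel. y \<notin> (+) a ` frontier (plate \<delta> L 0)"
      using fr unfolding negligible_iff_null_sets
      by (metis (no_types, lifting) AE_not_in AE_completion_iff eventually_mono)
    then have lim: "AE y in lborel. (\<lambda>n. indicator (plate \<delta> L (x n)) y * f y) \<longlonglongrightarrow> indicator (plate \<delta> L a) y * f y"
    proof eventually_elim
      case (elim y)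
      have tends: "(\<lambda>n. y - x n) \<longlonglongrightarrow> y - a" by (intro tendsto_intros x)
      have "y - a \<notin> frontier (plate \<delta> L 0)" using elim by (metis add.commute diff_add_cancel image_eqI)
      then consider "y - a \<in> plate \<delta> L 0" | "y - a \<notin> closure (plate \<delta> L 0)"
        by (auto simp: frontier_def interior_open[OF open_plate])
      then have "\<forall>\<^sub>F n in sequentially. (y - x n \<in> plate \<delta> L 0) = (y - a \<in> plate \<delta> L 0)"
      proof cases
        case 1
        then have "\<forall>\<^sub>F n in sequentially. y - x n \<in> plate \<delta> L 0"
          using tends open_plate topological_tendstoD by blast
        then show ?thesis by eventually_elim (simp add: 1)
      next
        case 2
        then have "\<forall>\<^sub>F n in sequentially. y - x n \<in> - closure (plate \<delta> L 0)"
          using tends open_Compl[OF closed_closure] topological_tendstoD by blast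
        then show ?thesis by eventually_elim (use 2 closure_subset in blast)
      qed
      then have "\<forall>\<^sub>F n in sequentially. indicator (plate \<delta> L (x n)) y * f y = indicator (plate \<delta> L a) y * f y"
        by eventually_elim (simp add: indicator_def plate_translate[of y])
      then show ?case by (rule tendsto_eventually)
    qed
    have "(\<lambda>n. LINT y|lborel. indicator (plate \<delta> L (x n)) y * f y) \<longlonglongrightarrow> (LINT y|lborel. indicator (plate \<delta> L a) y * f y)"
    proof (rule integral_dominated_convergence[where w="\<lambda>y. \<bar>indicator (ball 0 (B + 1)) y * f y\<bar>"])
      show "integrable lborel (\<lambda>y. \<bar>indicator (ball 0 (B + 1)) y * f y\<bar>)"
        by (intro integrable_abs integrable_on_bounded) auto
      show "AE y in lborel. norm (indicator (plate \<delta> L (x n)) y * f y) \<le> \<bar>indicator (ball 0 (B + 1)) y * f y\<bar>" for n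
      proof (rule AE_I2)
        fix y show "norm (indicator (plate \<delta> L (x n)) y * f y) \<le> \<bar>indicator (ball 0 (B + 1)) y * f y\<bar>"
          using sub[of n] by (cases "y \<in> plate \<delta> L (x n)") (auto simp: indicator_def)
      qed
    qed (use lim in auto)
    then show "((\<lambda>a. LINT y|lborel. indicator (plate \<delta> L a) y * f y) \<circ> x) \<longlonglongrightarrow> (LINT y|lborel. indicator (plate \<delta> L a) y * f y)"
      by (simp add: o_def)
  qed
  then have "isCont (plate_avg \<delta> f L) a" for a
    unfolding plate_avg_def[abs_def] divide_inverse by (intro continuous_mult continuous_const)
  then show ?thesis by (simp add: continuous_at_imp_continuous_on)
qed

lemma plate_avg_le_dense_SUP:
  assumes L: "subspace L" and D: "\<And>X. open X \<Longrightarrow> X \<noteq> {} \<Longrightarrow> \<exists>d\<in>D. d \<in> X"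
  shows "plate_avg \<delta> f L a \<le> (SUP a\<in>D. plate_avg \<delta> f L a)"
proof (rule ccontr)
  assume *: "\<not> ?thesis"
  let ?S = "SUP a\<in>D. plate_avg \<delta> f L a"
  have "open {x. ?S < plate_avg \<delta> f L x}"
    by (intro open_Collect_less continuous_on_const continuous_plate_avg L)
  moreover have "a \<in> {x. ?S < plate_avg \<delta> f L x}" using * by simp
  ultimately obtain d where d: "d \<in> D" "?S < plate_avg \<delta> f L d" using D[of "{x. ?S < plate_avg \<delta> f L x}"] by blast
  have "plate_avg \<delta> f L d \<le> ?S"
    using d(1) bdd_above_plate_avg(1)[OF L] by (intro cSUP_upper) (auto intro: bdd_above_mono)
  then show False using d by simp
qed

text \<open>Continuity of the averages in the centre reduces the supremum to a dense set; with a
  countable one, the maximal function becomes measurable in \<open>L\<close>.\<close>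

lemma plate_maximal_dense:
  assumes L: "subspace L" and D: "\<And>X. open X \<Longrightarrow> X \<noteq> {} \<Longrightarrow> \<exists>d\<in>D. d \<in> X"
  shows "plate_maximal \<delta> f L = (SUP a\<in>D. plate_avg \<delta> f L a)"
  unfolding plate_maximal_eq[OF f \<delta>]
proof (rule antisym)
  show "(SUP a. plate_avg \<delta> f L a) \<le> (SUP a\<in>D. plate_avg \<delta> f L a)"
    by (intro cSUP_least plate_avg_le_dense_SUP[OF L D]) auto
  have "D \<noteq> {}" using D[of UNIV] by auto
  then show "(SUP a\<in>D. plate_avg \<delta> f L a) \<le> (SUP a. plate_avg \<delta> f L a)"
    using bdd_above_plate_avg(1)[OF L] by (intro cSUP_subset_mono) auto
qed

end

subsection \<open>Measurability in the plane\<close>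

text \<open>A countable description of the plate in which \<open>L\<close> enters only through
  projections of fixed vectors; joint measurability in \<open>L\<close> and \<open>y\<close>
  follows. The strict bound by 1/2 makes the condition on \<open>u\<close> open, so that a dense set
  can meet it.\<close>

lemma mem_plate_dense:
  fixes L :: "'a::euclidean_space set"
  assumes L: "subspace L" and \<delta>: "0 < \<delta>" and D: "\<And>X. open X \<Longrightarrow> X \<noteq> {} \<Longrightarrow> \<exists>d\<in>D. d \<in> X"
  shows "y \<in> plate \<delta> L a \<longleftrightarrow> (\<exists>u\<in>D. norm (closest_point L u) < 1/2 \<and> norm (y - a - closest_point L u) < \<delta>)"
proof
  assume "\<exists>u\<in>D. norm (closest_point L u) < 1/2 \<and> norm (y - a - closest_point L u) < \<delta>"
  then show "y \<in> plate \<delta> L a"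
    unfolding mem_plate using closest_point_in_subspace[OF L] less_imp_le by blast
next
  assume "y \<in> plate \<delta> L a"
  then obtain w where w: "w \<in> L" "norm w \<le> 1/2" "norm (y - a - w) < \<delta>" by (auto simp: mem_plate)
  \<comment> \<open>Shrinking \<open>w\<close> by the factor \<open>1 - e\<close> brings its norm
    strictly below 1/2 and costs at most e/2 in distance, less than the slack \<delta> - |y - a -
    w|.\<close>
  define e where "e = min 1 (\<delta> - norm (y - a - w))"
  have e: "0 < e" "e \<le> 1" "e \<le> \<delta> - norm (y - a - w)" using w by (auto simp: e_def)
  have lin: "linear (closest_point L)" using bounded_linear_closest_point[OF L] by (rule bounded_linear.linear)
  have cont: "continuous_on UNIV (closest_point L)"
    using bounded_linear_closest_point[OF L] by (rule linear_continuous_on)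
  let ?O = "{u. norm (closest_point L u) < 1/2 \<and> norm (y - a - closest_point L u) < \<delta>}"
  have "open ?O"
    by (intro open_Collect_conj open_Collect_less continuous_intros cont)
  moreover have "(1 - e) *\<^sub>R w \<in> ?O"
  proof -
    have cp: "closest_point L ((1 - e) *\<^sub>R w) = (1 - e) *\<^sub>R w"
      by (intro closest_point_subspace_refl L subspace_scale w)
    have "(1 - e) * norm w \<le> (1 - e) * (1/2)" using w e by (intro mult_left_mono) auto
    then have "norm ((1 - e) *\<^sub>R w) \<le> (1 - e) * (1/2)" using e by simp
    moreover have "norm (y - a - (1 - e) *\<^sub>R w) < \<delta>"
    proof -
      have eq: "y - a - (1 - e) *\<^sub>R w = (y - a - w) + e *\<^sub>R w" by (simp add: algebra_simps)
      have "norm (y - a - (1 - e) *\<^sub>R w) \<le> norm (y - a - w) + e * norm w"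
        unfolding eq using norm_triangle_ineq[of "y - a - w" "e *\<^sub>R w"] e by simp
      also have "\<dots> \<le> norm (y - a - w) + e * (1/2)" using w e by (intro add_left_mono mult_left_mono) auto
      also have "\<dots> < \<delta>" using e by linarith
      finally show ?thesis .
    qed
    ultimately show ?thesis using e unfolding mem_Collect_eq cp by (auto intro: le_less_trans)
  qed
  ultimately show "\<exists>u\<in>D. norm (closest_point L u) < 1/2 \<and> norm (y - a - closest_point L u) < \<delta>"
    using D[of ?O] by blast
qed

lemma measurable_plate:
  fixes a :: "real^'n"
  assumes \<delta>: "0 < \<delta>"
  shows "(\<lambda>p. indicator (plate \<delta> (fst p) a) (snd p) :: real) \<in> borel_measurable (grass_borel m \<Otimes>\<^sub>M borel)"
proof -
  obtain D :: "(real^'n) set" where D: "countable D" "\<And>X. open X \<Longrightarrow> X \<noteq> {} \<Longrightarrow> \<exists>d\<in>D. d \<in> X"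
    using countable_dense_setE by blast
  let ?M = "(grass_borel m :: (real^'n) set measure) \<Otimes>\<^sub>M (borel :: (real^'n) measure)"
  have "Measurable.pred ?M (\<lambda>p. \<exists>u\<in>D. norm (closest_point (fst p) u) < 1/2 \<and> norm (snd p - a - closest_point (fst p) u) < \<delta>)"
    using D(1) by measurable
  moreover have "(\<exists>u\<in>D. norm (closest_point (fst p) u) < 1/2 \<and> norm (snd p - a - closest_point (fst p) u) < \<delta>) \<longleftrightarrow> snd p \<in> plate \<delta> (fst p) a"
    if "p \<in> space ?M" for p
    using that by (intro mem_plate_dense[OF _ \<delta> D(2), symmetric]) (auto simp: space_pair_measure grassmannian_def)
  ultimately have [measurable]: "Measurable.pred ?M (\<lambda>p. snd p \<in> plate \<delta> (fst p) a)"
    by (rule measurable_cong[THEN iffD1, rotated])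
  show ?thesis unfolding indicator_def by measurable
qed

lemma measurable_plate_avg:
  fixes f :: "'b \<Rightarrow> real^'n \<Rightarrow> real"
  assumes \<delta>: "0 < \<delta>" and L [measurable]: "L \<in> measurable M (grass_borel m)"
    and f [measurable]: "(\<lambda>p. f (fst p) (snd p)) \<in> borel_measurable (M \<Otimes>\<^sub>M borel)"
  shows "(\<lambda>x. plate_avg \<delta> (f x) (L x) a) \<in> borel_measurable M"
proof -
  have ind: "(\<lambda>p. indicator (plate \<delta> (L (fst p)) b) (snd p) :: real) \<in> borel_measurable (M \<Otimes>\<^sub>M borel)" for b
    using measurable_compose[OF _ measurable_plate[OF \<delta>, of b m], of "\<lambda>p. (L (fst p), snd p)" "M \<Otimes>\<^sub>M borel"] by simp
  have 1: "(\<lambda>x. LINT y|lborel. indicator (plate \<delta> (L x) a) y * f x y) \<in> borel_measurable M"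
    by (rule lborel.borel_measurable_lebesgue_integral)
      (use borel_measurable_times[OF ind[of a] f] in \<open>simp add: case_prod_beta measurable_cong_sets[OF sets_pair_measure_cong[OF refl sets_lborel] refl]\<close>)
  have "(\<lambda>x. LINT y|lborel. indicator (plate \<delta> (L x) 0) y :: real) \<in> borel_measurable M"
    by (rule lborel.borel_measurable_lebesgue_integral)
      (use ind[of 0] in \<open>simp add: case_prod_beta measurable_cong_sets[OF sets_pair_measure_cong[OF refl sets_lborel] refl]\<close>)
  then have "(\<lambda>x. plate_vol \<delta> (L x)) \<in> borel_measurable M" by (simp add: plate_vol_def)
  with 1 show ?thesis unfolding plate_avg_def by (rule borel_measurable_divide)
qed

subsection \<open>Maximal functions over fibres\<close>

lemma bump_indicator:
  assumes f: "bump H b f" and [measurable]: "A \<in> sets borel"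
  shows "bump H b (\<lambda>x. indicator A x * f x)"
  unfolding bump_def
proof (intro conjI allI impI)
  note [measurable] = bumpD(1)[OF f]
  show "(\<lambda>x. indicator A x * f x) \<in> borel_measurable borel" by measurable
  show "0 \<le> indicator A x * f x" "indicator A x * f x \<le> H" for x
    using bumpD(2,3,5)[OF f] by (auto simp: indicator_def)
  show "indicator A x * f x = 0" if "2 \<le> dist x b" for x using bumpD(4)[OF f that] by simp
qed

lemma plate_avg_nonneg: "(\<And>x. 0 \<le> g x) \<Longrightarrow> 0 \<le> plate_avg \<delta> g L a"
  unfolding plate_avg_def plate_vol_def
  by (intro divide_nonneg_nonneg Bochner_Integration.integral_nonneg) auto

text \<open>Jensen's inequality on the plate. It trades integrability p/t of the X-ray transform for
  the exponent p of the hypothesis.\<close>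

lemma plate_avg_le_powr:
  assumes g: "bump H b g" and t: "0 < t" "t \<le> 1" and L: "subspace L" and \<delta>: "0 < \<delta>" "\<delta> \<le> 1/2"
  shows "plate_avg \<delta> g L a \<le> plate_avg \<delta> (\<lambda>x. g x powr (1/t)) L a powr t"
proof -
  note [measurable] = bumpD(1)[OF g]
  define V where "V = plate_vol \<delta> L"
  have V: "0 < V" unfolding V_def by (rule plate_vol_pos[OF L \<delta>])
  let ?A = "plate \<delta> L a"
  have gt: "bump (H powr (1/t)) b (\<lambda>x. g x powr (1/t))" using t by (intro bump_powr[OF g]) simp
  define I where "I = (LINT x|lborel. indicator ?A x * g x powr (1/t))"
  have I: "(\<integral>\<^sup>+x. ennreal (indicator ?A x * g x powr (1/t)) \<partial>lborel) = ennreal I"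
    unfolding I_def by (rule bump_nn_integral_eq[OF bump_indicator[OF gt sets_plate]])
  have I0: "0 \<le> I" unfolding I_def by (intro Bochner_Integration.integral_nonneg) auto
  have "ennreal (LINT x|lborel. indicator ?A x * g x) = (\<integral>\<^sup>+x. ennreal (indicator ?A x * g x) \<partial>lborel)"
    by (rule bump_nn_integral_eq[OF bump_indicator[OF g sets_plate], symmetric])
  also have "\<dots> = (\<integral>\<^sup>+x. ennreal ((indicator ?A x * g x powr (1/t)) powr t * indicator ?A x powr (1 - t)) \<partial>lborel)"
    using t bumpD(2)[OF g] by (intro nn_integral_cong) (auto simp: indicator_def powr_powr)
  also have "\<dots> \<le> ennreal (I powr t * V powr (1 - t))"
  proof (rule nn_integral_Holder)
    show "(\<integral>\<^sup>+x. ennreal (indicator ?A x) \<partial>lborel) \<le> ennreal V"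
      using emeasure_plate[OF \<delta>, of L a] by (simp add: ennreal_indicator V_def)
  qed (use I I0 V t in auto)
  finally have "(LINT x|lborel. indicator ?A x * g x) \<le> I powr t * V powr (1 - t)" by simp
  then have "(LINT x|lborel. indicator ?A x * g x) / V \<le> I powr t * V powr (1 - t) / V"
    using V by (intro divide_right_mono) auto
  also have "\<dots> = (I / V) powr t" using V I0 by (simp add: powr_diff powr_divide)
  finally show ?thesis by (simp add: plate_avg_def V_def I_def)
qed

context coordinate_split
begin

lemma card_eq: "CARD('n) = Suc CARD('m)"
proof -
  have "CARD('m) = card (UNIV - {i0})" by (rule bij_betw_same_card[OF bij])
  also have "\<dots> = CARD('n) - 1" by (simp add: card_Diff_singleton)
  finally show ?thesis using Suc_leI[of 0 "CARD('n)"] by simp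
qed

lemma proj_rot_plate:
  assumes "x \<in> plate \<delta> (lift_plane v L) a"
  shows "proj (rot v x) \<in> plate \<delta> L (proj (rot v a))"
proof -
  obtain w where w: "w \<in> lift_plane v L" "norm w \<le> 1/2" "norm (x - a - w) < \<delta>"
    using assms by (auto simp: mem_plate)
  have "norm (proj (rot v w)) \<le> norm w" using norm_proj_le[of "rot v w"] by simp
  moreover have "proj (rot v x) - proj (rot v a) - proj (rot v w) = proj (rot v (x - a - w))"
    by (simp add: proj_diff linear_diff[OF linear_rot])
  then have "norm (proj (rot v x) - proj (rot v a) - proj (rot v w)) \<le> norm (x - a - w)"
    using norm_proj_le[of "rot v (x - a - w)"] by simp
  ultimately show ?thesis using w by (auto simp: mem_plate mem_lift_plane intro!: bexI[of _ "proj (rot v w)"])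
qed

text \<open>Shrinking the base by the factor two leaves room for the extra direction, so the constant does not
  depend on \<open>\<delta>\<close>.\<close>

lemma plate_vol_lift_plane:
  assumes L: "subspace L" and \<delta>: "0 < \<delta>" "\<delta> \<le> 1/2"
  shows "plate_vol \<delta> L \<le> 2 ^ CARD('n) * plate_vol \<delta> (lift_plane v L)"
proof -
  let ?A = "plate \<delta> (lift_plane v L) 0" and ?B = "plate \<delta> L 0"
  define I where "I = (\<integral>\<^sup>+y. indicator ?B (2 *\<^sub>R y) \<partial>(lborel :: (real^'m) measure))"
  \<comment> \<open>Halving a base point w leaves norm at most 1/4, so adding a coordinate of size
    at most 1/4 stays within the radius 1/2. The halving costs \<open>2 ^ CARD('m)\<close> in volume
    and the interval has length 1/2, whence the total factor \<open>2 ^ CARD('n)\<close>.\<close>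
  have mem: "rot v (join t y) \<in> ?A" if ty: "t \<in> {-1/4..1/4}" "2 *\<^sub>R y \<in> ?B" for t y
  proof -
    obtain w where w: "w \<in> L" "norm w \<le> 1/2" "norm (2 *\<^sub>R y - w) < \<delta>" using ty(2) by (auto simp: mem_plate)
    define z where "z = (1/2) *\<^sub>R w"
    define u where "u = rot v (join t z)"
    have "z \<in> L" unfolding z_def using L w(1) by (rule subspace_scale)
    then have uL: "u \<in> lift_plane v L" by (simp add: u_def mem_lift_plane)
    have "join t y - join t z = join 0 (y - z)"
      using linear_diff[OF linear_join, of "(t, y)" "(t, z)"] by simp
    then have "norm (rot v (join t y) - u) ^ 2 = norm (y - z) ^ 2"
      unfolding u_def linear_diff[OF linear_rot, symmetric] norm_rot by (simp add: norm_join)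
    then have "norm (rot v (join t y) - u) = norm (y - z)" by simp
    also have "y - z = (1/2) *\<^sub>R (2 *\<^sub>R y - w)" by (simp add: z_def scaleR_diff_right)
    also have "norm \<dots> < \<delta>" using w(3) \<delta> by simp
    finally have 1: "norm (rot v (join t y) - u) < \<delta>" .
    have "norm z \<le> 1/4" using w(2) by (simp add: z_def)
    then have "norm z ^ 2 \<le> (1/4) ^ 2" by (intro power_mono) auto
    moreover have "t ^ 2 \<le> (1/4) ^ 2" using ty(1) by (intro abs_le_square_iff[THEN iffD1]) auto
    moreover have "norm u ^ 2 = t ^ 2 + norm z ^ 2" unfolding u_def norm_rot norm_join ..
    ultimately have "norm u ^ 2 \<le> (1/2) ^ 2" by (simp add: power2_eq_square)
    then have "norm u \<le> 1/2" by (rule power2_le_imp_le) simp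
    then show ?thesis using 1 uL by (auto simp: mem_plate)
  qed
  have "ennreal (1/2) * I = (\<integral>\<^sup>+y. ennreal (1/2) * indicator ?B (2 *\<^sub>R y) \<partial>(lborel :: (real^'m) measure))"
    unfolding I_def by (rule nn_integral_cmult[symmetric]) measurable
  also have "\<dots> = (\<integral>\<^sup>+y. (\<integral>\<^sup>+t. indicator ?B (2 *\<^sub>R y) * indicator {-1/4..1/4 :: real} t \<partial>lborel) \<partial>(lborel :: (real^'m) measure))"
    by (intro nn_integral_cong, subst nn_integral_cmult_indicator) (simp_all add: mult.commute)
  also have "\<dots> \<le> (\<integral>\<^sup>+y. (\<integral>\<^sup>+t. indicator ?A (rot v (join t y)) \<partial>lborel) \<partial>(lborel :: (real^'m) measure))"
    using mem by (intro nn_integral_mono) (auto simp: indicator_def)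
  also have "\<dots> = (\<integral>\<^sup>+x. indicator ?A x \<partial>lborel)" by (rule nn_integral_rot_join) simp
  also have "\<dots> = ennreal (plate_vol \<delta> (lift_plane v L))" using emeasure_plate[OF \<delta>, of "lift_plane v L" 0] by simp
  finally have I: "ennreal (1/2) * I \<le> ennreal (plate_vol \<delta> (lift_plane v L))" .
  have "ennreal (plate_vol \<delta> L) = (\<integral>\<^sup>+y. indicator ?B y \<partial>(lborel :: (real^'m) measure))"
    using emeasure_plate[OF \<delta>, of L 0] by simp
  also have "\<dots> = ennreal (\<bar>2\<bar> ^ CARD('m)) * I"
    unfolding I_def using nn_integral_lborel_scaleR[of "indicator ?B :: real^'m \<Rightarrow> ennreal" 2] by simp
  also have "\<dots> = ennreal (2 ^ CARD('n)) * (ennreal (1/2) * I)"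
  proof -
    have "ennreal (2 ^ CARD('n)) * ennreal (1/2) = ennreal (2 ^ CARD('m))"
      by (subst ennreal_mult[symmetric]) (auto simp: card_eq)
    then show ?thesis by (simp only: mult.assoc[symmetric] abs_numeral)
  qed
  also have "\<dots> \<le> ennreal (2 ^ CARD('n)) * ennreal (plate_vol \<delta> (lift_plane v L))"
    using I by (rule mult_left_mono) simp
  also have "\<dots> = ennreal (2 ^ CARD('n) * plate_vol \<delta> (lift_plane v L))"
    by (simp add: ennreal_mult plate_vol_def)
  finally show ?thesis by (subst (asm) ennreal_le_iff) (auto simp: plate_vol_def)
qed

lemma subspace_lift_plane: "subspace L \<Longrightarrow> subspace (lift_plane v L)"
  unfolding lift_plane_def by (intro linear_subspace_image linear_rot subspace_cylinder)

text \<open>Lines parallel to \<open>v\<close> that meet the large plate have base points in the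
  small one. Integrating \<open>f\<close> over each whole line instead of its part in the plate
  gives the X-ray transform, and the two volumes are comparable.\<close>

lemma plate_avg_lift_le:
  assumes f: "bump H b f" and L: "subspace L" and \<delta>: "0 < \<delta>" "\<delta> \<le> 1/2"
  shows "plate_avg \<delta> f (lift_plane v L) a \<le> 2 ^ CARD('n) * plate_avg \<delta> (xray f v) L (proj (rot v a))"
proof -
  note [measurable] = bumpD(1)[OF f]
  let ?A = "plate \<delta> (lift_plane v L) a" and ?B = "plate \<delta> L (proj (rot v a))"
  define I where "I = (LINT x|lborel. indicator ?A x * f x)"
  define J where "J = (LINT y|lborel. indicator ?B y * xray f v y)"
  have "ennreal I = (\<integral>\<^sup>+x. ennreal (indicator ?A x * f x) \<partial>lborel)"
    unfolding I_def by (rule bump_nn_integral_eq[OF bump_indicator[OF f sets_plate], symmetric])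
  also have "\<dots> = (\<integral>\<^sup>+y. (\<integral>\<^sup>+t. ennreal (indicator ?A (rot v (join t y)) * f (rot v (join t y))) \<partial>lborel) \<partial>lborel)"
    by (rule nn_integral_rot_join[symmetric]) measurable
  also have "\<dots> \<le> (\<integral>\<^sup>+y. (\<integral>\<^sup>+t. indicator ?B y * ennreal (f (rot v (join t y))) \<partial>lborel) \<partial>lborel)"
  proof (intro nn_integral_mono)
    fix t y
    show "ennreal (indicator ?A (rot v (join t y)) * f (rot v (join t y))) \<le> indicator ?B y * ennreal (f (rot v (join t y)))"
      using proj_rot_plate[of "rot v (join t y)" \<delta> v L a] by (auto simp: indicator_def)
  qed
  also have "\<dots> = (\<integral>\<^sup>+y. ennreal (indicator ?B y * xray f v y) \<partial>lborel)"
    by (intro nn_integral_cong) (simp add: nn_integral_cmult ennreal_xray[OF f, symmetric] indicator_def)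
  also have "\<dots> = ennreal J"
    unfolding J_def by (rule bump_nn_integral_eq[OF bump_indicator[OF bump_xray[OF f] sets_plate]])
  finally have "I \<le> J"
    using xray_nonneg[OF f] by (subst (asm) ennreal_le_iff) (auto simp: J_def intro!: Bochner_Integration.integral_nonneg)
  have J0: "0 \<le> J" unfolding J_def using xray_nonneg[OF f] by (auto intro!: Bochner_Integration.integral_nonneg)
  have V: "0 < plate_vol \<delta> L" "0 < plate_vol \<delta> (lift_plane v L)"
    using plate_vol_pos[OF L \<delta>] plate_vol_pos[OF subspace_lift_plane[OF L] \<delta>] by auto
  have "I / plate_vol \<delta> (lift_plane v L) \<le> J / plate_vol \<delta> (lift_plane v L)"
    using \<open>I \<le> J\<close> V by (intro divide_right_mono) auto
  also have "\<dots> \<le> 2 ^ CARD('n) * (J / plate_vol \<delta> L)"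
  proof -
    have "J * plate_vol \<delta> L \<le> J * (2 ^ CARD('n) * plate_vol \<delta> (lift_plane v L))"
      using plate_vol_lift_plane[OF L \<delta>] J0 by (intro mult_left_mono) auto
    then show ?thesis using V by (simp add: field_simps)
  qed
  finally show ?thesis unfolding plate_avg_def I_def J_def .
qed

end

text \<open>A maximal function with the power taken inside and values in \<open>ennreal\<close>: it
  is defined without any boundedness, and for countable \<open>D\<close> it is measurable jointly
  with parameters of \<open>f\<close>.\<close>

definition avg_sup :: "(real^'n) set \<Rightarrow> real \<Rightarrow> real \<Rightarrow> (real^'n \<Rightarrow> real) \<Rightarrow> (real^'n) set \<Rightarrow> ennreal" where
  "avg_sup D s \<delta> f L = (SUP a\<in>D. ennreal (plate_avg \<delta> f L a powr s))"

lemma measurable_avg_sup: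
  fixes f :: "'b \<Rightarrow> real^'n \<Rightarrow> real"
  assumes "countable D" "0 < \<delta>" "L \<in> measurable M (grass_borel m)"
    and "(\<lambda>p. f (fst p) (snd p)) \<in> borel_measurable (M \<Otimes>\<^sub>M borel)"
  shows "(\<lambda>x. avg_sup D s \<delta> (f x) (L x)) \<in> borel_measurable M"
proof -
  have [measurable]: "(\<lambda>x. plate_avg \<delta> (f x) (L x) a) \<in> borel_measurable M" for a
    by (rule measurable_plate_avg[OF assms(2-4)])
  show ?thesis unfolding avg_sup_def by (intro borel_measurable_SUP assms(1)) measurable
qed

context coordinate_split
begin

text \<open>The hypothesis is applied to the power 1/t of the X-ray transform X. The p-norm of that
  power is an integral of X^(p/t), and by Jensen the average of X is at most the t-th power of the
  average of X^(1/t), which turns the exponent q into q/t.\<close>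

lemma fibre_bound:
  fixes p q t A \<delta> :: real
  assumes hyp: "\<And>g :: real^'m \<Rightarrow> real. g \<in> Lp_space lebesgue p \<Longrightarrow>
       plate_maximal \<delta> g \<in> Lp_space (grassmann_measure m) q \<and>
       Lp_norm (grassmann_measure m) q (plate_maximal \<delta> g) \<le> A * Lp_norm lebesgue p g"
    and m: "m \<le> CARD('m)" and A: "0 \<le> A" and p: "0 < p" and q: "0 < q" and t: "0 < t" "t \<le> 1"
    and \<delta>: "0 < \<delta>" "\<delta> \<le> 1/2" and f: "bump H b f"
  shows "(\<integral>\<^sup>+L. avg_sup D (q / t) \<delta> f (lift_plane v L) \<partial>grassmann_measure m)
    \<le> ennreal (2 powr (CARD('n) * (q / t)) * A powr q * (LINT y|lborel. xray f v y powr (p / t)) powr (q / p))"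
proof -
  define N where "N = (grassmann_measure m :: (real^'m) set measure)"
  note inv = invariant_radon_prob_grassmann_measure[OF m, folded N_def]
  have spN: "space N = grassmannian m"
    using invariant_radon_probD(1)[OF inv] by (auto dest: sets_eq_imp_space_eq)
  define g where "g y = xray f v y powr (1 / t)" for y
  have g: "bump ((4 * H) powr (1/t)) (proj (rot v b)) g"
    unfolding g_def using t by (intro bump_powr[OF bump_xray[OF f]]) simp
  note [measurable] = bumpD(1)[OF g]
  have gp: "\<bar>g y\<bar> powr p = xray f v y powr (p / t)" for y by (simp add: g_def powr_powr)
  have ib: "integrable lborel (\<lambda>y. \<bar>g y\<bar> powr p)"
    unfolding gp using p t by (intro bump_integrable[OF bump_powr[OF bump_xray[OF f]]]) simp
  have gL: "g \<in> Lp_space lebesgue p"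
  proof -
    have "g \<in> borel_measurable lebesgue" by (rule measurable_completion) simp
    then show ?thesis unfolding Lp_space_def using ib by (simp add: integrable_completion)
  qed
  define Z where "Z = (LINT y|lborel. xray f v y powr (p / t))"
  have Z0: "0 \<le> Z" unfolding Z_def by (intro Bochner_Integration.integral_nonneg) simp
  have nZ: "Lp_norm lebesgue p g = Z powr (1 / p)"
    unfolding Lp_norm_def Z_def gp[symmetric] by (subst integral_completion) auto
  define F where "F = plate_maximal \<delta> g"
  have F: "F \<in> borel_measurable N" "integrable N (\<lambda>L. \<bar>F L\<bar> powr q)" and Fn: "Lp_norm N q F \<le> A * Z powr (1 / p)"
    using hyp[OF gL] by (auto simp: Lp_space_def F_def N_def nZ)
  define Y where "Y = (LINT L|N. \<bar>F L\<bar> powr q)"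
  have Y0: "0 \<le> Y" unfolding Y_def by (intro Bochner_Integration.integral_nonneg) simp
  have "Y = (Lp_norm N q F) powr q" using q Y0 by (simp add: Lp_norm_def Y_def[symmetric] powr_powr)
  also have "\<dots> \<le> (A * Z powr (1 / p)) powr q" using Fn q by (intro powr_mono2) (auto simp: Lp_norm_def)
  also have "\<dots> = A powr q * Z powr (q / p)" using A by (simp add: powr_mult powr_powr)
  finally have Yb: "Y \<le> A powr q * Z powr (q / p)" .
  have i1: "integrable lborel (\<lambda>y. \<bar>g y\<bar> powr 1)"
    using bump_integrable[OF g] bumpD(2)[OF g] by simp
  interpret g: locally_bounded_average g 1 \<delta>
    by unfold_locales (use i1 \<delta> in auto)
  let ?c = "2 powr (CARD('n) * (q / t))"
  have pw: "plate_avg \<delta> f (lift_plane v L) a powr (q / t) \<le> ?c * \<bar>F L\<bar> powr q" if LG: "L \<in> grassmannian m" for L a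
  proof -
    have L: "subspace L" using LG by (rule grassmannianD)
    let ?a = "proj (rot v a)"
    have "plate_avg \<delta> g L ?a \<le> (SUP a. plate_avg \<delta> g L a)"
      using g.bdd_above_plate_avg(1)[OF L] by (intro cSUP_upper) auto
    then have gF: "plate_avg \<delta> g L ?a \<le> F L" by (simp add: F_def plate_maximal_eq[OF g.f \<delta>])
    have g0: "0 \<le> plate_avg \<delta> g L ?a" by (intro plate_avg_nonneg) (simp add: g_def)
    have "plate_avg \<delta> f (lift_plane v L) a \<le> 2 ^ CARD('n) * plate_avg \<delta> (xray f v) L ?a"
      by (rule plate_avg_lift_le[OF f L \<delta>])
    also have "\<dots> \<le> 2 ^ CARD('n) * plate_avg \<delta> g L ?a powr t"
      unfolding g_def by (intro mult_left_mono plate_avg_le_powr[OF bump_xray[OF f] t L \<delta>]) simp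
    also have "\<dots> \<le> 2 ^ CARD('n) * \<bar>F L\<bar> powr t"
      using gF g0 t by (intro mult_left_mono powr_mono2) auto
    finally have "plate_avg \<delta> f (lift_plane v L) a powr (q / t) \<le> (2 ^ CARD('n) * \<bar>F L\<bar> powr t) powr (q / t)"
      using q t bumpD(2)[OF f] by (intro powr_mono2 plate_avg_nonneg) auto
    also have "\<dots> = ?c * \<bar>F L\<bar> powr q"
      using t by (simp add: powr_mult powr_powr powr_realpow[symmetric])
    finally show ?thesis .
  qed
  have "(\<integral>\<^sup>+L. avg_sup D (q / t) \<delta> f (lift_plane v L) \<partial>N) \<le> (\<integral>\<^sup>+L. ennreal ?c * ennreal (\<bar>F L\<bar> powr q) \<partial>N)"
    unfolding avg_sup_def
    by (intro nn_integral_mono SUP_least, subst ennreal_mult[symmetric]) (auto simp: spN simp del: times_divide_eq_right intro!: ennreal_leI pw)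
  also have "\<dots> = ennreal ?c * (\<integral>\<^sup>+L. ennreal (\<bar>F L\<bar> powr q) \<partial>N)"
    using F(1) by (intro nn_integral_cmult) measurable
  also have "(\<integral>\<^sup>+L. ennreal (\<bar>F L\<bar> powr q) \<partial>N) = ennreal Y"
    unfolding Y_def by (intro nn_integral_eq_integral F(2)) simp
  also have "ennreal ?c * ennreal Y \<le> ennreal ?c * ennreal (A powr q * Z powr (q / p))"
    using Yb by (intro mult_left_mono ennreal_leI) auto
  also have "\<dots> = ennreal (?c * A powr q * Z powr (q / p))"
    by (simp add: ennreal_mult[symmetric] mult.assoc)
  finally show ?thesis unfolding N_def Z_def .
qed

text \<open>The first factor is the volume comparison of plates raised to the power
  \<open>s\<close>; the second is the constant of the mixed norm bound after Jensen over
  directions.\<close>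

definition local_const :: "real \<Rightarrow> real \<Rightarrow> real \<Rightarrow> real" where
  "local_const s \<rho> \<eta> = 2 powr (real CARD('n) * s) * (enn2real endpoint_const * 4 powr (\<rho> - 1)) powr (\<eta> / \<rho>)"

text \<open>Integrate the fibre bound over directions. It leaves the power q/p of the inner
  integral, whereas the mixed norm bound controls the power \<rho>; since q/p \<le> \<rho> and
  \<open>dirs\<close> has mass 1, Hoelder against the constant 1 connects them.\<close>

lemma local_bound:
  fixes p q t A \<delta> \<rho> :: real and f :: "real^'n \<Rightarrow> real"
  assumes hyp: "\<And>g :: real^'m \<Rightarrow> real. g \<in> Lp_space lebesgue p \<Longrightarrow>
       plate_maximal \<delta> g \<in> Lp_space (grassmann_measure m) q \<and>
       Lp_norm (grassmann_measure m) q (plate_maximal \<delta> g) \<le> A * Lp_norm lebesgue p g"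
    and m: "m \<le> CARD('m)" and A: "0 \<le> A" and p: "0 < p" and q: "0 < q" and t: "0 < t" "t \<le> 1"
    and \<rho>: "1 \<le> \<rho>" and pt: "p / t = (real CARD('n) - 1 + 2 * \<rho>) / \<rho>" and qp: "q / p \<le> \<rho>"
    and \<delta>: "0 < \<delta>" "\<delta> \<le> 1/2" and f: "bump H b f" and D: "countable D"
  shows "(\<integral>\<^sup>+L. avg_sup D (q / t) \<delta> f L \<partial>grassmann_measure (Suc m))
    \<le> ennreal (local_const (q / t) \<rho> (q / p) * A powr q *
        (LINT x|lborel. f x powr ((real CARD('n) - 1 + 2 * \<rho>) / (1 + \<rho>))) powr ((1 + \<rho>) * (q / p) / \<rho>))"
proof -
  define N where "N = (grassmann_measure m :: (real^'m) set measure)"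
  note inv = invariant_radon_prob_grassmann_measure[OF m, folded N_def]
  have sN: "sets N = sets (grass_borel m)" using invariant_radon_probD(1)[OF inv] .
  have spN: "space N = grassmannian m" using sN by (auto dest: sets_eq_imp_space_eq)
  interpret N: finite_measure N using invariant_radon_probD(2)[OF inv] by (intro finite_measureI) auto
  define R where "R = real CARD('n) - 1 + 2 * \<rho>"
  define F where "F = (LINT x|lborel. f x powr (R / (1 + \<rho>)))"
  define \<eta> where "\<eta> = q / p"
  have \<eta>: "0 < \<eta>" "\<eta> \<le> \<rho>" using p q qp by (auto simp: \<eta>_def)
  have F0: "0 \<le> F" unfolding F_def by (intro Bochner_Integration.integral_nonneg) simp
  note [measurable] = bumpD(1)[OF f]
  define Z where "Z v = (LINT y|lborel. xray f v y powr (p / t))" for v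
  have Z0: "0 \<le> Z v" for v unfolding Z_def by (intro Bochner_Integration.integral_nonneg) simp
  have [measurable]: "Z \<in> borel_measurable borel" unfolding Z_def by measurable
  define K where "K = enn2real endpoint_const * 4 powr (\<rho> - 1)"
  have K: "0 \<le> K" by (simp add: K_def)
  let ?c = "2 powr (CARD('n) * (q / t)) * A powr q"
  let ?X = "\<lambda>x. lift_plane (fst x) (snd x)"
  have X: "?X \<in> measurable (dirs \<Otimes>\<^sub>M N) (grass_borel (Suc m))"
    using measurable_lift_plane[of m] by (simp add: measurable_cong_sets[OF sets_pair_measure_cong[OF sets_dirs sN] refl])
  have G: "avg_sup D (q / t) \<delta> f \<in> borel_measurable (grass_borel (Suc m))"
    using measurable_avg_sup[OF D \<delta>(1), of "\<lambda>L. L" "grass_borel (Suc m)" "Suc m" "\<lambda>_. f" "q / t"] by simp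
  have "(\<integral>\<^sup>+L. avg_sup D (q / t) \<delta> f L \<partial>grassmann_measure (Suc m)) = (\<integral>\<^sup>+x. avg_sup D (q / t) \<delta> f (?X x) \<partial>(dirs \<Otimes>\<^sub>M N))"
    unfolding grassmann_measure_fibre[OF m] N_def[symmetric] by (rule nn_integral_distr[OF X]) (use G in simp)
  also have "\<dots> = (\<integral>\<^sup>+v. (\<integral>\<^sup>+L. avg_sup D (q / t) \<delta> f (lift_plane v L) \<partial>N) \<partial>dirs)"
    using N.nn_integral_fst[OF measurable_compose[OF X G]] by simp
  also have "\<dots> \<le> (\<integral>\<^sup>+v. ennreal ?c * ennreal (Z v powr \<eta>) \<partial>dirs)"
    using fibre_bound[OF hyp m A p q t \<delta> f]
    by (intro nn_integral_mono) (simp add: N_def Z_def \<eta>_def ennreal_mult[symmetric])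
  also have "\<dots> = ennreal ?c * (\<integral>\<^sup>+v. ennreal (Z v powr \<eta>) \<partial>dirs)"
    by (rule nn_integral_cmult) (simp add: measurable_cong_sets[OF sets_dirs refl])
  also have "(\<integral>\<^sup>+v. ennreal (Z v powr \<eta>) \<partial>dirs) = (\<integral>\<^sup>+v. ennreal ((Z v powr \<rho>) powr (\<eta> / \<rho>) * 1 powr (1 - \<eta> / \<rho>)) \<partial>dirs)"
    using \<rho> by (simp add: powr_powr)
  also have "\<dots> \<le> ennreal ((K * F powr (\<rho> + 1)) powr (\<eta> / \<rho>) * 1 powr (1 - \<eta> / \<rho>))"
  proof (rule nn_integral_Holder)
    show "(\<lambda>v. Z v powr \<rho>) \<in> borel_measurable dirs" by (simp add: measurable_cong_sets[OF sets_dirs refl])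
    show "(\<integral>\<^sup>+v. ennreal (Z v powr \<rho>) \<partial>dirs) \<le> ennreal (K * F powr (\<rho> + 1))"
      using xray_mixed_norm[OF f \<rho>] by (simp add: Z_def K_def F_def R_def pt)
    show "(\<integral>\<^sup>+v. ennreal 1 \<partial>(dirs :: (real^'n) measure)) \<le> ennreal 1" by (simp add: emeasure_dirs_UNIV)
  qed (use K \<eta> \<rho> in auto)
  also have "(K * F powr (\<rho> + 1)) powr (\<eta> / \<rho>) * 1 powr (1 - \<eta> / \<rho>) = K powr (\<eta> / \<rho>) * F powr ((1 + \<rho>) * \<eta> / \<rho>)"
    using K by (simp add: powr_mult powr_powr add.commute)
  also have "ennreal ?c * ennreal (K powr (\<eta> / \<rho>) * F powr ((1 + \<rho>) * \<eta> / \<rho>))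
    = ennreal (local_const (q / t) \<rho> \<eta> * A powr q * F powr ((1 + \<rho>) * \<eta> / \<rho>))"
    by (simp add: local_const_def K_def ennreal_mult[symmetric] mult_ac)
  finally show ?thesis by (simp add: mult_left_mono F_def R_def \<eta>_def)
qed

end

subsection \<open>Removing the support condition\<close>

text \<open>Averaging over the position \<open>b\<close> of a ball of radius \<open>2\<close> that contains the plate removes the
  support condition, because the exponent \<open>e\<close> is at least 1.\<close>

lemma globalize_bound:
  fixes f :: "real^'n \<Rightarrow> real" and M :: "(real^'n) set measure"
  assumes loc: "\<And>b g. bump H b g \<Longrightarrow>
      (\<integral>\<^sup>+L. avg_sup D s \<delta> g L \<partial>M) \<le> ennreal (K * (LINT x|lborel. g x powr u) powr e)"
    and M: "sets M = sets (grass_borel m)" "finite_measure M" and D: "countable D"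
    and \<delta>: "0 < \<delta>" "\<delta> \<le> 1/2" and K: "0 \<le> K" and u: "0 < u" and e: "1 \<le> e"
    and f: "f \<in> borel_measurable borel" "\<And>x. 0 \<le> f x" "\<And>x. f x \<le> H" "integrable lborel (\<lambda>x. f x powr u)"
  shows "(\<integral>\<^sup>+L. avg_sup D s \<delta> f L \<partial>M) \<le> ennreal (2 ^ CARD('n) * K * (LINT x|lborel. f x powr u) powr e)"
proof -
  note [measurable] = f(1)
  interpret M: finite_measure M by (rule M(2))
  interpret pair_sigma_finite M "lborel :: (real^'n) measure" by unfold_locales
  define F where "F = (LINT x|lborel. f x powr u)"
  have F0: "0 \<le> F" unfolding F_def by (intro Bochner_Integration.integral_nonneg) simp
  have Fn: "(\<integral>\<^sup>+x. ennreal (f x powr u) \<partial>lborel) = ennreal F"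
    unfolding F_def by (intro nn_integral_eq_integral f(4)) simp
  define V where "V = unit_ball_vol (real CARD('n))"
  have V: "0 < V" unfolding V_def by (intro unit_ball_vol_pos) simp
  have V1: "emeasure lborel (ball a 1 :: (real^'n) set) = ennreal V"
    and V2: "emeasure lborel (ball a 2 :: (real^'n) set) = ennreal (V * 2 ^ CARD('n))" for a
    by (simp_all add: emeasure_ball V_def)
  define g where "g b x = f x * indicator (ball b 2) x" for b x
  have g: "bump H b (g b)" for b
    unfolding bump_def
  proof (intro conjI allI impI)
    have [measurable]: "ball b 2 \<in> sets borel" by simp
    show "g b \<in> borel_measurable borel" unfolding g_def by measurable
    show "0 \<le> g b x" "g b x \<le> H" for x using f(2,3) order_trans[OF f(2) f(3)] by (auto simp: g_def indicator_def)
    show "g b x = 0" if "2 \<le> dist x b" for x using that by (simp add: g_def dist_commute)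
  qed
  have g_meas: "(\<lambda>q. g (snd (fst q)) (snd q)) \<in> borel_measurable ((M \<Otimes>\<^sub>M lborel) \<Otimes>\<^sub>M borel)"
  proof -
    have "(\<lambda>q :: ((real^'n) set \<times> (real^'n)) \<times> (real^'n). g (snd (fst q)) (snd q)) = (\<lambda>q. if dist (snd (fst q)) (snd q) < 2 then f (snd q) else 0)"
      by (auto simp: g_def fun_eq_iff)
    moreover have "\<dots> \<in> borel_measurable ((M \<Otimes>\<^sub>M lborel) \<Otimes>\<^sub>M borel)" by measurable
    ultimately show ?thesis by simp
  qed
  have G_meas: "(\<lambda>p. avg_sup D s \<delta> (g (snd p)) (fst p)) \<in> borel_measurable (M \<Otimes>\<^sub>M lborel)"
    by (rule measurable_avg_sup[OF D \<delta>(1) _ g_meas, of _ m]) (simp add: measurable_cong_sets[OF refl M(1)[symmetric]])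
  define Fb where "Fb b = (LINT x|lborel. g b x powr u)" for b
  have Fbn: "(\<integral>\<^sup>+x. ennreal (g b x powr u) \<partial>lborel) = ennreal (Fb b)" for b
    unfolding Fb_def by (rule bump_nn_integral_eq[OF bump_powr[OF g u]])
  have Fb0: "0 \<le> Fb b" for b unfolding Fb_def by (intro Bochner_Integration.integral_nonneg) simp
  have gf: "g b x powr u = f x powr u * indicator (ball b 2) x" for b x
    using u by (auto simp: g_def indicator_def)
  have FbF: "Fb b \<le> F" for b
  proof -
    have "ennreal (Fb b) \<le> ennreal F"
      unfolding Fbn[symmetric] Fn[symmetric] gf by (intro nn_integral_mono ennreal_leI) (auto simp: indicator_def)
    then show ?thesis using F0 by simp
  qed
  \<comment> \<open>For \<open>b\<close> within distance 1 of \<open>a\<close>, the plate at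
    \<open>a\<close> lies in \<open>ball b 2\<close>, so \<open>f\<close> and \<open>g b\<close>
    have the same average on it. Integrating over these \<open>b\<close> produces the factor
    \<open>V\<close>.\<close>
  have pw: "avg_sup D s \<delta> f L * ennreal V \<le> (\<integral>\<^sup>+b. avg_sup D s \<delta> (g b) L \<partial>lborel)" for L
  proof -
    have "ennreal (plate_avg \<delta> f L a powr s) * ennreal V \<le> (\<integral>\<^sup>+b. avg_sup D s \<delta> (g b) L \<partial>lborel)" if a: "a \<in> D" for a
    proof -
      have "ennreal (plate_avg \<delta> f L a powr s) * ennreal V = (\<integral>\<^sup>+b. ennreal (plate_avg \<delta> f L a powr s) * indicator (ball a 1) b \<partial>lborel)"
        by (simp add: nn_integral_cmult_indicator V1)
      also have "\<dots> \<le> (\<integral>\<^sup>+b. avg_sup D s \<delta> (g b) L \<partial>lborel)"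
      proof (rule nn_integral_mono)
        fix b
        show "ennreal (plate_avg \<delta> f L a powr s) * indicator (ball a 1) b \<le> avg_sup D s \<delta> (g b) L"
        proof (cases "b \<in> ball a 1")
          case True
          have "indicator (plate \<delta> L a) x * g b x = indicator (plate \<delta> L a) x * f x" for x
          proof (cases "x \<in> plate \<delta> L a")
            case x: True
            then have "dist a x < 1" using plate_subset_ball[OF \<delta>(2), of L a] by auto
            then have "dist b x < 2" using True dist_triangle_less_add[of b a 1 x 1] by (simp add: dist_commute)
            then show ?thesis by (simp add: g_def)
          qed simp
          then have "plate_avg \<delta> (g b) L a = plate_avg \<delta> f L a" by (simp only: plate_avg_def)
          then show ?thesis using True a unfolding avg_sup_def
            by (auto intro: SUP_upper2[of a])
        qed simp
      qed
      finally show ?thesis .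
    qed
    then show ?thesis
      unfolding avg_sup_def by (subst SUP_mult_right_ennreal) (rule SUP_least)
  qed
  \<comment> \<open>Because 1 \<le> e, the local bounds become linear in the local masses
    \<open>Fb b\<close> and can be integrated over \<open>b\<close>.\<close>
  have e1: "Fb b powr e \<le> F powr (e - 1) * Fb b" for b
  proof (cases "Fb b = 0")
    case False
    then have "0 < Fb b" using Fb0[of b] by simp
    then have "Fb b powr e = Fb b powr (e - 1) * Fb b" by (simp add: powr_diff)
    also have "\<dots> \<le> F powr (e - 1) * Fb b" using FbF Fb0 e by (intro mult_right_mono powr_mono2) auto
    finally show ?thesis .
  qed simp
  have Fb_meas: "(\<lambda>b. ennreal (Fb b)) \<in> borel_measurable lborel"
  proof -
    have "(\<lambda>b. \<integral>\<^sup>+x. ennreal (if dist b x < 2 then f x powr u else 0) \<partial>lborel) \<in> borel_measurable lborel" by measurable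
    moreover have "(\<integral>\<^sup>+x. ennreal (if dist b x < 2 then f x powr u else 0) \<partial>lborel) = ennreal (Fb b)" for b
      unfolding Fbn[symmetric] gf by (intro nn_integral_cong) (auto simp: indicator_def)
    ultimately show ?thesis by simp
  qed
  \<comment> \<open>Each point is seen by the centres within distance 2. Against the unit ball
    volume \<open>V\<close> of the lower bound, this overlap leaves the factor
    \<open>2 ^ CARD('n)\<close>.\<close>
  have Fb_int: "(\<integral>\<^sup>+b. ennreal (Fb b) \<partial>lborel) = ennreal (F * (V * 2 ^ CARD('n)))"
  proof -
    have "(\<integral>\<^sup>+b. ennreal (Fb b) \<partial>lborel) = (\<integral>\<^sup>+b. (\<integral>\<^sup>+x. ennreal (f x powr u) * (if dist b x < 2 then 1 else 0) \<partial>lborel) \<partial>lborel)"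
      unfolding Fbn[symmetric] gf by (intro nn_integral_cong) (auto simp: indicator_def)
    also have "\<dots> = (\<integral>\<^sup>+x. (\<integral>\<^sup>+b. ennreal (f x powr u) * (if dist b x < 2 then 1 else 0) \<partial>lborel) \<partial>lborel)"
      by (rule lborel_pair.Fubini') measurable
    also have "\<dots> = (\<integral>\<^sup>+x. ennreal (f x powr u) * ennreal (V * 2 ^ CARD('n)) \<partial>lborel)"
    proof (rule nn_integral_cong)
      fix x :: "real^'n"
      have "(\<integral>\<^sup>+b. ennreal (f x powr u) * (if dist b x < 2 then 1 else 0) \<partial>lborel) = (\<integral>\<^sup>+b. ennreal (f x powr u) * indicator (ball x 2) b \<partial>lborel)"
        by (intro nn_integral_cong) (auto simp: indicator_def dist_commute)
      then show "(\<integral>\<^sup>+b. ennreal (f x powr u) * (if dist b x < 2 then 1 else 0) \<partial>lborel) = ennreal (f x powr u) * ennreal (V * 2 ^ CARD('n))"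
        by (simp add: nn_integral_cmult_indicator V2)
    qed
    also have "\<dots> = ennreal F * ennreal (V * 2 ^ CARD('n))" by (simp add: nn_integral_multc Fn)
    also have "\<dots> = ennreal (F * (V * 2 ^ CARD('n)))" using F0 V by (simp add: ennreal_mult)
    finally show ?thesis .
  qed
  have f_avg: "avg_sup D s \<delta> f \<in> borel_measurable M"
    using measurable_avg_sup[OF D \<delta>(1), of "\<lambda>L. L" M m "\<lambda>_. f" s] by (simp add: measurable_cong_sets[OF refl M(1)[symmetric]])
  have "(\<integral>\<^sup>+L. avg_sup D s \<delta> f L \<partial>M) * ennreal V = (\<integral>\<^sup>+L. avg_sup D s \<delta> f L * ennreal V \<partial>M)"
    using f_avg by (rule nn_integral_multc[symmetric])
  also have "\<dots> \<le> (\<integral>\<^sup>+L. (\<integral>\<^sup>+b. avg_sup D s \<delta> (g b) L \<partial>lborel) \<partial>M)"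
    by (intro nn_integral_mono pw)
  also have "\<dots> = (\<integral>\<^sup>+b. (\<integral>\<^sup>+L. avg_sup D s \<delta> (g b) L \<partial>M) \<partial>lborel)"
    by (rule Fubini'[symmetric]) (use G_meas in \<open>simp add: case_prod_beta\<close>)
  also have "\<dots> \<le> (\<integral>\<^sup>+b. ennreal (K * F powr (e - 1)) * ennreal (Fb b) \<partial>lborel)"
  proof (rule nn_integral_mono)
    fix b
    have "(\<integral>\<^sup>+L. avg_sup D s \<delta> (g b) L \<partial>M) \<le> ennreal (K * Fb b powr e)" unfolding Fb_def by (rule loc[OF g])
    also have "\<dots> \<le> ennreal (K * (F powr (e - 1) * Fb b))" using K e1 by (intro ennreal_leI mult_left_mono)
    finally show "(\<integral>\<^sup>+L. avg_sup D s \<delta> (g b) L \<partial>M) \<le> ennreal (K * F powr (e - 1)) * ennreal (Fb b)"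
      using K Fb0[of b] by (simp add: ennreal_mult[symmetric] mult.assoc)
  qed
  also have "\<dots> = ennreal (K * F powr (e - 1)) * ennreal (F * (V * 2 ^ CARD('n)))"
    using Fb_meas by (simp add: nn_integral_cmult Fb_int)
  also have "\<dots> = ennreal (2 ^ CARD('n) * K * F powr e) * ennreal V"
  proof -
    have "F powr (e - 1) * F = F powr e" using F0 by (cases "F = 0") (auto simp: powr_diff)
    then have "K * F powr (e - 1) * (F * (V * 2 ^ CARD('n))) = 2 ^ CARD('n) * K * F powr e * V"
      by (metis (no_types, opaque_lifting) mult.assoc mult.commute)
    then show ?thesis using K F0 V by (simp add: ennreal_mult[symmetric])
  qed
  finally have "(\<integral>\<^sup>+L. avg_sup D s \<delta> f L \<partial>M) * ennreal V / ennreal V \<le> ennreal (2 ^ CARD('n) * K * F powr e) * ennreal V / ennreal V"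
    by (rule divide_right_mono_ennreal)
  then show ?thesis using V by (simp add: mult_divide_eq_ennreal F_def)
qed

text \<open>The truncations of \<open>f\<close> at height n increase to \<open>f\<close>, so every
  single average converges. The supremum of the limits is at most the lower limit of the suprema,
  and Fatou passes the uniform bound to the integral.\<close>

lemma truncate_bound:
  fixes f :: "real^'n \<Rightarrow> real" and M :: "(real^'n) set measure"
  assumes bd: "\<And>H f. f \<in> borel_measurable borel \<Longrightarrow> (\<And>x. 0 \<le> f x) \<Longrightarrow> (\<And>x. f x \<le> H) \<Longrightarrow> integrable lborel (\<lambda>x. f x powr u) \<Longrightarrow>
      (\<integral>\<^sup>+L. avg_sup D s \<delta> f L \<partial>M) \<le> ennreal (K * (LINT x|lborel. f x powr u) powr e)"
    and M: "sets M = sets (grass_borel m)" and D: "countable D"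
    and \<delta>: "0 < \<delta>" "\<delta> \<le> 1/2" and K: "0 \<le> K" and u: "1 \<le> u" and e: "0 \<le> e" and s: "0 < s"
    and f: "f \<in> borel_measurable borel" "\<And>x. 0 \<le> f x" "integrable lborel (\<lambda>x. f x powr u)"
  shows "(\<integral>\<^sup>+L. avg_sup D s \<delta> f L \<partial>M) \<le> ennreal (K * (LINT x|lborel. f x powr u) powr e)"
proof -
  note [measurable] = f(1)
  interpret avg: locally_bounded_average f u \<delta>
    by unfold_locales (use f u \<delta> in auto)
  define F where "F = (LINT x|lborel. f x powr u)"
  define h where "h n x = min (f x) (real n)" for n x
  have [measurable]: "h n \<in> borel_measurable borel" for n unfolding h_def by measurable
  have h0: "0 \<le> h n x" and hf: "h n x \<le> f x" for n x using f(2)[of x] by (auto simp: h_def)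
  have hint: "integrable lborel (\<lambda>x. h n x powr u)" for n
    by (rule Bochner_Integration.integrable_bound[OF f(3)]) (use h0 hf u f(2) in \<open>auto intro!: powr_mono2\<close>)
  have hF: "(LINT x|lborel. h n x powr u) \<le> F" for n
    unfolding F_def using h0 hf u by (intro integral_mono hint f(3) powr_mono2) auto
  have hbd: "(\<integral>\<^sup>+L. avg_sup D s \<delta> (h n) L \<partial>M) \<le> ennreal (K * F powr e)" for n
  proof -
    have "(\<integral>\<^sup>+L. avg_sup D s \<delta> (h n) L \<partial>M) \<le> ennreal (K * (LINT x|lborel. h n x powr u) powr e)"
      by (rule bd[of _ "real n"]) (use h0 hint in \<open>auto simp: h_def\<close>)
    also have "\<dots> \<le> ennreal (K * F powr e)"
      using K e hF by (intro ennreal_leI mult_left_mono powr_mono2) (auto intro!: Bochner_Integration.integral_nonneg)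
    finally show ?thesis .
  qed
  have lim: "(\<lambda>n. ennreal (plate_avg \<delta> (h n) L a powr s)) \<longlonglongrightarrow> ennreal (plate_avg \<delta> f L a powr s)" for L a
  proof -
    have "(\<lambda>n. LINT y|lborel. indicator (plate \<delta> L a) y * h n y) \<longlonglongrightarrow> (LINT y|lborel. indicator (plate \<delta> L a) y * f y)"
    proof (rule integral_dominated_convergence[where w="\<lambda>y. indicator (plate \<delta> L a) y * f y"])
      show "AE y in lborel. (\<lambda>n. indicator (plate \<delta> L a) y * h n y) \<longlonglongrightarrow> indicator (plate \<delta> L a) y * f y"
      proof (rule AE_I2)
        fix y
        obtain N where N: "f y \<le> real N" using real_arch_simple by blast
        have "\<forall>\<^sub>F n in sequentially. indicator (plate \<delta> L a) y * h n y = indicator (plate \<delta> L a) y * f y"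
          using eventually_ge_at_top[of N] by eventually_elim (use N in \<open>auto simp: h_def\<close>)
        then show "(\<lambda>n. indicator (plate \<delta> L a) y * h n y) \<longlonglongrightarrow> indicator (plate \<delta> L a) y * f y" by (rule tendsto_eventually)
      qed
      show "AE y in lborel. norm (indicator (plate \<delta> L a) y * h n y) \<le> indicator (plate \<delta> L a) y * f y" for n
        using h0 hf by (intro AE_I2) (auto simp: indicator_def)
    qed (use avg.integrable_plate in auto)
    then have "(\<lambda>n. plate_avg \<delta> (h n) L a) \<longlonglongrightarrow> plate_avg \<delta> f L a"
      unfolding plate_avg_def divide_inverse by (intro tendsto_mult tendsto_const)
    moreover have "\<forall>\<^sub>F n in sequentially. 0 \<le> plate_avg \<delta> (h n) L a"
      by (intro always_eventually allI plate_avg_nonneg h0)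
    ultimately show ?thesis using s by (intro tendsto_ennrealI tendsto_powr') auto
  qed
  have "(\<integral>\<^sup>+L. avg_sup D s \<delta> f L \<partial>M) \<le> (\<integral>\<^sup>+L. liminf (\<lambda>n. avg_sup D s \<delta> (h n) L) \<partial>M)"
  proof (rule nn_integral_mono)
    fix L
    show "avg_sup D s \<delta> f L \<le> liminf (\<lambda>n. avg_sup D s \<delta> (h n) L)"
      unfolding avg_sup_def[of D s \<delta> f]
    proof (rule SUP_least)
      fix a assume a: "a \<in> D"
      have "ennreal (plate_avg \<delta> f L a powr s) = liminf (\<lambda>n. ennreal (plate_avg \<delta> (h n) L a powr s))"
        using lim_imp_Liminf[OF sequentially_bot lim[of L a]] by simp
      also have "\<dots> \<le> liminf (\<lambda>n. avg_sup D s \<delta> (h n) L)"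
        by (intro Liminf_mono always_eventually allI) (auto simp: avg_sup_def intro: SUP_upper a)
      finally show "ennreal (plate_avg \<delta> f L a powr s) \<le> liminf (\<lambda>n. avg_sup D s \<delta> (h n) L)" .
    qed
  qed
  also have "\<dots> \<le> liminf (\<lambda>n. \<integral>\<^sup>+L. avg_sup D s \<delta> (h n) L \<partial>M)"
  proof (rule nn_integral_liminf)
    show "avg_sup D s \<delta> (h n) \<in> borel_measurable M" for n
      using measurable_avg_sup[OF D \<delta>(1), of "\<lambda>L. L" M m "\<lambda>_. h n" s] by (simp add: measurable_cong_sets[OF refl M[symmetric]])
  qed
  also have "\<dots> \<le> liminf (\<lambda>n. ennreal (K * F powr e))"
    by (intro Liminf_mono always_eventually allI hbd)
  also have "\<dots> = ennreal (K * F powr e)" by (simp add: Liminf_const)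
  finally show ?thesis unfolding F_def .
qed

text \<open>Since \<open>f\<close> may change sign, the absolute value of the maximal function needs
  a lower bound as well; a single centre of \<open>D\<close> supplies it. An infinite right side is
  trivial.\<close>

lemma (in locally_bounded_average) plate_maximal_powr_le_avg_sup:
  fixes L :: "'a set"
  assumes L: "subspace L" and D: "\<And>X. open X \<Longrightarrow> X \<noteq> {} \<Longrightarrow> \<exists>d\<in>D. d \<in> X" and r: "0 < r"
  shows "ennreal (\<bar>plate_maximal \<delta> f L\<bar> powr r) \<le> (SUP a\<in>D. ennreal (plate_avg \<delta> (\<lambda>x. \<bar>f x\<bar>) L a powr r))" (is "_ \<le> ?G")
proof (cases ?G)
  case (real c)
  have le: "\<bar>plate_avg \<delta> f L a\<bar> \<le> c powr (1 / r)" if a: "a \<in> D" for a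
  proof -
    have "ennreal (plate_avg \<delta> (\<lambda>x. \<bar>f x\<bar>) L a powr r) \<le> ennreal c"
      unfolding real(2)[symmetric] using a by (rule SUP_upper)
    then have "plate_avg \<delta> (\<lambda>x. \<bar>f x\<bar>) L a powr r \<le> c" using real(1) by simp
    then have "(plate_avg \<delta> (\<lambda>x. \<bar>f x\<bar>) L a powr r) powr (1 / r) \<le> c powr (1 / r)"
      using r by (intro powr_mono2) auto
    moreover have "0 \<le> plate_avg \<delta> (\<lambda>x. \<bar>f x\<bar>) L a"
      unfolding plate_avg_def plate_vol_def by (intro divide_nonneg_nonneg Bochner_Integration.integral_nonneg) auto
    ultimately have "plate_avg \<delta> (\<lambda>x. \<bar>f x\<bar>) L a \<le> c powr (1 / r)" using r by (simp add: powr_powr)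
    then show ?thesis using plate_avg_abs_le[of L a] by linarith
  qed
  obtain d where d: "d \<in> D" using D[of UNIV] by auto
  have "plate_maximal \<delta> f L = (SUP a\<in>D. plate_avg \<delta> f L a)" by (rule plate_maximal_dense[OF L D])
  also have "\<dots> \<le> c powr (1 / r)"
  proof (rule cSUP_least)
    show "plate_avg \<delta> f L a \<le> c powr (1 / r)" if "a \<in> D" for a using le[OF that] by linarith
  qed (use d in blast)
  finally have "plate_maximal \<delta> f L \<le> c powr (1 / r)" .
  moreover have "plate_avg \<delta> f L d \<le> plate_maximal \<delta> f L"
    unfolding plate_maximal_eq[OF f \<delta>] using bdd_above_plate_avg(1)[OF L] by (intro cSUP_upper) auto
  ultimately have "\<bar>plate_maximal \<delta> f L\<bar> \<le> c powr (1 / r)" using le[OF d] by linarith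
  then have "\<bar>plate_maximal \<delta> f L\<bar> powr r \<le> (c powr (1 / r)) powr r" using r by (intro powr_mono2) auto
  also have "\<dots> = c" using r real(1) by (simp add: powr_powr)
  finally show ?thesis unfolding real(2) by (rule ennreal_leI)
next
  case top
  show ?thesis unfolding top by simp
qed

section \<open>Matching of the exponents, and passage from Lebesgue measurable to Borel
  functions\<close>

theorem proposition3p1:
  fixes d k :: nat and p q r \<alpha> C \<epsilon> \<alpha>' p' q' :: real
  assumes "CARD('n::finite) = d" and "CARD('m::finite) = d - 1"
    and "2 \<le> k" and "k < d"
    and "2 \<le> p" and "p \<le> real d + 1"
    and "p \<le> r" and "p \<noteq> 2 \<longrightarrow> r \<le> p * (real d - 1) / (p - 2)"
    and "p * r / (p + r) \<le> q" and "q \<le> r"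
    and "\<forall>\<delta> f. 0 < \<delta> \<longrightarrow> \<delta> \<le> 1/2 \<longrightarrow> f \<in> Lp_space (lebesgue :: (real^'m) measure) p \<longrightarrow>
           plate_maximal \<delta> f \<in> Lp_space (grassmann_measure (k - 1)) q \<and>
           Lp_norm (grassmann_measure (k - 1)) q (plate_maximal \<delta> f)
             \<le> C * \<delta> powr (- (\<alpha> / p)) * Lp_norm lebesgue p f"
    and "\<epsilon> > 0"
    and "\<alpha>' = r * \<alpha> / (p + r) + \<epsilon>"
    and "p' = (p * (real d - 1) + 2 * r) / (p + r)"
    and "q' = p' * q * (p + r) / (p * r)"
  shows "\<exists>C'. \<forall>\<delta> f. 0 < \<delta> \<longrightarrow> \<delta> \<le> 1/2 \<longrightarrow> f \<in> Lp_space (lebesgue :: (real^'n) measure) p' \<longrightarrow>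
           plate_maximal \<delta> f \<in> Lp_space (grassmann_measure k) q' \<and>
           Lp_norm (grassmann_measure k) q' (plate_maximal \<delta> f)
             \<le> C' * \<delta> powr (- (\<alpha>' / p')) * Lp_norm lebesgue p' f"
proof -
  obtain i0 :: 'n where True by simp
  have "card (UNIV :: 'm set) = card (UNIV - {i0})" using assms(1,2) by (simp add: card_Diff_singleton)
  then obtain \<sigma> :: "'m \<Rightarrow> 'n" where "bij_betw \<sigma> UNIV (UNIV - {i0})"
    using finite_same_card_bij[of "UNIV :: 'm set" "UNIV - {i0}"] by auto
  then interpret coordinate_split i0 \<sigma> by unfold_locales
  define m where "m = k - 1"
  have k: "k = Suc m" "m \<le> CARD('m)" using assms(2-4) by (auto simp: m_def)
  have dn: "real CARD('n) = real d" "1 \<le> real d - 1" using assms(1,3,4) by auto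
  \<comment> \<open>\<open>R\<close> is the outer exponent of the mixed norm bound, R/\<rho> = p/t
    the inner one, and \<open>\<eta>\<close> the power of the inner integral that each fibre
    produces.\<close>
  define \<rho> where "\<rho> = r / p"
  define R where "R = real d - 1 + 2 * \<rho>"
  define t where "t = r / R"
  define \<eta> where "\<eta> = q / p"
  have p0: "0 < p" and r0: "0 < r" using assms(5,7) by auto
  have q0: "0 < q" using assms(9) p0 r0 by (intro less_le_trans[OF _ assms(9)]) simp
  have \<rho>: "1 \<le> \<rho>" using assms(7) p0 by (simp add: \<rho>_def)
  have R0: "0 < R" using \<rho> dn unfolding R_def by linarith
  have pR: "p * R = p * (real d - 1) + 2 * r" using p0 by (simp add: R_def \<rho>_def field_simps)
  have t: "0 < t" "t \<le> 1"
  proof -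
    show "0 < t" using r0 R0 by (simp add: t_def)
    have "r * (p - 2) \<le> p * (real d - 1)"
    proof (cases "p = 2")
      case False
      then show ?thesis using assms(5,8) by (simp add: pos_le_divide_eq)
    qed (use dn p0 in simp)
    then have "p * r \<le> p * R" unfolding pR by (simp add: algebra_simps)
    then have "r \<le> R" using p0 by simp
    then show "t \<le> 1" using R0 by (simp add: t_def)
  qed
  have pt: "p / t = R / \<rho>" using p0 r0 R0 by (simp add: t_def \<rho>_def)
  have p': "p' = R / (1 + \<rho>)" unfolding assms(14) pR[symmetric] \<rho>_def using p0 r0 by (simp add: field_simps)
  have p'0: "0 < p'" "1 \<le> p'"
  proof -
    show "0 < p'" unfolding p' using R0 \<rho> by simp
    have "1 + \<rho> \<le> R" unfolding R_def using \<rho> dn by linarith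
    then show "1 \<le> p'" unfolding p' using \<rho> by simp
  qed
  have q': "q' = q / t"
  proof -
    have "p' * (p + r) = p * R" using assms(14) pR p0 r0 by simp
    moreover have "p' * q * (p + r) = (p' * (p + r)) * q" by (simp only: mult_ac)
    ultimately have "q' = p * R * q / (p * r)" unfolding assms(15) by (simp only:)
    then show ?thesis using p0 r0 R0 by (simp add: t_def mult.commute)
  qed
  have q'0: "0 < q'" unfolding q' using q0 t by simp
  have \<eta>: "\<eta> \<le> \<rho>" unfolding \<eta>_def \<rho>_def using assms(10) p0 by (intro divide_right_mono) auto
  \<comment> \<open>This is q'/p', the power to which the integral of |f|^p' gets raised; 1 \<le> e
    is a rewriting of the lower bound on \<open>q\<close>.\<close>
  define e where "e = (1 + \<rho>) * \<eta> / \<rho>"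
  have e1: "1 \<le> e"
  proof -
    have "e = q * (p + r) / (p * r)" using p0 r0 by (simp add: e_def \<rho>_def \<eta>_def field_simps)
    moreover have "p * r \<le> q * (p + r)" using assms(9) p0 r0 by (simp add: pos_divide_le_eq)
    ultimately show ?thesis using p0 r0 by simp
  qed
  have eq': "e / q' = 1 / p'"
    unfolding e_def q' p' \<eta>_def t_def \<rho>_def using p0 q0 r0 R0 by (simp add: field_simps)
  define K1 where "K1 = local_const q' \<rho> \<eta>"
  have K1: "0 \<le> K1" by (simp add: K1_def local_const_def)
  \<comment> \<open>All constants under the q'-th root. The absolute value allows a negative
    \<open>C\<close>, for which the hypothesis holds with |C| in its place.\<close>
  define C' where "C' = (2 ^ CARD('n) * K1 * \<bar>C\<bar> powr q) powr (1 / q')"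
  show ?thesis
  proof (intro exI[of _ C'] allI impI)
    fix \<delta> :: real and f0 :: "real^'n \<Rightarrow> real"
    assume \<delta>: "0 < \<delta>" "\<delta> \<le> 1/2" and f0: "f0 \<in> Lp_space lebesgue p'"
    define A where "A = \<bar>C\<bar> * \<delta> powr (- (\<alpha> / p))"
    have A: "0 \<le> A" by (simp add: A_def)
    have hyp: "plate_maximal \<delta> g \<in> Lp_space (grassmann_measure m) q \<and>
       Lp_norm (grassmann_measure m) q (plate_maximal \<delta> g) \<le> A * Lp_norm lebesgue p g"
      if g: "g \<in> Lp_space lebesgue p" for g :: "real^'m \<Rightarrow> real"
    proof -
      have "C * \<delta> powr (- (\<alpha> / p)) * Lp_norm lebesgue p g \<le> A * Lp_norm lebesgue p g"
        unfolding A_def by (intro mult_right_mono) (auto simp: Lp_norm_def)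
      then show ?thesis using assms(11) \<delta> g unfolding m_def by (meson order_trans)
    qed
    \<comment> \<open>Slicing along lines works with Borel functions. Changing \<open>f0\<close> on
      a null set alters no average, hence the maximal function at no plane, and it leaves the norm
      unchanged.\<close>
    obtain f where f [measurable]: "f \<in> borel_measurable borel" and AE: "AE x in lborel. f0 x = f x"
      using completion_ex_borel_measurable_real[of f0 lborel] f0 by (auto simp: Lp_space_def)
    have AEl: "AE x in lebesgue. f0 x = f x" using AE by (rule AE_completion)
    have fl: "f \<in> borel_measurable lebesgue" and f0l: "f0 \<in> borel_measurable lebesgue"
      using f0 by (auto simp: Lp_space_def intro: measurable_completion)
    have mx: "plate_maximal \<delta> f0 = plate_maximal \<delta> f"
    proof (rule ext)
      fix L :: "(real^'n) set"
      have "(LINT y : plate \<delta> L a | lebesgue. f0 y) = (LINT y : plate \<delta> L a | lebesgue. f y)" for a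
      proof -
        note [measurable] = f0l fl
        have [measurable]: "plate \<delta> L a \<in> sets lebesgue" by simp
        have "AE x in lebesgue. indicator (plate \<delta> L a) x *\<^sub>R f0 x = indicator (plate \<delta> L a) x *\<^sub>R f x"
          using AEl by eventually_elim simp
        then show ?thesis unfolding set_lebesgue_integral_def
          by (intro integral_cong_AE) measurable
      qed
      then show "plate_maximal \<delta> f0 L = plate_maximal \<delta> f L" by (simp add: plate_maximal_def)
    qed
    define F where "F = (LINT x|lborel. \<bar>f x\<bar> powr p')"
    have F0: "0 \<le> F" unfolding F_def by (intro Bochner_Integration.integral_nonneg) simp
    have fp: "(\<lambda>x. \<bar>f x\<bar> powr p') \<in> borel_measurable lborel" by measurable
    have il: "integrable lebesgue (\<lambda>x. \<bar>f x\<bar> powr p')"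
    proof (rule integrable_cong_AE_imp)
      show "integrable lebesgue (\<lambda>x. \<bar>f0 x\<bar> powr p')" using f0 by (simp add: Lp_space_def)
      show "(\<lambda>x. \<bar>f x\<bar> powr p') \<in> borel_measurable lebesgue" using fl by measurable
      show "AE x in lebesgue. \<bar>f0 x\<bar> powr p' = \<bar>f x\<bar> powr p'" using AEl by eventually_elim simp
    qed
    have ib: "integrable lborel (\<lambda>x. \<bar>f x\<bar> powr p')" using il fp by (simp add: integrable_completion)
    have nF: "Lp_norm lebesgue p' f0 = F powr (1 / p')"
    proof -
      have "(LINT x|lebesgue. \<bar>f0 x\<bar> powr p') = (LINT x|lebesgue. \<bar>f x\<bar> powr p')"
        using AEl f0l fl by (intro integral_cong_AE) auto
      also have "\<dots> = F" unfolding F_def using fp by (rule integral_completion)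
      finally show ?thesis by (simp add: Lp_norm_def)
    qed
    interpret avg: locally_bounded_average f p' \<delta>
      by unfold_locales (use p'0 ib \<delta> in auto)
    obtain D :: "(real^'n) set" where D: "countable D" "\<And>X. open X \<Longrightarrow> X \<noteq> {} \<Longrightarrow> \<exists>d\<in>D. d \<in> X"
      using countable_dense_setE by blast
    define M where "M = (grassmann_measure k :: (real^'n) set measure)"
    have kn: "k \<le> CARD('n)" using assms(1,4) by simp
    note inv = invariant_radon_prob_grassmann_measure[OF kn, folded M_def]
    have sM: "sets M = sets (grass_borel k)" using invariant_radon_probD(1)[OF inv] .
    have spM: "space M = grassmannian k" using sM by (auto dest: sets_eq_imp_space_eq)
    have finM: "finite_measure M" using invariant_radon_probD(2)[OF inv] by (intro finite_measureI) auto
    have loc: "(\<integral>\<^sup>+L. avg_sup D q' \<delta> g L \<partial>M) \<le> ennreal (K1 * A powr q * (LINT x|lborel. g x powr p') powr e)"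
      if g: "bump H b g" for H b and g :: "real^'n \<Rightarrow> real"
      using local_bound[OF hyp k(2) A p0 q0 t \<rho> _ _ \<delta> g D(1)] pt \<eta>
      by (simp add: dn(1) R_def M_def k(1) K1_def q' p' e_def \<eta>_def)
    have glob: "(\<integral>\<^sup>+L. avg_sup D q' \<delta> g L \<partial>M) \<le> ennreal (2 ^ CARD('n) * (K1 * A powr q) * (LINT x|lborel. g x powr p') powr e)"
      if "g \<in> borel_measurable borel" "\<And>x. 0 \<le> g x" "\<And>x. g x \<le> H" "integrable lborel (\<lambda>x. g x powr p')" for H g
      by (rule globalize_bound[OF loc sM finM D(1) \<delta> _ p'0(1) e1 that]) (use K1 in auto)
    define B where "B = 2 ^ CARD('n) * (K1 * A powr q) * F powr e"
    have B0: "0 \<le> B" using K1 by (simp add: B_def)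
    have Bd: "(\<integral>\<^sup>+L. avg_sup D q' \<delta> (\<lambda>x. \<bar>f x\<bar>) L \<partial>M) \<le> ennreal B"
      unfolding B_def F_def
      by (rule truncate_bound[OF glob sM D(1) \<delta> _ p'0(2) _ q'0]) (use K1 e1 ib in auto)
    have pm_meas [measurable]: "plate_maximal \<delta> f \<in> borel_measurable M"
    proof -
      have "(\<lambda>L. SUP a\<in>D. plate_avg \<delta> f L a) \<in> borel_measurable M"
      proof (rule borel_measurable_cSUP[OF D(1)])
        show "(\<lambda>L. plate_avg \<delta> f L a) \<in> borel_measurable M" for a
          using measurable_plate_avg[OF \<delta>(1), of "\<lambda>L. L" M k "\<lambda>_. f" a]
          by (simp add: measurable_cong_sets[OF refl sM[symmetric]])
        show "bdd_above ((\<lambda>a. plate_avg \<delta> f L a) ` D)" if "L \<in> space M" for L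
          using avg.bdd_above_plate_avg(1)[of L] that by (auto simp: spM grassmannian_def intro: bdd_above_mono)
      qed
      moreover have "plate_maximal \<delta> f L = (SUP a\<in>D. plate_avg \<delta> f L a)" if "L \<in> space M" for L
        using that D(2) by (intro avg.plate_maximal_dense) (auto simp: spM grassmannian_def)
      ultimately show ?thesis by (rule measurable_cong[THEN iffD2, rotated])
    qed
    have pmB: "(\<integral>\<^sup>+L. ennreal (\<bar>plate_maximal \<delta> f L\<bar> powr q') \<partial>M) \<le> ennreal B"
    proof (rule order_trans[OF nn_integral_mono Bd])
      fix L assume "L \<in> space M"
      then show "ennreal (\<bar>plate_maximal \<delta> f L\<bar> powr q') \<le> avg_sup D q' \<delta> (\<lambda>x. \<bar>f x\<bar>) L"
        unfolding avg_sup_def using D(2) q'0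
        by (intro avg.plate_maximal_powr_le_avg_sup) (auto simp: spM grassmannian_def)
    qed
    have pm_int: "integrable M (\<lambda>L. \<bar>plate_maximal \<delta> f L\<bar> powr q')"
      by (rule integrableI_nonneg) (use pmB in \<open>auto intro: le_less_trans\<close>)
    define Y where "Y = (LINT L|M. \<bar>plate_maximal \<delta> f L\<bar> powr q')"
    have Y0: "0 \<le> Y" unfolding Y_def by (intro Bochner_Integration.integral_nonneg) simp
    have "ennreal Y = (\<integral>\<^sup>+L. ennreal (\<bar>plate_maximal \<delta> f L\<bar> powr q') \<partial>M)"
      unfolding Y_def by (rule nn_integral_eq_integral[OF pm_int, symmetric]) simp
    then have "ennreal Y \<le> ennreal B" using pmB by (simp only:)
    then have "Y \<le> B" using B0 by (simp add: ennreal_le_iff)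
    then have "Y powr (1 / q') \<le> B powr (1 / q')" using Y0 q'0 by (intro powr_mono2) auto
    also have "B = (2 ^ CARD('n) * K1 * \<bar>C\<bar> powr q) * (\<delta> powr (- (\<alpha> / p))) powr q * F powr e"
      by (simp add: B_def A_def powr_mult mult_ac)
    also have "\<dots> powr (1 / q') = C' * \<delta> powr (- (\<alpha> / p) * (q * (1 / q'))) * F powr (e * (1 / q'))"
      using K1 by (simp add: C'_def powr_mult powr_powr)
    also have "e * (1 / q') = 1 / p'" using eq' by simp
    also have "C' * \<delta> powr (- (\<alpha> / p) * (q * (1 / q'))) * F powr (1 / p') \<le> C' * \<delta> powr (- (\<alpha>' / p')) * F powr (1 / p')"
    proof -
      \<comment> \<open>Since q/q' = t = r/R and p' = R p / (p + r), taking the q'-th root of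
        \<open>A powr q\<close> yields exactly this power of \<delta>. The comparison with \<alpha>'
        that follows uses \<delta> \<le> 1.\<close>
      have "- (\<alpha> / p) * (q * (1 / q')) = - (r * \<alpha> / (p + r)) / p'"
      proof -
        have "p' = R * p / (p + r)" unfolding p' \<rho>_def using p0 r0 by (simp add: field_simps)
        moreover have "q * (1 / q') = r / R" using q0 by (simp add: q' t_def)
        moreover have "p + r \<noteq> 0" using p0 r0 by simp
        ultimately show ?thesis using p0 R0 by (simp add: mult_ac)
      qed
      also have "\<dots> \<ge> - (\<alpha>' / p')"
      proof -
        have "r * \<alpha> / (p + r) / p' \<le> \<alpha>' / p'"
          using p'0 assms(12) by (intro divide_right_mono) (auto simp: assms(13))
        then show ?thesis by (simp only: minus_divide_left[symmetric] neg_le_iff_le)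
      qed
      finally have "\<delta> powr (- (\<alpha> / p) * (q * (1 / q'))) \<le> \<delta> powr (- (\<alpha>' / p'))"
        using \<delta> by (intro powr_mono') auto
      then show ?thesis by (intro mult_right_mono mult_left_mono) (auto simp: C'_def)
    qed
    finally have "Y powr (1 / q') \<le> C' * \<delta> powr (- (\<alpha>' / p')) * F powr (1 / p')" .
    then show "plate_maximal \<delta> f0 \<in> Lp_space (grassmann_measure k) q' \<and>
           Lp_norm (grassmann_measure k) q' (plate_maximal \<delta> f0)
             \<le> C' * \<delta> powr (- (\<alpha>' / p')) * Lp_norm lebesgue p' f0"
      unfolding mx nF using pm_int pm_meas by (simp add: Lp_space_def Lp_norm_def M_def Y_def)
  qed
qed

end
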